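(* Let $d\ge1$, $L\ge1$ be integers, $\Lambda_n(d)=[-n^{1/d},n^{1/d}]^d\cap\mathbb{Z}^d$, and $\mathbf{Q}_{ij}=\mathbf{1}(0<\|i-j\|_1\le L)$ for $i,j\in\Lambda_n(d)$. Let $0\le\beta<\beta_c(d,L)$ and $\mathbf{X}\sim\mathbb{P}_{\beta,\mathbf{Q},\boldsymbol{\mu}}$ on $\{\pm1\}^{\Lambda_n(d)}$. Consider testing $H_0:\boldsymbol{\mu}=\mathbf{0}$ against $H_1:\boldsymbol{\mu}\in\Xi(\mathcal{C}_n,s,A)$, where $\mathcal{C}_n$ is the class of all sub-cubes $\prod_{j=1}^d[a_j:b_j]$ contained in $\Lambda_n(d)$ with $a_j,b_j\in\mathbb{Z}$ and $b_j-a_j=\lceil s^{1/d}\rceil$ for all $j$. Then there exist positive constants $c,C$ depending on $\beta,L,d$ such that the following hold. (a) Suppose $s\le c\log n$. Then all tests are asymptotically powerless irrespective of $A$. (b) Suppose $s\ge C\log n$. Then there exist constants $c',C'>0$ such that if $\tanh(A)\ge C'\sqrt{\frac{\log n}{s}}$, there exists a sequence of asymptotically powerful tests; and if $\tanh(A)\le c'\sqrt{\frac{\log n}{s}}$, then all tests are asymptotically powerless.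
   Context: Ising model on a finite vertex set $V$: for a symmetric real array $\mathbf{Q}=(\mathbf{Q}_{ij})_{i,j\in V}$ with zero diagonal, $\beta\in\mathbb{R}$ and $\boldsymbol{\mu}\in\mathbb{R}^V$, $\mathbb{P}_{\beta,\mathbf{Q},\boldsymbol{\mu}}$ is the law on $\{\pm1\}^V$ with $\mathbb{P}_{\beta,\mathbf{Q},\boldsymbol{\mu}}(\mathbf{X}=\mathbf{x})=\frac{1}{Z(\beta,\mathbf{Q},\boldsymbol{\mu})}\exp\big(\frac{\beta}{2}\mathbf{x}^\top\mathbf{Q}\mathbf{x}+\boldsymbol{\mu}^\top\mathbf{x}\big)$, where $Z(\beta,\mathbf{Q},\boldsymbol{\mu})$ is the normalizing constant, with expectation $\mathbb{E}_{\beta,\mathbf{Q},\boldsymbol{\mu}}$. Here $V=\Lambda_n(d)$, and $[a:b]=\{a,a+1,\dots,b\}$. Critical temperature: let $\Lambda_n(d)=[-n^{1/d},n^{1/d}]^d\cap\mathbb{Z}^d$ and let $\mathbf{Q}$ be the array on $\Lambda_n(d)$ with $\mathbf{Q}_{ij}=\mathbf{1}(0<\|i-j\|_1\le L)$ for $i,j\in\Lambda_n(d)$. Then $\beta_c(d,L)=\inf\Big\{\beta>0:\ \lim_{h\downarrow0}\lim_{n\to\infty}\mathbb{E}_{\beta,\mathbf{Q},\boldsymbol{\mu}(h)}\big(\frac{1}{|\Lambda_n(d)|}\sum_{i\in\Lambda_n(d)}X_i\big)>0\Big\}$, where $\boldsymbol{\mu}(h)$ has all coordinates equal to $h$ (with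 $\inf\emptyset=+\infty$; existence of the limits is classical). Testing problem: $s=s_n$ is a positive integer with $s\le n^{1-\upsilon}$ for some fixed $\upsilon>0$; $A=A_n>0$; $\Xi(\mathcal{C}_n,s,A)=\{\boldsymbol{\mu}\in\mathbb{R}_+^V:\ \mathrm{supp}(\boldsymbol{\mu})\in\mathcal{C}_n,\ \min_{i\in\mathrm{supp}(\boldsymbol{\mu})}\mu_i\ge A\}$, with $\mathrm{supp}(\boldsymbol{\mu})=\{i:\mu_i\neq0\}$. A test is a function $T:\{\pm1\}^V\to\{0,1\}$ ($1$ means reject $H_0$), with $\mathrm{Risk}(T)=\mathbb{P}_{\beta,\mathbf{Q},\mathbf{0}}(T(\mathbf{X})=1)+\sup_{\boldsymbol{\mu}\in\Xi(\mathcal{C}_n,s,A)}\mathbb{P}_{\beta,\mathbf{Q},\boldsymbol{\mu}}(T(\mathbf{X})=0)$. A sequence of tests $T_n$ is asymptotically powerful if $\limsup_n\mathrm{Risk}(T_n)=0$ and asymptotically powerless if $\liminf_n\mathrm{Risk}(T_n)=1$; "all tests are asymptotically powerless" means every sequence of tests is. "Irrespective of $A$" means for every sequence $A=A_n>0$. The constants $c,C,c',C'$ do not depend on $n,s,A$; they may depend on $\beta,L,d,\upsilon$.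
   Formalization: "Asymptotically powerless" is taken as liminf Risk ≥ 1 instead of = 1: with equality for every test the claim fails, since the test accepting H_0 iff all spins of a fixed cube are +1 has risk at least 3/2. *)

theory Defs
  imports "HOL-Probability.Probability"
begin

definition spins :: "'v set \<Rightarrow> ('v \<Rightarrow> real) set" where
  "spins V = (V \<rightarrow>\<^sub>E {-1, 1})"

definition ising_weight ::
    "'v set \<Rightarrow> real \<Rightarrow> ('v \<Rightarrow> 'v \<Rightarrow> real) \<Rightarrow> ('v \<Rightarrow> real) \<Rightarrow> ('v \<Rightarrow> real) \<Rightarrow> real" where
  "ising_weight V \<beta> Q \<mu> x =
     exp (\<beta> / 2 * (\<Sum>i\<in>V. \<Sum>j\<in>V. x i * Q i j * x j) + (\<Sum>i\<in>V. \<mu> i * x i))"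

definition ising_Z ::
    "'v set \<Rightarrow> real \<Rightarrow> ('v \<Rightarrow> 'v \<Rightarrow> real) \<Rightarrow> ('v \<Rightarrow> real) \<Rightarrow> real" where
  "ising_Z V \<beta> Q \<mu> = (\<Sum>x\<in>spins V. ising_weight V \<beta> Q \<mu> x)"

definition ising ::
    "'v set \<Rightarrow> real \<Rightarrow> ('v \<Rightarrow> 'v \<Rightarrow> real) \<Rightarrow> ('v \<Rightarrow> real) \<Rightarrow> ('v \<Rightarrow> real) pmf" where
  "ising V \<beta> Q \<mu> =
     embed_pmf (\<lambda>x. if x \<in> spins V then ising_weight V \<beta> Q \<mu> x / ising_Z V \<beta> Q \<mu> else 0)"

lemma finite_spins: "finite V \<Longrightarrow> finite (spins V)"
  by (auto simp: spins_def intro: finite_PiE)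

lemma spins_nonempty: "spins V \<noteq> {}"
  by (auto simp: spins_def PiE_eq_empty_iff)

lemma ising_Z_pos: "finite V \<Longrightarrow> 0 < ising_Z V \<beta> Q \<mu>"
  unfolding ising_Z_def
  by (intro sum_pos finite_spins spins_nonempty) (simp_all add: ising_weight_def)

text \<open>The function passed to \<^const>\<open>embed_pmf\<close> is a probability mass function.\<close>

lemma pmf_ising:
  assumes "finite V"
  shows "pmf (ising V \<beta> Q \<mu>) x =
    (if x \<in> spins V then ising_weight V \<beta> Q \<mu> x / ising_Z V \<beta> Q \<mu> else 0)"
  unfolding ising_def
proof (rule pmf_embed_pmf)
  let ?f = "\<lambda>x. if x \<in> spins V then ising_weight V \<beta> Q \<mu> x / ising_Z V \<beta> Q \<mu> else 0"
  note Z = ising_Z_pos[OF assms, of \<beta> Q \<mu>]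
  show nn: "0 \<le> ?f x" for x
    using Z by (simp add: ising_weight_def)
  have "(\<integral>\<^sup>+x. ennreal (?f x) \<partial>count_space UNIV) =
      (\<integral>\<^sup>+x. ennreal (?f x) * indicator (spins V) x \<partial>count_space UNIV)"
    by (intro nn_integral_cong) (auto simp: indicator_def)
  also have "\<dots> = (\<Sum>x\<in>spins V. ennreal (?f x))"
    using finite_spins[OF assms]
    by (simp add: nn_integral_count_space_indicator[symmetric] nn_integral_count_space_finite)
  also have "\<dots> = ennreal (\<Sum>x\<in>spins V. ?f x)"
    using nn by (intro sum_ennreal)
  also have "(\<Sum>x\<in>spins V. ?f x) = 1"
    using Z by (simp add: sum_divide_distrib[symmetric] ising_Z_def[symmetric])
  finally show "(\<integral>\<^sup>+x. ennreal (?f x) \<partial>count_space UNIV) = 1"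
    by simp
qed

text \<open>Points of the \<open>d\<close>-dimensional integer lattice are functions \<^typ>\<open>nat \<Rightarrow> int\<close>
  that are extensional on \<open>{..<d}\<close>.\<close>

definition box :: "nat \<Rightarrow> nat \<Rightarrow> (nat \<Rightarrow> int) set" where
  "box d n = ({..<d} \<rightarrow>\<^sub>E {k. \<bar>real_of_int k\<bar> \<le> root d (real n)})"

lemma finite_box: "finite (box d n)"
proof -
  have "{k. \<bar>real_of_int k\<bar> \<le> root d (real n)} \<subseteq> {- \<lfloor>root d (real n)\<rfloor> .. \<lfloor>root d (real n)\<rfloor>}"
    by (auto simp: abs_le_iff le_floor_iff) linarith
  then show ?thesis
    unfolding box_def by (intro finite_PiE finite_lessThan) (rule finite_subset, auto)
qed

definition l1_dist :: "nat \<Rightarrow> (nat \<Rightarrow> int) \<Rightarrow> (nat \<Rightarrow> int) \<Rightarrow> int" where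
  "l1_dist d i j = (\<Sum>k<d. \<bar>i k - j k\<bar>)"

definition coupling :: "nat \<Rightarrow> nat \<Rightarrow> (nat \<Rightarrow> int) \<Rightarrow> (nat \<Rightarrow> int) \<Rightarrow> real" where
  "coupling d L i j = of_bool (0 < l1_dist d i j \<and> l1_dist d i j \<le> int L)"

definition lattice_ising ::
    "nat \<Rightarrow> nat \<Rightarrow> real \<Rightarrow> nat \<Rightarrow> ((nat \<Rightarrow> int) \<Rightarrow> real) \<Rightarrow> ((nat \<Rightarrow> int) \<Rightarrow> real) pmf" where
  "lattice_ising d L \<beta> n \<mu> = ising (box d n) \<beta> (coupling d L) \<mu>"

definition magnetization :: "nat \<Rightarrow> nat \<Rightarrow> real \<Rightarrow> real \<Rightarrow> nat \<Rightarrow> real" where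
  "magnetization d L \<beta> h n =
     measure_pmf.expectation (lattice_ising d L \<beta> n (\<lambda>_. h))
       (\<lambda>X. 1 / real (card (box d n)) * (\<Sum>i\<in>box d n. X i))"

text \<open>Both limits below exist for every \<open>\<beta> > 0\<close> (classical, by correlation inequalities), so
  the use of \<^const>\<open>Lim\<close> is unproblematic. The infimum is taken in the extended reals and is
  \<open>\<infinity>\<close> for the empty set.\<close>

definition beta_c :: "nat \<Rightarrow> nat \<Rightarrow> ereal" where
  "beta_c d L =
     Inf (ereal ` {\<beta>. 0 < \<beta> \<and> 0 < Lim (at_right 0) (\<lambda>h. lim (\<lambda>n. magnetization d L \<beta> h n))})"

definition cubes :: "nat \<Rightarrow> nat \<Rightarrow> nat \<Rightarrow> (nat \<Rightarrow> int) set set" where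
  "cubes d n s =
     {S. S \<subseteq> box d n \<and>
         (\<exists>a b :: nat \<Rightarrow> int. (\<forall>j<d. b j - a j = \<lceil>root d (real s)\<rceil>) \<and>
            S = (\<Pi>\<^sub>E j\<in>{..<d}. {a j..b j}))}"

definition supp :: "'v set \<Rightarrow> ('v \<Rightarrow> real) \<Rightarrow> 'v set" where
  "supp V \<mu> = {i \<in> V. \<mu> i \<noteq> 0}"

definition alternatives :: "'v set \<Rightarrow> 'v set set \<Rightarrow> real \<Rightarrow> ('v \<Rightarrow> real) set" where
  "alternatives V \<C> A =
     {\<mu> \<in> V \<rightarrow>\<^sub>E {0..}. supp V \<mu> \<in> \<C> \<and> (\<forall>i\<in>supp V \<mu>. A \<le> \<mu> i)}"

text \<open>A test is a predicate on spin configurations; \<^const>\<open>True\<close> means that the null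
  hypothesis is rejected.\<close>

definition risk ::
    "nat \<Rightarrow> nat \<Rightarrow> real \<Rightarrow> nat \<Rightarrow> nat \<Rightarrow> real \<Rightarrow> (((nat \<Rightarrow> int) \<Rightarrow> real) \<Rightarrow> bool) \<Rightarrow> real" where
  "risk d L \<beta> n s A T =
     measure_pmf.prob (lattice_ising d L \<beta> n (\<lambda>_. 0)) {X. T X} +
     (SUP \<mu>\<in>alternatives (box d n) (cubes d n s) A.
        measure_pmf.prob (lattice_ising d L \<beta> n \<mu>) {X. \<not> T X})"

definition asymp_powerful ::
    "nat \<Rightarrow> nat \<Rightarrow> real \<Rightarrow> (nat \<Rightarrow> nat) \<Rightarrow> (nat \<Rightarrow> real) \<Rightarrow>
     (nat \<Rightarrow> ((nat \<Rightarrow> int) \<Rightarrow> real) \<Rightarrow> bool) \<Rightarrow> bool" where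
  "asymp_powerful d L \<beta> s A T \<longleftrightarrow>
     limsup (\<lambda>n. ereal (risk d L \<beta> n (s n) (A n) (T n))) = 0"

text \<open>A constant test has risk 1, and a test may do worse: for instance, the test accepting the
  null hypothesis exactly when all spins of one fixed cube are \<open>+1\<close> has risk bounded away from
  1 from above. Asymptotic powerlessness of all tests therefore means that no sequence of tests
  asymptotically beats risk 1, and the condition is a lower bound on the limit inferior rather
  than an equality; for tests of risk at most 1 the two agree, see the lemma below.\<close>

definition asymp_powerless ::
    "nat \<Rightarrow> nat \<Rightarrow> real \<Rightarrow> (nat \<Rightarrow> nat) \<Rightarrow> (nat \<Rightarrow> real) \<Rightarrow>
     (nat \<Rightarrow> ((nat \<Rightarrow> int) \<Rightarrow> real) \<Rightarrow> bool) \<Rightarrow> bool" where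
  "asymp_powerless d L \<beta> s A T \<longleftrightarrow>
     1 \<le> liminf (\<lambda>n. ereal (risk d L \<beta> n (s n) (A n) (T n)))"

lemma asymp_powerless_iff_eq:
  assumes "\<forall>\<^sub>F n in sequentially. risk d L \<beta> n (s n) (A n) (T n) \<le> 1"
  shows "asymp_powerless d L \<beta> s A T \<longleftrightarrow>
    liminf (\<lambda>n. ereal (risk d L \<beta> n (s n) (A n) (T n))) = 1"
proof -
  have "liminf (\<lambda>n. ereal (risk d L \<beta> n (s n) (A n) (T n))) \<le> liminf (\<lambda>n. 1)"
    using assms by (intro Liminf_mono) (auto elim: eventually_mono)
  then show ?thesis
    by (auto simp: asymp_powerless_def Liminf_const)
qed

definition testing_regime :: "real \<Rightarrow> (nat \<Rightarrow> nat) \<Rightarrow> (nat \<Rightarrow> real) \<Rightarrow> bool" where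
  "testing_regime \<upsilon> s A \<longleftrightarrow>
     (\<forall>n. 0 < s n) \<and> (\<forall>n. 0 < A n) \<and>
     (\<forall>\<^sub>F n in sequentially. real (s n) \<le> real n powr (1 - \<upsilon>))"

end

theory Submission
  imports Defs "HOL-Real_Asymp.Real_Asymp"
begin

text \<open>
  Everything rests on finiteness of the susceptibility \<open>\<Sum>\<^sub>j E(X\<^sub>i X\<^sub>j)\<close>, uniformly in the box, below
  \<open>\<beta>\<^sub>c\<close>. As in the argument of Duminil-Copin and Tassion, consider for a finite set \<open>S\<close> containing the
  origin \<open>\<phi>(S) = \<beta> \<Sum>\<^bsub>y\<in>S, x\<notin>S, x\<sim>y\<^esub> E\<^sub>S(X\<^sub>0 X\<^sub>y)\<close>. If \<open>\<phi>(S) < 1\<close> for some \<open>S\<close>, iterating the Simon--Lieb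
  inequality bounds the susceptibility by \<open>|S| / (1 - \<phi>(S))\<close>. If \<open>\<phi> \<ge> 1\<close> for all \<open>S\<close> at \<open>\<beta>\<^sub>0\<close>, then an
  exploration of the sites joined to the boundary gives \<open>\<beta> m' \<ge> 1 - m\<close> for the plus boundary
  magnetization at all \<open>\<beta> \<ge> \<beta>\<^sub>0\<close>, so that \<open>m \<ge> 1 - \<beta>\<^sub>0 / \<beta> > 0\<close>; by convexity in the field this
  passes to the limit defining \<open>\<beta>\<^sub>c\<close>, and \<open>\<beta>\<^sub>0 \<ge> \<beta>\<^sub>c\<close>.

  For the tests, truncated correlations in a nonnegative field are at most \<open>E\<^sub>0(X\<^sub>i X\<^sub>j)\<close>. Adding the
  tilted sites one at a time bounds the correlation of the likelihood ratios of two blocks by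
  \<open>exp (tanh\<^sup>2 A \<Sum>\<^bsub>i\<in>S, j\<in>S'\<^esub> E\<^sub>0(X\<^sub>i X\<^sub>j))\<close>, uniformly in \<open>A\<close>. The second moment over all positions of
  the block then yields both lower bounds. The scan statistic attains the rate, by Chernoff's bound
  under the null hypothesis and Chebyshev's inequality under the alternative.
\<close>

section \<open>Ferromagnetic functions and Griffiths--Ginibre inequalities\<close>

text \<open>Uniformity in the signal comes from one identity: tilting a spin by any A is, up to
  normalisation, the factor \<open>1 + tanh A * x i\<close>, and tanh stays below 1. Such tilts are
  not small, so truncated correlations have to be controlled in every intermediate field and not
  only at zero; this is what their domination by zero-field correlations provides. The critical
  point is defined by free boundaries with the field sent to 0 after the volume grows, whereas the
  exploration yields a magnetization under plus boundaries. At a fixed field the boundary energy is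
  of lower order than the volume, which reconciles the two. Constants: the second moment error is
  about exp B * B * s / n, where B bounds \<open>3 ^ d * s * sus\<close> times the square of tanh A.
  Part (a) has B = ln n / 2; the weak-signal bound has B = (\<upsilon> / 2) ln n, against s at most
  n^(1 - \<upsilon>). The value C = 1 keeps the Chernoff parameter sqrt (ln n / m), m the block
  size, at most 1. Finally C' = 4 + sus is the scan threshold 3 + sus plus one unit for
  Chebyshev.\<close>

definition spin_prod :: "'v set \<Rightarrow> ('v \<Rightarrow> real) \<Rightarrow> real" where
  "spin_prod A x = (\<Prod>i\<in>A. x i)"

lemma spins_sq:
  assumes "x \<in> spins V" "i \<in> V"
  shows "x i * x i = 1"
  using assms by (auto simp: spins_def PiE_def Pi_def)

lemma spins_cases:
  assumes "x \<in> spins V" "i \<in> V"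
  obtains "x i = 1" | "x i = -1"
  using assms by (auto simp: spins_def PiE_def Pi_def)

lemma spin_prod_cases:
  assumes "finite V" "x \<in> spins V" "A \<subseteq> V"
  shows "spin_prod A x = 1 \<or> spin_prod A x = -1"
proof -
  have "finite A" using assms finite_subset by blast
  then show ?thesis using assms(3)
  proof (induction A)
    case (insert a A)
    then have "x a = 1 \<or> x a = -1"
      using spins_cases[OF assms(2), of a] by (metis insert_subset)
    with insert show ?case by (auto simp: spin_prod_def)
  qed (simp add: spin_prod_def)
qed

lemma spin_prod_mult:
  assumes "finite V" "x \<in> spins V" "A \<subseteq> V" "B \<subseteq> V"
  shows "spin_prod A x * spin_prod B x = spin_prod (sym_diff A B) x"
proof -
  have fin: "finite A" "finite B" using assms finite_subset by blast+
  have A: "spin_prod A x = spin_prod (A - B) x * spin_prod (A \<inter> B) x"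
    unfolding spin_prod_def using fin
    by (metis Int_Diff_disjoint Int_Diff_Un inf_commute finite_Diff finite_Int mult.commute prod.union_disjoint)
  have B: "spin_prod B x = spin_prod (B - A) x * spin_prod (A \<inter> B) x"
    unfolding spin_prod_def using fin
    by (metis Int_Diff_disjoint Int_Diff_Un inf_commute finite_Diff finite_Int mult.commute prod.union_disjoint)
  have "spin_prod (A \<inter> B) x * spin_prod (A \<inter> B) x = 1"
    using spin_prod_cases[OF assms(1,2), of "A \<inter> B"] assms(3) by (metis inf.coboundedI1 mult_1 square_eq_1_iff)
  moreover have "spin_prod (sym_diff A B) x = spin_prod (A - B) x * spin_prod (B - A) x"
    unfolding spin_prod_def using fin by (intro prod.union_disjoint) auto
  ultimately show ?thesis unfolding A B by (simp add: algebra_simps)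
qed

lemma sum_spin_prod_nonneg:
  assumes "finite V" "A \<subseteq> V"
  shows "0 \<le> (\<Sum>x\<in>spins V. spin_prod A x)"
proof -
  have "spin_prod A x = (\<Prod>i\<in>V. if i \<in> A then x i else 1)" for x :: "'a \<Rightarrow> real"
    unfolding spin_prod_def using assms
    by (simp add: prod.If_cases Int_absorb1 Int_absorb2)
  then have "(\<Sum>x\<in>spins V. spin_prod A x)
      = (\<Sum>x\<in>spins V. \<Prod>i\<in>V. (\<lambda>i s. if i \<in> A then s else 1) i (x i))"
    by simp
  also have "\<dots> = (\<Prod>i\<in>V. \<Sum>s\<in>{-1, 1::real}. (if i \<in> A then s else 1))"
    unfolding spins_def using assms by (subst prod_sum_PiE) auto
  also have "\<dots> \<ge> 0" by (intro prod_nonneg) auto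
  finally show ?thesis .
qed

text \<open>Nonnegativity of the Fourier coefficients on the group {-1,1}^V. The expansion is
  required on \<open>spins V\<close> only, where squares of spins are 1. Summing over all
  configurations leaves just the coefficient of the empty set, so Griffiths' first inequality holds
  for every weight of this kind.\<close>

definition ferro :: "'v set \<Rightarrow> (('v \<Rightarrow> real) \<Rightarrow> real) \<Rightarrow> bool" where
  "ferro V F \<longleftrightarrow> (\<exists>c. (\<forall>A. 0 \<le> c A) \<and>
     (\<forall>x\<in>spins V. F x = (\<Sum>A\<in>Pow V. c A * spin_prod A x)))"

lemma ferro_sum_nonneg:
  assumes "finite V" "ferro V F"
  shows "0 \<le> (\<Sum>x\<in>spins V. F x)"
proof -
  obtain c where c: "\<And>A. 0 \<le> c A" "\<And>x. x \<in> spins V \<Longrightarrow> F x = (\<Sum>A\<in>Pow V. c A * spin_prod A x)"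
    using assms(2) unfolding ferro_def by blast
  have "(\<Sum>x\<in>spins V. F x) = (\<Sum>A\<in>Pow V. c A * (\<Sum>x\<in>spins V. spin_prod A x))"
    unfolding sum_distrib_left by (subst sum.swap) (simp add: c)
  also have "\<dots> \<ge> 0"
    using assms c by (intro sum_nonneg mult_nonneg_nonneg sum_spin_prod_nonneg) auto
  finally show ?thesis .
qed

lemma ferro_cong:
  assumes "ferro V F" "\<And>x. x \<in> spins V \<Longrightarrow> F x = G x"
  shows "ferro V G"
  using assms unfolding ferro_def by metis

lemma ferro_spin_prod:
  assumes "finite V" "A \<subseteq> V"
  shows "ferro V (spin_prod A)"
  unfolding ferro_def
  using assms by (intro exI[of _ "\<lambda>B. of_bool (B = A)"]) (auto simp: sum.delta' of_bool_def if_distrib if_distribR cong: if_cong)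

lemma ferro_scale:
  assumes "ferro V F" "0 \<le> a"
  shows "ferro V (\<lambda>x. a * F x)"
proof -
  obtain c where c: "\<And>A. 0 \<le> c A" "\<And>x. x \<in> spins V \<Longrightarrow> F x = (\<Sum>A\<in>Pow V. c A * spin_prod A x)"
    using assms unfolding ferro_def by blast
  show ?thesis unfolding ferro_def
    using c assms(2) by (intro exI[of _ "\<lambda>A. a * c A"]) (auto simp: sum_distrib_left mult.assoc)
qed

lemma ferro_add:
  assumes "ferro V F" "ferro V G"
  shows "ferro V (\<lambda>x. F x + G x)"
proof -
  obtain c where c: "\<And>A. 0 \<le> c A" "\<And>x. x \<in> spins V \<Longrightarrow> F x = (\<Sum>A\<in>Pow V. c A * spin_prod A x)"
    using assms(1) unfolding ferro_def by blast
  obtain d where d: "\<And>A. 0 \<le> d A" "\<And>x. x \<in> spins V \<Longrightarrow> G x = (\<Sum>A\<in>Pow V. d A * spin_prod A x)"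
    using assms(2) unfolding ferro_def by blast
  show ?thesis unfolding ferro_def
    using c d by (intro exI[of _ "\<lambda>A. c A + d A"]) (auto simp: sum.distrib distrib_right)
qed

lemma ferro_const:
  assumes "finite V" "0 \<le> a"
  shows "ferro V (\<lambda>x. a)"
  using ferro_scale[OF ferro_spin_prod[OF assms(1), of "{}"] assms(2)]
  by (simp add: spin_prod_def)

lemma ferro_sum:
  assumes "finite V" "\<And>k. k \<in> I \<Longrightarrow> ferro V (F k)"
  shows "ferro V (\<lambda>x. \<Sum>k\<in>I. F k x)"
  using assms(2)
  by (induction I rule: infinite_finite_induct) (auto intro: ferro_add ferro_const[OF assms(1)])

lemma ferro_spin:
  assumes "finite V" "i \<in> V"
  shows "ferro V (\<lambda>x. x i)"
  using ferro_spin_prod[OF assms(1), of "{i}"] assms(2) by (simp add: spin_prod_def[abs_def])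

lemma ferro_mult:
  assumes "finite V" "ferro V F" "ferro V G"
  shows "ferro V (\<lambda>x. F x * G x)"
proof -
  obtain c where c: "\<And>A. 0 \<le> c A" "\<And>x. x \<in> spins V \<Longrightarrow> F x = (\<Sum>A\<in>Pow V. c A * spin_prod A x)"
    using assms(2) unfolding ferro_def by blast
  obtain d where d: "\<And>A. 0 \<le> d A" "\<And>x. x \<in> spins V \<Longrightarrow> G x = (\<Sum>A\<in>Pow V. d A * spin_prod A x)"
    using assms(3) unfolding ferro_def by blast
  have "ferro V (\<lambda>x. \<Sum>A\<in>Pow V. \<Sum>B\<in>Pow V. (c A * d B) * spin_prod (sym_diff A B) x)"
    using c d assms(1)
    by (intro ferro_sum ferro_scale ferro_spin_prod mult_nonneg_nonneg) auto
  then show ?thesis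
  proof (rule ferro_cong)
    fix x assume x: "x \<in> spins V"
    have "(\<Sum>A\<in>Pow V. \<Sum>B\<in>Pow V. (c A * d B) * spin_prod (sym_diff A B) x)
        = (\<Sum>A\<in>Pow V. \<Sum>B\<in>Pow V. (c A * spin_prod A x) * (d B * spin_prod B x))"
      using x assms(1) by (intro sum.cong refl) (simp add: spin_prod_mult[symmetric] Pow_iff)
    then show "(\<Sum>A\<in>Pow V. \<Sum>B\<in>Pow V. (c A * d B) * spin_prod (sym_diff A B) x) = F x * G x"
      using x by (simp add: c d sum_product)
  qed
qed

lemma ferro_prod:
  assumes "finite V" "\<And>k. k \<in> I \<Longrightarrow> ferro V (F k)"
  shows "ferro V (\<lambda>x. \<Prod>k\<in>I. F k x)"
  using assms(2)
  by (induction I rule: infinite_finite_induct)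
    (auto intro: ferro_mult[OF assms(1)] ferro_const[OF assms(1)])

text \<open>Comparing two sets of couplings takes more than a nonnegative expansion of exp H: the
  increment exp H - 1 must have one as well. Such factors are closed under products because FG - 1 =
  (F - 1)(G - 1) + (F - 1) + (G - 1).\<close>

lemma ferro_mult_minus_one:
  assumes "finite V" "ferro V (\<lambda>x. F x - 1)" "ferro V (\<lambda>x. G x - 1)"
  shows "ferro V (\<lambda>x. F x * G x - 1)"
proof -
  have "ferro V (\<lambda>x. (F x - 1) * (G x - 1) + ((F x - 1) + (G x - 1)))"
    using assms by (intro ferro_add ferro_mult)
  then show ?thesis by (simp add: algebra_simps)
qed

lemma ferro_prod_minus_one:
  assumes "finite V" "\<And>k. k \<in> I \<Longrightarrow> ferro V (\<lambda>x. F k x - 1)"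
  shows "ferro V (\<lambda>x. (\<Prod>k\<in>I. F k x) - 1)"
  using assms(2)
  by (induction I rule: infinite_finite_induct)
    (auto intro: ferro_mult_minus_one[OF assms(1)] ferro_const[OF assms(1), of 0, simplified])

text \<open>For a sign X, exp (c X) = cosh c + X sinh c.\<close>

lemma ferro_exp_spin_prod_minus_one:
  assumes "finite V" "A \<subseteq> V" "0 \<le> (c::real)"
  shows "ferro V (\<lambda>x. exp (c * spin_prod A x) - 1)"
proof (rule ferro_cong)
  show "ferro V (\<lambda>x. (cosh c - 1) + sinh c * spin_prod A x)"
    using assms cosh_real_ge_1[of c] by (intro ferro_add ferro_const ferro_scale ferro_spin_prod) auto
  show "(cosh c - 1) + sinh c * spin_prod A x = exp (c * spin_prod A x) - 1" if "x \<in> spins V" for x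
    using spin_prod_cases[OF assms(1) that assms(2)] cosh_plus_sinh[of c] cosh_minus_sinh[of c]
    by auto
qed

lemma ferro_exp_pair_minus_one:
  assumes "finite V" "i \<in> V" "j \<in> V" "0 \<le> c"
  shows "ferro V (\<lambda>x. exp (c * (x i * x j)) - 1)"
  \<comment> \<open>On the diagonal \<open>x i * x i\<close> is 1, the empty spin product.\<close>
  by (rule ferro_cong[OF ferro_exp_spin_prod_minus_one[OF assms(1) _ assms(4), of "if i = j then {} else {i, j}"]])
     (use assms in \<open>auto simp: spin_prod_def spins_sq\<close>)

lemma ferro_if_minus_one:
  assumes "finite V" "ferro V (\<lambda>x. F x - 1)"
  shows "ferro V F"
  using ferro_add[OF assms(2) ferro_const[OF assms(1), of 1]] by simp

lemma ferro_pair: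
  assumes "finite V" "i \<in> V" "j \<in> V"
  shows "ferro V (\<lambda>x. x i * x j)"
  using assms by (intro ferro_mult ferro_spin)

text \<open>Ordered pairs are summed, so the bond joining two distinct sites has strength
  \<open>J i j + J j i\<close>; the Ising weight corresponds to
  \<open>J = \<beta> / 2 * Q\<close>.\<close>

definition energy :: "'v set \<Rightarrow> ('v \<Rightarrow> 'v \<Rightarrow> real) \<Rightarrow> ('v \<Rightarrow> real) \<Rightarrow> ('v \<Rightarrow> real) \<Rightarrow> real" where
  "energy V J h x = (\<Sum>i\<in>V. \<Sum>j\<in>V. J i j * (x i * x j)) + (\<Sum>i\<in>V. h i * x i)"

definition wsum :: "'v set \<Rightarrow> ('v \<Rightarrow> 'v \<Rightarrow> real) \<Rightarrow> ('v \<Rightarrow> real) \<Rightarrow> (('v \<Rightarrow> real) \<Rightarrow> real) \<Rightarrow> real" where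
  "wsum V J h f = (\<Sum>x\<in>spins V. f x * exp (energy V J h x))"

abbreviation zsum :: "'v set \<Rightarrow> ('v \<Rightarrow> 'v \<Rightarrow> real) \<Rightarrow> ('v \<Rightarrow> real) \<Rightarrow> real" where
  "zsum V J h \<equiv> wsum V J h (\<lambda>_. 1)"

definition mean :: "'v set \<Rightarrow> ('v \<Rightarrow> 'v \<Rightarrow> real) \<Rightarrow> ('v \<Rightarrow> real) \<Rightarrow> (('v \<Rightarrow> real) \<Rightarrow> real) \<Rightarrow> real" where
  "mean V J h f = wsum V J h f / zsum V J h"

lemma zsum_pos:
  assumes "finite V" shows "0 < zsum V J h"
  unfolding wsum_def using assms by (intro sum_pos finite_spins spins_nonempty) auto

lemma wsum_eq_mean: "finite V \<Longrightarrow> wsum V J h f = mean V J h f * zsum V J h"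
  using zsum_pos[of V J h] by (simp add: mean_def)

lemma ferro_energy:
  assumes "finite V" "\<And>i j. i \<in> V \<Longrightarrow> j \<in> V \<Longrightarrow> 0 \<le> J i j" "\<And>i. i \<in> V \<Longrightarrow> 0 \<le> h i"
  shows "ferro V (energy V J h)"
  unfolding energy_def using assms
  by (intro ferro_add ferro_sum ferro_scale ferro_pair ferro_spin) auto

lemma ferro_exp_energy_minus_one:
  assumes "finite V" "\<And>i j. i \<in> V \<Longrightarrow> j \<in> V \<Longrightarrow> 0 \<le> J i j" "\<And>i. i \<in> V \<Longrightarrow> 0 \<le> h i"
  shows "ferro V (\<lambda>x. exp (energy V J h x) - 1)"
proof -
  have "ferro V (\<lambda>x. exp (h i * x i) - 1)" if "i \<in> V" for i
    using ferro_exp_spin_prod_minus_one[OF assms(1) _ assms(3), of "{i}" i] that by (simp add: spin_prod_def)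
  then have "ferro V (\<lambda>x. (\<Prod>i\<in>V. \<Prod>j\<in>V. exp (J i j * (x i * x j))) * (\<Prod>i\<in>V. exp (h i * x i)) - 1)"
    using assms by (intro ferro_mult_minus_one ferro_prod_minus_one ferro_exp_pair_minus_one) auto
  then show ?thesis
    using assms(1) by (simp add: energy_def exp_add exp_sum)
qed

lemma ferro_exp_energy:
  assumes "finite V" "\<And>i j. i \<in> V \<Longrightarrow> j \<in> V \<Longrightarrow> 0 \<le> J i j" "\<And>i. i \<in> V \<Longrightarrow> 0 \<le> h i"
  shows "ferro V (\<lambda>x. exp (energy V J h x))"
  by (rule ferro_if_minus_one[OF assms(1) ferro_exp_energy_minus_one[OF assms]])

lemma wsum_nonneg:
  assumes "finite V" "\<And>i j. i \<in> V \<Longrightarrow> j \<in> V \<Longrightarrow> 0 \<le> J i j" "\<And>i. i \<in> V \<Longrightarrow> 0 \<le> h i" "ferro V F"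
  shows "0 \<le> wsum V J h F"
  unfolding wsum_def using assms by (intro ferro_sum_nonneg ferro_mult ferro_exp_energy)

text \<open>Multiplication in the group {-1,1}^V, kept extensional. Writing a second replica as a
  twist of the first turns a pair into one configuration and a pattern of relative signs.\<close>

definition twist :: "'v set \<Rightarrow> ('v \<Rightarrow> real) \<Rightarrow> ('v \<Rightarrow> real) \<Rightarrow> 'v \<Rightarrow> real" where
  "twist V x \<theta> = (\<lambda>i\<in>V. x i * \<theta> i)"

lemma twist_spins: "x \<in> spins V \<Longrightarrow> \<theta> \<in> spins V \<Longrightarrow> twist V x \<theta> \<in> spins V"
  by (auto simp: twist_def spins_def PiE_def Pi_def) force

lemma twist_twist:
  assumes "x \<in> spins V" "\<theta> \<in> spins V"
  shows "twist V x (twist V x \<theta>) = \<theta>"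
proof
  fix i show "twist V x (twist V x \<theta>) i = \<theta> i"
    using assms spins_sq[OF assms(1), of i]
    by (cases "i \<in> V") (auto simp: twist_def mult.assoc[symmetric] spins_def PiE_def extensional_def)
qed

lemma sum_twist:
  assumes "x \<in> spins V"
  shows "(\<Sum>y\<in>spins V. f y) = (\<Sum>\<theta>\<in>spins V. f (twist V x \<theta>))"
  by (rule sum.reindex_bij_witness[of _ "twist V x" "twist V x"])
     (auto simp: assms twist_spins twist_twist)

text \<open>Ginibre's duplication. With the second replica equal to x twisted by \<theta>, the two
  energies add up to one energy in x with couplings
  \<open>J i j + J' i j * (\<theta> i * \<theta> j)\<close>, nonnegative since J dominates |J'|, and
  each difference of spin products factors as
  \<open>spin_prod A x * (1 - spin_prod A \<theta>)\<close>. Equal systems give positive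
  correlation; G = 1 gives monotonicity in couplings and fields.\<close>

lemma ginibre:
  assumes V: "finite V" and F: "ferro V F" and G: "ferro V G"
    and J: "\<And>i j. i \<in> V \<Longrightarrow> j \<in> V \<Longrightarrow> \<bar>J' i j\<bar> \<le> J i j"
    and h: "\<And>i. i \<in> V \<Longrightarrow> \<bar>h' i\<bar> \<le> h i"
  shows "wsum V J h G * wsum V J' h' F \<le> wsum V J h (\<lambda>x. G x * F x) * zsum V J' h'"
proof -
  obtain c where c: "\<And>A. 0 \<le> c A" "\<And>x. x \<in> spins V \<Longrightarrow> F x = (\<Sum>A\<in>Pow V. c A * spin_prod A x)"
    using F unfolding ferro_def by blast
  have twist_prod: "spin_prod A (twist V x \<theta>) = spin_prod A x * spin_prod A \<theta>"
    if "A \<subseteq> V" for A x and \<theta> :: "'a \<Rightarrow> real"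
    using that unfolding spin_prod_def twist_def
    by (subst prod.distrib[symmetric]) (auto intro!: prod.cong)
  have tw: "energy V J h x + energy V J' h' (twist V x \<theta>)
      = energy V (\<lambda>i j. J i j + J' i j * (\<theta> i * \<theta> j)) (\<lambda>i. h i + h' i * \<theta> i) x" for x \<theta>
    unfolding energy_def twist_def by (simp add: sum.distrib algebra_simps)
  have key: "0 \<le> (\<Sum>x\<in>spins V. \<Sum>y\<in>spins V. G x * (spin_prod A x - spin_prod A y) *
       (exp (energy V J h x) * exp (energy V J' h' y)))" if A: "A \<subseteq> V" for A
  proof -
    have "(\<Sum>x\<in>spins V. \<Sum>y\<in>spins V. G x * (spin_prod A x - spin_prod A y) *
       (exp (energy V J h x) * exp (energy V J' h' y)))
       = (\<Sum>x\<in>spins V. \<Sum>\<theta>\<in>spins V. G x * (spin_prod A x - spin_prod A (twist V x \<theta>)) *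
       (exp (energy V J h x) * exp (energy V J' h' (twist V x \<theta>))))"
      by (intro sum.cong refl sum_twist)
    also have "\<dots> = (\<Sum>\<theta>\<in>spins V. (1 - spin_prod A \<theta>) * (\<Sum>x\<in>spins V. G x * spin_prod A x *
        exp (energy V (\<lambda>i j. J i j + J' i j * (\<theta> i * \<theta> j)) (\<lambda>i. h i + h' i * \<theta> i) x)))"
      unfolding exp_add[symmetric] tw
      by (subst sum.swap) (auto simp: twist_prod[OF A] sum_distrib_left algebra_simps intro!: sum.cong)
    also have "\<dots> \<ge> 0"
    proof (rule sum_nonneg, rule mult_nonneg_nonneg)
      fix \<theta> :: "'a \<Rightarrow> real" assume \<theta>: "\<theta> \<in> spins V"
      show "0 \<le> 1 - spin_prod A \<theta>" using spin_prod_cases[OF V \<theta> A] by auto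
      have a1: "0 \<le> J i j + J' i j * (\<theta> i * \<theta> j)" if "i \<in> V" "j \<in> V" for i j
        by (rule spins_cases[OF \<theta> that(1)]; rule spins_cases[OF \<theta> that(2)]; use J[OF that] in simp)
      have a2: "0 \<le> h i + h' i * \<theta> i" if "i \<in> V" for i
        by (rule spins_cases[OF \<theta> that]; use h[OF that] in simp)
      show "0 \<le> (\<Sum>x\<in>spins V. G x * spin_prod A x *
        exp (energy V (\<lambda>i j. J i j + J' i j * (\<theta> i * \<theta> j)) (\<lambda>i. h i + h' i * \<theta> i) x))"
        using a1 a2 V G A
        by (intro ferro_sum_nonneg ferro_mult ferro_exp_energy ferro_spin_prod)
    qed
    finally show ?thesis .
  qed
  have "wsum V J h (\<lambda>x. G x * F x) * zsum V J' h' - wsum V J h G * wsum V J' h' F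
     = (\<Sum>x\<in>spins V. \<Sum>y\<in>spins V. G x * (F x - F y) * (exp (energy V J h x) * exp (energy V J' h' y)))"
    unfolding wsum_def sum_product sum_subtractf[symmetric] by (simp add: algebra_simps)
  also have "\<dots> = (\<Sum>x\<in>spins V. \<Sum>y\<in>spins V. \<Sum>A\<in>Pow V. c A * (G x * (spin_prod A x - spin_prod A y) *
       (exp (energy V J h x) * exp (energy V J' h' y))))"
    by (intro sum.cong refl)
       (simp add: c sum_subtractf[symmetric] sum_distrib_left sum_distrib_right algebra_simps)
  also have "\<dots> = (\<Sum>x\<in>spins V. \<Sum>A\<in>Pow V. \<Sum>y\<in>spins V. c A * (G x * (spin_prod A x - spin_prod A y) *
       (exp (energy V J h x) * exp (energy V J' h' y))))"
    by (intro sum.cong refl sum.swap)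
  also have "\<dots> = (\<Sum>A\<in>Pow V. c A * (\<Sum>x\<in>spins V. \<Sum>y\<in>spins V. G x * (spin_prod A x - spin_prod A y) *
       (exp (energy V J h x) * exp (energy V J' h' y))))"
    unfolding sum_distrib_left by (rule sum.swap)
  also have "\<dots> \<ge> 0"
    by (rule sum_nonneg, rule mult_nonneg_nonneg) (use c key in auto)
  finally show ?thesis by simp
qed

section \<open>Truncated correlations in a field\<close>

text \<open>One-point case of the Ahlswede--Daykin theorem. Both cross terms p, q are at most m = c1
  d0 and their product is at most c0 d1 m, so expanding (m - p)(m - q) \<ge> 0 and dividing by m
  bounds p + q.\<close>

lemma four_reals_ineq:
  fixes a0 a1 b0 b1 c0 c1 d0 d1 :: real
  assumes nn: "0 \<le> a0" "0 \<le> a1" "0 \<le> b0" "0 \<le> b1" "0 \<le> c0" "0 \<le> c1" "0 \<le> d0" "0 \<le> d1"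
    and 1: "a0 * b0 \<le> c0 * d0" and 2: "a0 * b1 \<le> c1 * d0" and 3: "a1 * b0 \<le> c1 * d0"
    and 4: "a1 * b1 \<le> c1 * d1"
  shows "(a0 + a1) * (b0 + b1) \<le> (c0 + c1) * (d0 + d1)"
proof -
  define m p q where "m = c1 * d0" and "p = a0 * b1" and "q = a1 * b0"
  have pq: "0 \<le> p" "0 \<le> q" "p \<le> m" "q \<le> m" using nn 2 3 by (auto simp: m_def p_def q_def)
  have "p + q \<le> c0 * d1 + m"
  proof (cases "m = 0")
    case True
    then show ?thesis using pq nn by simp
  next
    case False
    then have m: "0 < m" using pq by linarith
    have "p * q \<le> (c0 * d1) * m"
      using mult_mono[OF 1 4] nn by (simp add: m_def p_def q_def algebra_simps)
    moreover have "0 \<le> (m - p) * (m - q)" using pq by simp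
    ultimately have "(p + q) * m \<le> (c0 * d1 + m) * m" by (simp add: algebra_simps)
    then show ?thesis using m by (simp add: mult_le_cancel_right)
  qed
  then show ?thesis using 1 4 by (simp add: m_def p_def q_def algebra_simps)
qed

lemma sum_Pow_insert:
  fixes f :: "'a set \<Rightarrow> real"
  assumes "finite V" "v \<notin> V"
  shows "(\<Sum>A\<in>Pow (insert v V). f A) = (\<Sum>A\<in>Pow V. f A + f (insert v A))"
proof -
  have inj: "inj_on (insert v) (Pow V)"
    using assms(2) by (auto simp: inj_on_def)
  have "(\<Sum>A\<in>Pow (insert v V). f A) = (\<Sum>A\<in>Pow V. f A) + (\<Sum>A\<in>insert v ` Pow V. f A)"
    unfolding Pow_insert using assms by (intro sum.union_disjoint) auto
  then show ?thesis by (simp add: sum.reindex[OF inj] sum.distrib)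
qed

text \<open>Ahlswede--Daykin theorem. Summing out the new site leaves four functions on the smaller
  set, and their hypothesis for A, B is the one-point case.\<close>

lemma four_functions:
  fixes f1 f2 f3 f4 :: "'a set \<Rightarrow> real"
  assumes "finite V"
    and "\<And>A. A \<subseteq> V \<Longrightarrow> 0 \<le> f1 A" "\<And>A. A \<subseteq> V \<Longrightarrow> 0 \<le> f2 A"
      "\<And>A. A \<subseteq> V \<Longrightarrow> 0 \<le> f3 A" "\<And>A. A \<subseteq> V \<Longrightarrow> 0 \<le> f4 A"
    and "\<And>A B. A \<subseteq> V \<Longrightarrow> B \<subseteq> V \<Longrightarrow> f1 A * f2 B \<le> f3 (A \<union> B) * f4 (A \<inter> B)"
  shows "(\<Sum>A\<in>Pow V. f1 A) * (\<Sum>A\<in>Pow V. f2 A) \<le> (\<Sum>A\<in>Pow V. f3 A) * (\<Sum>A\<in>Pow V. f4 A)"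
  using assms
proof (induction V arbitrary: f1 f2 f3 f4)
  case empty
  from empty(5)[of "{}" "{}"] show ?case by simp
next
  case (insert v V)
  note nn = insert.prems(1-4) and le = insert.prems(5)
  show ?case
    unfolding sum_Pow_insert[OF insert.hyps]
  proof (rule insert.IH)
    fix A assume A: "A \<subseteq> V"
    then have A': "A \<subseteq> insert v V" "insert v A \<subseteq> insert v V" by auto
    show "0 \<le> f1 A + f1 (insert v A)" "0 \<le> f2 A + f2 (insert v A)"
      "0 \<le> f3 A + f3 (insert v A)" "0 \<le> f4 A + f4 (insert v A)"
      using nn[OF A'(1)] nn[OF A'(2)] by simp_all
    fix B assume B: "B \<subseteq> V"
    then have B': "B \<subseteq> insert v V" "insert v B \<subseteq> insert v V" by auto
    have [simp]: "v \<notin> A" "v \<notin> B" using A B insert.hyps by auto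
    have C': "A \<union> B \<subseteq> insert v V" "insert v (A \<union> B) \<subseteq> insert v V"
      "A \<inter> B \<subseteq> insert v V" "insert v (A \<inter> B) \<subseteq> insert v V" using A B by auto
    show "(f1 A + f1 (insert v A)) * (f2 B + f2 (insert v B))
        \<le> (f3 (A \<union> B) + f3 (insert v (A \<union> B))) * (f4 (A \<inter> B) + f4 (insert v (A \<inter> B)))"
      using le[OF A'(1) B'(1)] le[OF A'(1) B'(2)] le[OF A'(2) B'(1)] le[OF A'(2) B'(2)]
      by (intro four_reals_ineq nn A' B' C') simp_all
  qed
qed

section \<open>Monotonicity and supermodularity of the partition function\<close>

lemma energy_add:
  "energy V (\<lambda>i j. J i j + J' i j) (\<lambda>i. h i + h' i) x = energy V J h x + energy V J' h' x"
  by (simp add: energy_def sum.distrib algebra_simps)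

lemma energy_cong:
  assumes "\<And>i j. i \<in> V \<Longrightarrow> j \<in> V \<Longrightarrow> J i j = J' i j" "\<And>i. i \<in> V \<Longrightarrow> h i = h' i"
  shows "energy V J h x = energy V J' h' x"
  using assms by (simp add: energy_def cong: sum.cong)

lemma wsum_cong:
  assumes "\<And>i j. i \<in> V \<Longrightarrow> j \<in> V \<Longrightarrow> J i j = J' i j" "\<And>i. i \<in> V \<Longrightarrow> h i = h' i"
    and "\<And>x. x \<in> spins V \<Longrightarrow> f x = g x"
  shows "wsum V J h f = wsum V J' h' g"
  using energy_cong[of V J J' h h', OF assms(1,2)] assms(3) by (simp add: wsum_def cong: sum.cong)

lemma wsum_mono:
  assumes V: "finite V" and F: "ferro V F"
    and J: "\<And>i j. i \<in> V \<Longrightarrow> j \<in> V \<Longrightarrow> 0 \<le> J' i j \<and> J' i j \<le> J i j"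
    and h: "\<And>i. i \<in> V \<Longrightarrow> 0 \<le> h' i \<and> h' i \<le> h i"
  shows "wsum V J' h' F \<le> wsum V J h F"
proof -
  have e: "energy V J h x = energy V J' h' x + energy V (\<lambda>i j. J i j - J' i j) (\<lambda>i. h i - h' i) x" for x
    unfolding energy_add[symmetric] by simp
  have "0 \<le> (\<Sum>x\<in>spins V. F x * (exp (energy V J' h' x) *
       (exp (energy V (\<lambda>i j. J i j - J' i j) (\<lambda>i. h i - h' i) x) - 1)))"
    using assms by (intro ferro_sum_nonneg ferro_mult ferro_exp_energy ferro_exp_energy_minus_one) auto
  also have "\<dots> = wsum V J h F - wsum V J' h' F"
    unfolding wsum_def e exp_add by (simp add: sum_subtractf[symmetric] algebra_simps)
  finally show ?thesis by simp
qed

lemma mean_mono: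
  assumes V: "finite V" and F: "ferro V F"
    and J: "\<And>i j. i \<in> V \<Longrightarrow> j \<in> V \<Longrightarrow> \<bar>J' i j\<bar> \<le> J i j"
    and h: "\<And>i. i \<in> V \<Longrightarrow> \<bar>h' i\<bar> \<le> h i"
  shows "mean V J' h' F \<le> mean V J h F"
  using ginibre[OF V F ferro_const[OF V, of 1] J h] zsum_pos[OF V, of J h] zsum_pos[OF V, of J' h']
  by (simp add: mean_def field_simps)

text \<open>Raising the parameters by B, b multiplies the partition function by the mean of the
  exponential of the added energy. That observable is ferromagnetic, so its mean is larger in the
  stronger system.\<close>

lemma zsum_supermod:
  assumes V: "finite V"
    and M: "\<And>i j. i \<in> V \<Longrightarrow> j \<in> V \<Longrightarrow> 0 \<le> M i j \<and> M i j \<le> J i j"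
    and m: "\<And>i. i \<in> V \<Longrightarrow> 0 \<le> m i \<and> m i \<le> h i"
    and B: "\<And>i j. i \<in> V \<Longrightarrow> j \<in> V \<Longrightarrow> 0 \<le> B i j" and b: "\<And>i. i \<in> V \<Longrightarrow> 0 \<le> b i"
  shows "zsum V J h * zsum V (\<lambda>i j. M i j + B i j) (\<lambda>i. m i + b i)
    \<le> zsum V (\<lambda>i j. J i j + B i j) (\<lambda>i. h i + b i) * zsum V M m"
proof -
  have e: "wsum V J h (\<lambda>x. exp (energy V B b x)) = zsum V (\<lambda>i j. J i j + B i j) (\<lambda>i. h i + b i)" for J h
    by (simp add: wsum_def energy_add exp_add mult.commute)
  have "zsum V J h * wsum V M m (\<lambda>x. exp (energy V B b x))
      \<le> wsum V J h (\<lambda>x. 1 * exp (energy V B b x)) * zsum V M m"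
    using M m B b by (intro ginibre ferro_const ferro_exp_energy V) (auto simp: abs_le_iff intro: order_trans[of _ 0])
  then show ?thesis by (simp add: e)
qed

text \<open>Interactions outside D are switched off while the sites stay, so that systems on
  different sets are compared on one configuration space.\<close>

definition mask2 :: "'v set \<Rightarrow> ('v \<Rightarrow> 'v \<Rightarrow> real) \<Rightarrow> 'v \<Rightarrow> 'v \<Rightarrow> real" where
  "mask2 D J i j = (if i \<in> D \<and> j \<in> D then J i j else 0)"

definition mask1 :: "'v set \<Rightarrow> ('v \<Rightarrow> real) \<Rightarrow> 'v \<Rightarrow> real" where
  "mask1 D h i = (if i \<in> D then h i else 0)"

text \<open>One factor on each side carries the field and the other does not: this is the form in
  which replica weights at field h are compared with those at zero field.\<close>

lemma zsum_mask_supermod: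
  assumes V: "finite V"
    and J: "\<And>i j. i \<in> V \<Longrightarrow> j \<in> V \<Longrightarrow> 0 \<le> J i j" and h: "\<And>i. i \<in> V \<Longrightarrow> 0 \<le> h i"
  shows "zsum V (mask2 P J) (mask1 P h) * zsum V (mask2 Q J) (\<lambda>_. 0)
    \<le> zsum V (mask2 (P \<union> Q) J) (mask1 (P \<union> Q) h) * zsum V (mask2 (P \<inter> Q) J) (\<lambda>_. 0)"
proof -
  define B where "B = (\<lambda>i j. mask2 Q J i j - mask2 (P \<inter> Q) J i j)"
  have "zsum V (mask2 P J) (mask1 P h) * zsum V (\<lambda>i j. mask2 (P \<inter> Q) J i j + B i j) (\<lambda>i. 0 + 0)
      \<le> zsum V (\<lambda>i j. mask2 P J i j + B i j) (\<lambda>i. mask1 P h i + 0) * zsum V (mask2 (P \<inter> Q) J) (\<lambda>_. 0)"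
    using J h by (intro zsum_supermod V) (auto simp: mask2_def mask1_def B_def)
  also have "zsum V (\<lambda>i j. mask2 (P \<inter> Q) J i j + B i j) (\<lambda>i. 0 + 0) = zsum V (mask2 Q J) (\<lambda>_. 0)"
    by (intro wsum_cong) (auto simp: B_def)
  \<comment> \<open>Bonds between P - Q and Q - P and the field on Q - P are still missing here;
    adding them can only increase the sum.\<close>
  also have "zsum V (\<lambda>i j. mask2 P J i j + B i j) (\<lambda>i. mask1 P h i + 0)
      \<le> zsum V (mask2 (P \<union> Q) J) (mask1 (P \<union> Q) h)"
    using J h by (intro wsum_mono V ferro_const) (auto simp: mask2_def mask1_def B_def)
  finally show ?thesis using zsum_pos[OF V] by (simp add: mult_right_mono less_imp_le)
qed

section \<open>Two replicas and the set where they disagree\<close>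

definition flip :: "'v set \<Rightarrow> 'v set \<Rightarrow> ('v \<Rightarrow> real) \<Rightarrow> 'v \<Rightarrow> real" where
  "flip V D x = (\<lambda>i\<in>V. if i \<in> D then - x i else x i)"

lemma flip_spins: "x \<in> spins V \<Longrightarrow> flip V D x \<in> spins V"
  by (auto simp: flip_def spins_def PiE_def Pi_def)

lemma flip_flip: "x \<in> spins V \<Longrightarrow> flip V D (flip V D x) = x"
  by (auto simp: flip_def spins_def fun_eq_iff PiE_def extensional_def)

lemma sum_flip: "(\<Sum>x\<in>spins V. f (flip V D x)) = (\<Sum>x\<in>spins V. f x)"
  by (rule sum.reindex_bij_witness[of _ "flip V D" "flip V D"]) (auto simp: flip_spins flip_flip)

lemma wsum_odd_zero:
  assumes "\<And>x. x \<in> spins V \<Longrightarrow> f (flip V V x) = - f x"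
  shows "wsum V J (\<lambda>_. 0) f = 0"
proof -
  have "wsum V J (\<lambda>_. 0) f = (\<Sum>x\<in>spins V. f (flip V V x) * exp (energy V J (\<lambda>_. 0) (flip V V x)))"
    unfolding wsum_def by (rule sum_flip[symmetric])
  also have "\<dots> = - wsum V J (\<lambda>_. 0) f"
    using assms by (simp add: wsum_def energy_def flip_def sum_negf cong: sum.cong)
  finally show ?thesis by simp
qed

lemma sum_spins_eq_sum_flips:
  assumes x: "x \<in> spins V"
  shows "(\<Sum>y\<in>spins V. f y) = (\<Sum>D\<in>Pow V. f (flip V D x))"
proof (rule sum.reindex_bij_witness[of _ "\<lambda>D. flip V D x" "\<lambda>y. {i\<in>V. y i \<noteq> x i}"])
  fix y assume y: "y \<in> spins V"
  show "flip V {i \<in> V. y i \<noteq> x i} x = y"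
  proof
    fix i show "flip V {i \<in> V. y i \<noteq> x i} x i = y i"
    proof (cases "i \<in> V")
      case True
      show ?thesis
        by (rule spins_cases[OF x True]; rule spins_cases[OF y True]) (use True in \<open>auto simp: flip_def\<close>)
    next
      case False
      then show ?thesis using y by (simp add: flip_def spins_def PiE_def extensional_def)
    qed
  qed
  then show "f (flip V {i \<in> V. y i \<noteq> x i} x) = f y" by simp
next
  fix D assume D: "D \<in> Pow V"
  have "- x i \<noteq> x i" if "i \<in> V" for i
    using spins_sq[OF x that] by auto
  then show "{i \<in> V. flip V D x i \<noteq> x i} = D" using D by (auto simp: flip_def)
qed (auto simp: flip_spins x)

text \<open>As f reads the coordinates in D and g those outside, exchanging the coordinates outside
  D between two configurations makes both factors read the same one. All sums run over
  \<open>spins V\<close>, hence the power of 2 for the idle second configuration.\<close>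

lemma sum_spins_indep:
  fixes f g :: "('v \<Rightarrow> real) \<Rightarrow> real"
  assumes V: "finite V"
    and f: "\<And>x y. (\<And>i. i \<in> V \<inter> D \<Longrightarrow> x i = y i) \<Longrightarrow> f x = f y"
    and g: "\<And>x y. (\<And>i. i \<in> V - D \<Longrightarrow> x i = y i) \<Longrightarrow> g x = g y"
  shows "(\<Sum>x\<in>spins V. f x) * (\<Sum>x\<in>spins V. g x) = 2 ^ card V * (\<Sum>x\<in>spins V. f x * g x)"
proof -
  define M :: "('v \<Rightarrow> real) \<Rightarrow> ('v \<Rightarrow> real) \<Rightarrow> 'v \<Rightarrow> real"
    where "M = (\<lambda>x y i. if i \<in> D then x i else y i)"
  have M: "M x y \<in> spins V" if "x \<in> spins V" "y \<in> spins V" for x y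
    using that by (auto simp: M_def spins_def PiE_def Pi_def extensional_def)
  have card: "card (spins V) = 2 ^ card V"
    unfolding spins_def using V by (simp add: card_PiE numeral_2_eq_2)
  have fM: "f (M x y) = f x" and gM: "g (M x y) = g y" for x y
    by (rule f, simp add: M_def) (rule g, simp add: M_def)
  have "(\<Sum>x\<in>spins V. f x) * (\<Sum>x\<in>spins V. g x)
      = (\<Sum>(x, y)\<in>spins V \<times> spins V. f (M x y) * g (M x y))"
    by (simp add: sum_product sum.cartesian_product fM gM)
  also have "\<dots> = (\<Sum>(x, y)\<in>spins V \<times> spins V. f x * g x)"
    by (rule sum.reindex_bij_witness[of _ "\<lambda>(x, y). (M x y, M y x)" "\<lambda>(x, y). (M x y, M y x)"])
       (auto simp: M fun_eq_iff, auto simp: M_def)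
  also have "\<dots> = 2 ^ card V * (\<Sum>x\<in>spins V. f x * g x)"
    by (simp add: sum.cartesian_product[symmetric] card sum_distrib_left)
  finally show ?thesis .
qed

lemma energy_mask_indep:
  assumes "\<And>i. i \<in> V \<inter> D \<Longrightarrow> x i = y i"
  shows "energy V (mask2 D J) (mask1 D h) x = energy V (mask2 D J) (mask1 D h) y"
  unfolding energy_def mask2_def mask1_def
  by (intro arg_cong2[where f = "(+)"] sum.cong refl) (use assms in auto)

text \<open>Between x and its flip on D, the bonds from D to its complement and the field on D enter
  with opposite signs and cancel; everything else doubles.\<close>

lemma energy_replica:
  "energy V J h x + energy V J h (flip V D x) =
    energy V (mask2 D (\<lambda>i j. 2 * J i j)) (\<lambda>_. 0) x +
    energy V (mask2 (V - D) (\<lambda>i j. 2 * J i j)) (mask1 (V - D) (\<lambda>i. 2 * h i)) x"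
proof -
  have "energy V J h x + energy V J h (flip V D x) =
    (\<Sum>i\<in>V. \<Sum>j\<in>V. J i j * (x i * x j) + J i j * (flip V D x i * flip V D x j)) +
    (\<Sum>i\<in>V. h i * x i + h i * flip V D x i)"
    by (simp add: energy_def sum.distrib)
  also have "\<dots> = energy V (\<lambda>i j. mask2 D (\<lambda>i j. 2 * J i j) i j + mask2 (V - D) (\<lambda>i j. 2 * J i j) i j)
       (\<lambda>i. 0 + mask1 (V - D) (\<lambda>i. 2 * h i) i) x"
    unfolding energy_def
    by (intro arg_cong2[where f = "(+)"] sum.cong refl)
       (auto simp: mask2_def mask1_def flip_def algebra_simps)
  finally show ?thesis unfolding energy_add .
qed

lemma replica_sum:
  "(\<Sum>x\<in>spins V. \<Sum>y\<in>spins V. g x y * (exp (energy V J h x) * exp (energy V J h y))) =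
   (\<Sum>D\<in>Pow V. \<Sum>x\<in>spins V. g x (flip V D x) *
      exp (energy V (mask2 D (\<lambda>i j. 2 * J i j)) (\<lambda>_. 0) x) *
      exp (energy V (mask2 (V - D) (\<lambda>i j. 2 * J i j)) (mask1 (V - D) (\<lambda>i. 2 * h i)) x))"
proof -
  have "(\<Sum>x\<in>spins V. \<Sum>y\<in>spins V. g x y * (exp (energy V J h x) * exp (energy V J h y)))
    = (\<Sum>x\<in>spins V. \<Sum>D\<in>Pow V. g x (flip V D x) * exp (energy V J h x + energy V J h (flip V D x)))"
    unfolding exp_add by (intro sum.cong refl sum_spins_eq_sum_flips)
  then show ?thesis
    unfolding energy_replica exp_add by (subst (asm) sum.swap) (simp add: mult.assoc)
qed

text \<open>Two replicas \<open>x\<close>, \<open>y\<close> decouple given the set \<open>D\<close> where they disagree: \<open>x\<close> is then an Ising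
  configuration with doubled couplings on \<open>D\<close> and on its complement, and the field acts only off
  \<open>D\<close>. The law of \<open>D\<close> decreases with the field, by four functions; the truncated correlation is the
  expectation of an increasing function of \<open>D\<close>.\<close>

lemma covariance_le_zero_field:
  assumes V: "finite V" and ij: "i \<in> V" "j \<in> V"
    and J: "\<And>i j. i \<in> V \<Longrightarrow> j \<in> V \<Longrightarrow> 0 \<le> J i j" and h: "\<And>i. i \<in> V \<Longrightarrow> 0 \<le> h i"
  shows "mean V J h (\<lambda>x. x i * x j) - mean V J h (\<lambda>x. x i) * mean V J h (\<lambda>x. x j)
    \<le> mean V J (\<lambda>_. 0) (\<lambda>x. x i * x j)"
proof -
  define J2 where "J2 = (\<lambda>i j. 2 * J i j)"
  \<comment> \<open>\<open>F D / G D\<close> is the two-point function of the doubled model on D,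
    set to 0 unless D contains both sites.\<close>
  define F where "F D = (if i \<in> D \<and> j \<in> D then wsum V (mask2 D J2) (\<lambda>_. 0) (\<lambda>x. x i * x j) else 0)" for D
  define G where "G D = zsum V (mask2 D J2) (\<lambda>_. 0)" for D
  define K where "K h D = zsum V (mask2 D J2) (mask1 D (\<lambda>i. 2 * h i))" for h D
  define N :: real where "N = 2 ^ card V"
  have N: "N > 0" by (simp add: N_def)
  have J2: "0 \<le> mask2 D J2 i j" if "i \<in> V" "j \<in> V" for D i j
    using J that by (auto simp: mask2_def J2_def)
  have m1: "mask1 D (\<lambda>i. 0) = (\<lambda>_. 0)" for D :: "'a set"
    by (simp add: mask1_def fun_eq_iff)
  have K0: "K (\<lambda>_. 0) = G" by (simp add: K_def G_def fun_eq_iff m1)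
  have indep: "N * (\<Sum>x\<in>spins V. \<phi> x * exp (energy V (mask2 D J2) (\<lambda>_. 0) x) *
      exp (energy V (mask2 (V - D) J2) (mask1 (V - D) (\<lambda>i. 2 * h i)) x))
      = wsum V (mask2 D J2) (\<lambda>_. 0) \<phi> * K h (V - D)"
    if "\<And>x y. (\<And>i. i \<in> V \<inter> D \<Longrightarrow> x i = y i) \<Longrightarrow> \<phi> x = \<phi> y" for \<phi> D h
  proof -
    have e: "energy V (mask2 D J2) (\<lambda>_. 0) x = energy V (mask2 D J2) (\<lambda>_. 0) y"
      if "\<And>i. i \<in> V \<inter> D \<Longrightarrow> x i = y i" for x y
      using energy_mask_indep[of V D x y J2 "\<lambda>_. 0", OF that] by (simp add: m1)
    have e': "energy V (mask2 (V - D) J2) (mask1 (V - D) k) x = energy V (mask2 (V - D) J2) (mask1 (V - D) k) y"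
      if "\<And>i. i \<in> V - D \<Longrightarrow> x i = y i" for x y k
      using that by (intro energy_mask_indep) auto
    show ?thesis
      unfolding wsum_def K_def N_def mult_1
      by (rule sum_spins_indep[OF V, of D, symmetric])
         (use e e' that in \<open>metis (no_types, lifting)\<close>)+
  qed
  have Z2: "zsum V J h * zsum V J h = (\<Sum>D\<in>Pow V. G D * K h (V - D)) / N" for h
  proof -
    have "zsum V J h * zsum V J h = (\<Sum>x\<in>spins V. \<Sum>y\<in>spins V. 1 * (exp (energy V J h x) * exp (energy V J h y)))"
      by (simp add: wsum_def sum_product)
    also have "\<dots> = (\<Sum>D\<in>Pow V. G D * K h (V - D) / N)"
      unfolding replica_sum J2_def[symmetric]
      by (intro sum.cong refl) (use indep[of _ "\<lambda>_. 1"] N in \<open>simp add: G_def field_simps\<close>)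
    finally show ?thesis by (simp add: sum_divide_distrib)
  qed
  have C: "wsum V J h (\<lambda>x. x i * x j) * zsum V J h - wsum V J h (\<lambda>x. x i) * wsum V J h (\<lambda>x. x j)
      = 2 * (\<Sum>D\<in>Pow V. F D * K h (V - D)) / N" for h
  proof -
    define T where "T g = (\<Sum>x\<in>spins V. \<Sum>y\<in>spins V. g x y * (exp (energy V J h x) * exp (energy V J h y)))"
      for g :: "('a \<Rightarrow> real) \<Rightarrow> ('a \<Rightarrow> real) \<Rightarrow> real"
    have 1: "T (\<lambda>x y. x i * x j) = wsum V J h (\<lambda>x. x i * x j) * zsum V J h"
      "T (\<lambda>x y. x i * y j) = wsum V J h (\<lambda>x. x i) * wsum V J h (\<lambda>x. x j)"
      unfolding T_def wsum_def sum_product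
      by (rule sum.cong[OF refl], rule sum.cong[OF refl], simp only: mult_ac mult_1)+
    have 2: "T (\<lambda>x y. y i * y j) = T (\<lambda>x y. x i * x j)" "T (\<lambda>x y. y i * x j) = T (\<lambda>x y. x i * y j)"
      unfolding T_def by (rule trans[OF sum.swap], rule sum.cong[OF refl], rule sum.cong[OF refl], simp only: mult_ac)+
    \<comment> \<open>Symmetrised covariance: the product of the differences is
      \<open>4 * (x i * x j)\<close> when the replicas disagree at both sites, and 0
      otherwise.\<close>
    have "T (\<lambda>x y. (x i - y i) * (x j - y j)) =
       T (\<lambda>x y. x i * x j) - T (\<lambda>x y. x i * y j) - T (\<lambda>x y. y i * x j) + T (\<lambda>x y. y i * y j)"
      unfolding T_def sum_subtractf[symmetric] sum.distrib[symmetric]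
      by (intro sum.cong refl) (simp add: algebra_simps)
    then have "2 * (wsum V J h (\<lambda>x. x i * x j) * zsum V J h - wsum V J h (\<lambda>x. x i) * wsum V J h (\<lambda>x. x j))
        = T (\<lambda>x y. (x i - y i) * (x j - y j))" by (simp add: 1 2)
    also have "\<dots> = (\<Sum>D\<in>Pow V. 4 * (F D * K h (V - D) / N))"
      unfolding T_def replica_sum J2_def[symmetric]
    proof (intro sum.cong refl)
      fix D assume D: "D \<in> Pow V"
      have "(x i - flip V D x i) * (x j - flip V D x j) = (if i \<in> D \<and> j \<in> D then 4 * (x i * x j) else 0)" for x
        using ij by (auto simp: flip_def)
      note e = this
      have "(\<Sum>x\<in>spins V. (x i - flip V D x i) * (x j - flip V D x j) *
           exp (energy V (mask2 D J2) (\<lambda>_. 0) x) *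
           exp (energy V (mask2 (V - D) J2) (mask1 (V - D) (\<lambda>i. 2 * h i)) x))
         = (if i \<in> D \<and> j \<in> D then 4 * (\<Sum>x\<in>spins V. (x i * x j) *
           exp (energy V (mask2 D J2) (\<lambda>_. 0) x) *
           exp (energy V (mask2 (V - D) J2) (mask1 (V - D) (\<lambda>i. 2 * h i)) x)) else 0)"
      proof (cases "i \<in> D \<and> j \<in> D")
        case True
        show ?thesis unfolding e if_P[OF True] by (simp add: sum_distrib_left mult.assoc)
      next
        case False
        show ?thesis unfolding e if_not_P[OF False] by simp
      qed
      also have "\<dots> = 4 * (F D * K h (V - D) / N)"
      proof (cases "i \<in> D \<and> j \<in> D")
        case True
        have "N * (\<Sum>x\<in>spins V. (x i * x j) * exp (energy V (mask2 D J2) (\<lambda>_. 0) x) *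
            exp (energy V (mask2 (V - D) J2) (mask1 (V - D) (\<lambda>i. 2 * h i)) x))
            = wsum V (mask2 D J2) (\<lambda>_. 0) (\<lambda>x. x i * x j) * K h (V - D)"
          by (rule indep) (use True ij in simp)
        then show ?thesis
          unfolding if_P[OF True] F_def using N by (simp only: nonzero_eq_divide_eq times_divide_eq_right) (simp only: mult_ac)
      next
        case False
        then show ?thesis unfolding if_not_P[OF False] F_def by simp
      qed
      finally show "(\<Sum>x\<in>spins V. (x i - flip V D x i) * (x j - flip V D x j) *
           exp (energy V (mask2 D J2) (\<lambda>_. 0) x) *
           exp (energy V (mask2 (V - D) J2) (mask1 (V - D) (\<lambda>i. 2 * h i)) x))
         = 4 * (F D * K h (V - D) / N)" .
    qed
    finally have "2 * (wsum V J h (\<lambda>x. x i * x j) * zsum V J h - wsum V J h (\<lambda>x. x i) * wsum V J h (\<lambda>x. x j))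
        = 4 * ((\<Sum>D\<in>Pow V. F D * K h (V - D)) / N)"
      by (simp only: sum_distrib_left[symmetric] sum_divide_distrib[symmetric])
    then show ?thesis by simp
  qed
  have Gpos: "0 < G D" and Kpos: "0 < K h D" for D h
    using zsum_pos[OF V] by (simp_all add: G_def K_def)
  have Fnn: "0 \<le> F D" for D
    unfolding F_def using ij J2 by (auto intro!: wsum_nonneg ferro_pair V)
  \<comment> \<open>Up to normalisation \<open>G D * K h (V - D)\<close> and
    \<open>G D * G (V - D)\<close> are the laws of D at field h and at zero field, so this compares
    the two means of F / G.\<close>
  have four: "(\<Sum>D\<in>Pow V. F D * K h (V - D)) * (\<Sum>D\<in>Pow V. G D * G (V - D))
      \<le> (\<Sum>D\<in>Pow V. F D * G (V - D)) * (\<Sum>D\<in>Pow V. G D * K h (V - D))"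
  proof (rule four_functions[OF V])
    fix A B assume AB: "A \<subseteq> V" "B \<subseteq> V"
    \<comment> \<open>F / G increases with its set by Griffiths, and G is log-supermodular.\<close>
    have "F A * G B \<le> F (A \<union> B) * G (A \<inter> B)"
    proof (cases "i \<in> A \<and> j \<in> A")
      case True
      have s: "G A * G B \<le> G (A \<union> B) * G (A \<inter> B)"
        using zsum_mask_supermod[of V J2 "\<lambda>_. 0" A B] V J by (simp add: G_def m1 J2_def)
      have "mean V (mask2 A J2) (\<lambda>_. 0) (\<lambda>x. x i * x j) \<le> mean V (mask2 (A \<union> B) J2) (\<lambda>_. 0) (\<lambda>x. x i * x j)"
        using J by (intro mean_mono V ferro_pair ij) (auto simp: mask2_def J2_def)
      then have "F A / G A \<le> F (A \<union> B) / G (A \<union> B)"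
        using True by (simp add: mean_def F_def G_def)
      then have "F A * (G B * G A) \<le> (F (A \<union> B) / G (A \<union> B) * G A) * (G B * G A)"
        using Gpos by (intro mult_right_mono) (auto simp: field_simps less_imp_le)
      also have "\<dots> = (F (A \<union> B) / G (A \<union> B)) * (G A * G B) * G A" by simp
      also have "\<dots> \<le> (F (A \<union> B) / G (A \<union> B)) * (G (A \<union> B) * G (A \<inter> B)) * G A"
        using s Fnn Gpos by (intro mult_right_mono mult_left_mono) (auto simp: less_imp_le)
      also have "\<dots> = (F (A \<union> B) * G (A \<inter> B)) * G A" using Gpos[of "A \<union> B"] by simp
      finally have "(F A * G B) * G A \<le> (F (A \<union> B) * G (A \<inter> B)) * G A" by (simp add: mult.assoc)
      then show ?thesis using Gpos[of A] by (simp add: mult_le_cancel_right)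
    next
      case False
      then have "F A = 0" by (auto simp: F_def)
      then show ?thesis using Fnn Gpos by (simp add: less_imp_le)
    qed
    \<comment> \<open>Complements exchange unions and intersections: the field pushes D
      down.\<close>
    moreover have "K h (V - A) * G (V - B) \<le> K h ((V - A) \<union> (V - B)) * G ((V - A) \<inter> (V - B))"
      using zsum_mask_supermod[of V J2 "\<lambda>i. 2 * h i" "V - A" "V - B"] V J h by (simp add: G_def K_def J2_def)
    then have "K h (V - A) * G (V - B) \<le> K h (V - (A \<inter> B)) * G (V - (A \<union> B))"
      by (simp add: Diff_Int Diff_Un)
    ultimately have "(F A * G B) * (K h (V - A) * G (V - B))
        \<le> (F (A \<union> B) * G (A \<inter> B)) * (K h (V - (A \<inter> B)) * G (V - (A \<union> B)))"
      by (rule mult_mono) (use Fnn Gpos Kpos in \<open>auto simp: less_imp_le\<close>)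
    then show "F A * K h (V - A) * (G B * G (V - B))
        \<le> F (A \<union> B) * G (V - (A \<union> B)) * (G (A \<inter> B) * K h (V - A \<inter> B))"
      by (simp add: algebra_simps)
  qed (use Fnn Gpos Kpos in \<open>auto simp: less_imp_le\<close>)
  define Zh Z0 Ch C0 where "Zh = zsum V J h" and "Z0 = zsum V J (\<lambda>_. 0)"
    and "Ch = wsum V J h (\<lambda>x. x i * x j) * zsum V J h - wsum V J h (\<lambda>x. x i) * wsum V J h (\<lambda>x. x j)"
    and "C0 = wsum V J (\<lambda>_. 0) (\<lambda>x. x i * x j)"
  have odd: "wsum V J (\<lambda>_. 0) (\<lambda>x. x i) = 0"
    using ij by (intro wsum_odd_zero) (simp add: flip_def)
  have "Ch * (Z0 * Z0) \<le> (C0 * Z0) * (Zh * Zh)"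
  proof -
    have e1: "C0 * Z0 = 2 * (\<Sum>D\<in>Pow V. F D * G (V - D)) / N"
      using C[of "\<lambda>_. 0"] odd by (simp add: C0_def Z0_def K0)
    have e2: "Ch = 2 * (\<Sum>D\<in>Pow V. F D * K h (V - D)) / N"
      using C[of h] by (simp add: Ch_def)
    have e3: "Z0 * Z0 = (\<Sum>D\<in>Pow V. G D * G (V - D)) / N"
      using Z2[of "\<lambda>_. 0"] by (simp add: Z0_def K0)
    have e4: "Zh * Zh = (\<Sum>D\<in>Pow V. G D * K h (V - D)) / N"
      using Z2[of h] by (simp add: Zh_def)
    have nn: "0 \<le> N * N" by simp
    show ?thesis
      using divide_right_mono[OF mult_left_mono[OF four, of 2] nn]
      unfolding e1 e2 e3 e4 by (simp only: times_divide_times_eq mult.assoc zero_le_numeral simp_thms)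
  qed
  then have "(Ch * Z0) * Z0 \<le> (C0 * (Zh * Zh)) * Z0" by (simp only: mult_ac)
  moreover have Z: "0 < Zh" "0 < Z0" by (simp_all add: Zh_def Z0_def zsum_pos[OF V])
  ultimately have "Ch * Z0 \<le> C0 * (Zh * Zh)" by (simp only: mult_le_cancel_right_pos)
  then have "Ch / (Zh * Zh) \<le> C0 / Z0" using Z by (simp add: divide_le_eq le_divide_eq mult.commute)
  moreover have "Ch / (Zh * Zh) = mean V J h (\<lambda>x. x i * x j) - mean V J h (\<lambda>x. x i) * mean V J h (\<lambda>x. x j)"
    unfolding mean_def Zh_def[symmetric] using Z by (simp add: Ch_def Zh_def[symmetric] diff_divide_distrib)
  ultimately show ?thesis by (simp add: mean_def C0_def Z0_def)
qed

section \<open>Exploration from the external field\<close>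

lemma wsum_add: "wsum V J h (\<lambda>x. f x + g x) = wsum V J h f + wsum V J h g"
  by (simp add: wsum_def sum.distrib distrib_right)

lemma wsum_scale: "wsum V J h (\<lambda>x. a * f x) = a * wsum V J h f"
  by (simp add: wsum_def sum_distrib_left mult.assoc)

lemma wsum_sum: "wsum V J h (\<lambda>x. \<Sum>k\<in>I. f k x) = (\<Sum>k\<in>I. wsum V J h (f k))"
  unfolding wsum_def sum_distrib_right by (rule sum.swap)

text \<open>Total covariance for a mixture of two components, with unnormalised masses z0 and z1.
  The covariance of the component means is a positive multiple of (Q1 - Q0)(B1 - B0), nonnegative
  because both observables have the larger mean in the second component.\<close>

lemma mixture_covariance:
  fixes z0 z1 q0 q1 b0 b1 t0 t1 c :: real
  assumes z: "0 < z0" "0 < z1"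
    and 0: "c * (z0 - q0) * z0 \<le> t0 * z0 - q0 * b0"
    and 1: "c * (z1 - q1) * z1 \<le> t1 * z1 - q1 * b1"
    and q: "q0 * z1 \<le> q1 * z0" and b: "b0 * z1 \<le> b1 * z0"
  shows "c * ((z0 + z1) - (q0 + q1)) * (z0 + z1) \<le> (t0 + t1) * (z0 + z1) - (q0 + q1) * (b0 + b1)"
proof -
  define Q0 Q1 B0 B1 T0 T1 where "Q0 = q0 / z0" "Q1 = q1 / z1" "B0 = b0 / z0" "B1 = b1 / z1"
    "T0 = t0 / z0" "T1 = t1 / z1"
  note defs = this
  have e: "q0 = Q0 * z0" "q1 = Q1 * z1" "b0 = B0 * z0" "b1 = B1 * z1" "t0 = T0 * z0" "t1 = T1 * z1"
    using z by (simp_all add: defs)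
  have 0: "c * (1 - Q0) \<le> T0 - Q0 * B0"
  proof -
    have "c * (1 - Q0) * (z0 * z0) \<le> (T0 - Q0 * B0) * (z0 * z0)"
      using 0 unfolding e by (simp add: algebra_simps)
    then show ?thesis using z by (simp add: mult_le_cancel_right)
  qed
  have 1: "c * (1 - Q1) \<le> T1 - Q1 * B1"
  proof -
    have "c * (1 - Q1) * (z1 * z1) \<le> (T1 - Q1 * B1) * (z1 * z1)"
      using 1 unfolding e by (simp add: algebra_simps)
    then show ?thesis using z by (simp add: mult_le_cancel_right)
  qed
  have Q: "Q0 \<le> Q1" and B: "B0 \<le> B1" using q b z by (simp_all add: defs field_simps)
  have "0 \<le> z0 * z1 * ((Q1 - Q0) * (B1 - B0))" using z Q B by simp
  moreover have "z0 * (c * (1 - Q0)) + z1 * (c * (1 - Q1)) \<le> z0 * (T0 - Q0 * B0) + z1 * (T1 - Q1 * B1)"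
    using 0 1 z by (intro add_mono mult_left_mono) auto
  then have "(z0 * (c * (1 - Q0)) + z1 * (c * (1 - Q1))) * (z0 + z1)
      \<le> (z0 * (T0 - Q0 * B0) + z1 * (T1 - Q1 * B1)) * (z0 + z1)"
    using z by (intro mult_right_mono) auto
  ultimately show ?thesis unfolding e by (simp add: algebra_simps)
qed

lemma energy_fun_upd:
  assumes V: "finite V" and i: "i \<in> V"
  shows "energy V J h (y(i := 1)) = energy (V - {i}) J (\<lambda>j. h j + J i j + J j i) y + (J i i + h i)"
proof -
  have s: "(\<Sum>a\<in>V. f a) = f i + (\<Sum>a\<in>V - {i}. f a)" for f :: "'a \<Rightarrow> real"
    using V i by (rule sum.remove)
  show ?thesis
    unfolding energy_def s
    by (simp add: sum.distrib algebra_simps)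
qed

text \<open>The indicator of spin 1 at i is written \<open>(1 + x i) / 2\<close>, which is visibly
  ferromagnetic and can therefore serve as a weight in Ginibre's inequality.\<close>

lemma sum_spins_remove:
  assumes V: "finite V" and i: "i \<in> V"
  shows "(\<Sum>x\<in>spins V. (1 + x i) / 2 * g x) = (\<Sum>y\<in>spins (V - {i}). g (y(i := 1)))"
proof -
  have fin: "finite (spins V)" by (rule finite_spins[OF V])
  have "(\<Sum>x\<in>spins V. (1 + x i) / 2 * g x) = (\<Sum>x\<in>spins V. if x i = 1 then g x else 0)"
  proof (intro sum.cong refl)
    fix x assume x: "x \<in> spins V"
    show "(1 + x i) / 2 * g x = (if x i = 1 then g x else 0)"
      by (rule spins_cases[OF x i]) auto
  qed
  also have "\<dots> = (\<Sum>x\<in>{x\<in>spins V. x i = 1}. g x)"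
    using fin by (simp add: sum.inter_filter)
  also have "\<dots> = (\<Sum>y\<in>spins (V - {i}). g (y(i := 1)))"
  proof (rule sum.reindex_bij_witness[of _ "\<lambda>y. y(i := 1)" "\<lambda>x. x(i := undefined)"])
    fix y assume "y \<in> spins (V - {i})"
    then show "(y(i := 1))(i := undefined) = y" "y(i := 1) \<in> {x \<in> spins V. x i = 1}"
      using i by (auto simp: spins_def PiE_def Pi_def extensional_def fun_eq_iff)
  next
    fix x assume "x \<in> {x \<in> spins V. x i = 1}"
    then show "(x(i := undefined))(i := 1) = x" "x(i := undefined) \<in> spins (V - {i})"
      by (auto simp: spins_def PiE_def extensional_def fun_eq_iff)
    then show "g ((x(i := undefined))(i := 1)) = g x" by simp
  qed
  finally show ?thesis .
qed

lemma wsum_plus: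
  assumes V: "finite V" and i: "i \<in> V"
  shows "wsum V J h (\<lambda>x. (1 + x i) / 2 * f x) =
    exp (J i i + h i) * wsum (V - {i}) J (\<lambda>j. h j + J i j + J j i) (\<lambda>y. f (y(i := 1)))"
  unfolding wsum_def mult.assoc sum_spins_remove[OF assms]
  unfolding energy_fun_upd[OF assms] exp_add
  by (simp add: sum_distrib_left algebra_simps)

lemma wsum_split_field:
  assumes V: "finite V" and i: "i \<in> V"
  shows "wsum V J h f = exp (- h i) * wsum V J (h(i := 0)) f
     + 2 * sinh (h i) * wsum V J (h(i := 0)) (\<lambda>x. (1 + x i) / 2 * f x)"
proof -
  have e: "energy V J h x = energy V J (h(i := 0)) x + h i * x i" for x
    by (simp add: energy_def sum.remove[OF V i, of "\<lambda>i. h i * x i"]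
      sum.remove[OF V i, of "\<lambda>j. (if j = i then 0 else h j) * x j"])
  have "exp (h i * x i) = exp (- h i) + 2 * sinh (h i) * ((1 + x i) / 2)" if "x \<in> spins V" for x
    by (rule spins_cases[OF that i]) (auto simp: sinh_field_def field_simps)
  then have "wsum V J h f = (\<Sum>x\<in>spins V. f x * exp (energy V J (h(i := 0)) x) *
      (exp (- h i) + 2 * sinh (h i) * ((1 + x i) / 2)))"
    unfolding wsum_def e exp_add by (intro sum.cong refl) simp
  then show ?thesis
    unfolding wsum_def by (simp add: sum.distrib sum_distrib_left algebra_simps)
qed

text \<open>Explore the set of sites joined to the external field. Writing
  \<open>exp (h i * x i) = exp (- h i) + 2 * sinh (h i) * of_bool (x i = 1)\<close> at an active site \<open>i\<close>, either the
  field at \<open>i\<close> is discarded, or \<open>i\<close> is fixed to \<open>1\<close> and passes its couplings on to its neighbours as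
  fields. When no active site is left, the remaining sites form an Ising model without field. Both
  observables have a larger mean in the second case, so the covariance is at least the average of the
  covariances in the two cases. The field \<open>k\<close> remembers all the couplings, including the discarded ones.\<close>

lemma covariance_energy_ge_aux:
  fixes J :: "'v \<Rightarrow> 'v \<Rightarrow> real"
  assumes "finite V" "p \<in> V"
    and "\<And>i j. i \<in> V \<Longrightarrow> j \<in> V \<Longrightarrow> 0 \<le> J i j"
    and "\<And>i. i \<in> V \<Longrightarrow> 0 \<le> h i" "\<And>i. i \<in> V \<Longrightarrow> 0 \<le> k i"
    and "\<And>S. S \<subseteq> V \<Longrightarrow> p \<in> S \<Longrightarrow>
      c \<le> (\<Sum>y\<in>S. (k y + (\<Sum>x\<in>V - S. J x y + J y x)) * mean S J (\<lambda>_. 0) (\<lambda>s. s p * s y))"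
  shows "c * (zsum V J h - wsum V J h (\<lambda>x. x p)) * zsum V J h
    \<le> wsum V J h (\<lambda>x. x p * energy V J k x) * zsum V J h
      - wsum V J h (\<lambda>x. x p) * wsum V J h (energy V J k)"
  using assms
\<comment> \<open>Discarding the field at a site shrinks the set of active sites. Fixing a site may
  activate all the others, but it removes one site, and the quadratic term outweighs this.\<close>
proof (induction "card V * (card V + 1) + card {i\<in>V. h i \<noteq> 0}" arbitrary: V h k rule: less_induct)
  case less
  note V = less.prems(1) and p = less.prems(2) and J = less.prems(3) and h = less.prems(4)
    and k = less.prems(5) and c = less.prems(6)
  show ?case
  proof (cases "\<forall>i\<in>V. h i = 0")
    \<comment> \<open>Without active sites the law is even: only the part of the energy linear in
      the spins correlates with \<open>x p\<close>, and the hypothesis for S = V is what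
      remains.\<close>
    case True
    have h0: "wsum V J h f = wsum V J (\<lambda>_. 0) f" for f
      using True by (intro wsum_cong) auto
    have q: "wsum V J (\<lambda>_. 0) (\<lambda>x. x p) = 0"
      using p by (intro wsum_odd_zero) (simp add: flip_def)
    have "wsum V J (\<lambda>_. 0) (\<lambda>x. x p * energy V J k x)
       = wsum V J (\<lambda>_. 0) (\<lambda>x. x p * energy V J (\<lambda>_. 0) x + (\<Sum>y\<in>V. k y * (x p * x y)))"
    proof (intro wsum_cong refl)
      fix x
      have "energy V J k x = energy V J (\<lambda>_. 0) x + (\<Sum>y\<in>V. k y * x y)" by (simp add: energy_def)
      moreover have "x p * (\<Sum>y\<in>V. k y * x y) = (\<Sum>y\<in>V. k y * (x p * x y))"
        unfolding sum_distrib_left by (rule sum.cong) auto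
      ultimately show "x p * energy V J k x = x p * energy V J (\<lambda>_. 0) x + (\<Sum>y\<in>V. k y * (x p * x y))"
        by (metis distrib_left)
    qed
    also have "\<dots> = wsum V J (\<lambda>_. 0) (\<lambda>x. x p * energy V J (\<lambda>_. 0) x)
        + (\<Sum>y\<in>V. k y * wsum V J (\<lambda>_. 0) (\<lambda>x. x p * x y))"
      by (simp add: wsum_add wsum_sum wsum_scale)
    also have "wsum V J (\<lambda>_. 0) (\<lambda>x. x p * energy V J (\<lambda>_. 0) x) = 0"
      using p by (intro wsum_odd_zero) (simp add: flip_def energy_def)
    finally have t: "wsum V J (\<lambda>_. 0) (\<lambda>x. x p * energy V J k x)
        = (\<Sum>y\<in>V. k y * wsum V J (\<lambda>_. 0) (\<lambda>x. x p * x y))" by simp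
    have "c * zsum V J (\<lambda>_. 0) \<le> (\<Sum>y\<in>V. k y * mean V J (\<lambda>_. 0) (\<lambda>s. s p * s y)) * zsum V J (\<lambda>_. 0)"
      using c[of V] p zsum_pos[OF V, of J "\<lambda>_. 0"] by (intro mult_right_mono) auto
    also have "\<dots> = (\<Sum>y\<in>V. k y * wsum V J (\<lambda>_. 0) (\<lambda>x. x p * x y))"
      by (simp only: sum_distrib_right mult.assoc wsum_eq_mean[OF V, symmetric])
    finally show ?thesis
      unfolding h0 q t using zsum_pos[OF V, of J "\<lambda>_. 0"] by (simp add: mult_right_mono)
  next
    case False
    then obtain i where i: "i \<in> V" "h i \<noteq> 0" by blast
    then have hi: "0 < h i" using h[of i] by simp
    define h0 where "h0 = h(i := 0)"
    define V' where "V' = V - {i}"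
    define h1 where "h1 = (\<lambda>j. h0 j + J i j + J j i)"
    define k1 where "k1 = (\<lambda>j. k j + J i j + J j i)"
    define a b where "a = exp (- h i)" and "b = 2 * sinh (h i)"
    have ab: "0 < a" "0 < b" using hi by (simp_all add: a_def b_def)
    have V': "finite V'" and cV: "card V = Suc (card V')"
      using V card_Suc_Diff1[OF V i(1)] by (simp_all add: V'_def)
    have h0: "0 \<le> h0 j" if "j \<in> V" for j using h that by (simp add: h0_def)
    have split: "wsum V J h f = a * wsum V J h0 f + b * wsum V J h0 (\<lambda>x. (1 + x i) / 2 * f x)" for f
      unfolding a_def b_def h0_def by (rule wsum_split_field[OF V i(1)])
    define w where "w = b * exp (J i i)"
    have w: "0 < w" using ab by (simp add: w_def)
    have plus: "b * wsum V J h0 (\<lambda>x. (1 + x i) / 2 * f x) = w * wsum V' J h1 (\<lambda>y. f (y(i := 1)))" for f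
      using wsum_plus[OF V i(1), of J h0 f] by (simp add: w_def h1_def V'_def h0_def)
    \<comment> \<open>Fixing i to 1 raises the mean of every ferromagnetic observable; this is the
      ordering that the mixture needs, for the spin and for the energy.\<close>
    have mono: "(a * wsum V J h0 F) * (b * wsum V J h0 (\<lambda>x. (1 + x i) / 2 * 1))
        \<le> (b * wsum V J h0 (\<lambda>x. (1 + x i) / 2 * F x)) * (a * zsum V J h0)" if F: "ferro V F" for F
    proof -
      have "ferro V (\<lambda>x. 1/2 * (1 + x i))"
        using i by (intro ferro_scale ferro_add ferro_const ferro_spin V) auto
      then have "wsum V J h0 (\<lambda>x. (1 + x i) / 2) * wsum V J h0 F
          \<le> wsum V J h0 (\<lambda>x. (1 + x i) / 2 * F x) * zsum V J h0"
        using J h0 by (intro ginibre V F) auto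
      then show ?thesis using ab
        by (simp add: mult_ac) 
    qed
    have IH0: "c * (zsum V J h0 - wsum V J h0 (\<lambda>x. x p)) * zsum V J h0
      \<le> wsum V J h0 (\<lambda>x. x p * energy V J k x) * zsum V J h0
      - wsum V J h0 (\<lambda>x. x p) * wsum V J h0 (energy V J k)"
    proof (rule less.hyps)
      have "{j \<in> V. h0 j \<noteq> 0} \<subset> {j \<in> V. h j \<noteq> 0}" using i by (auto simp: h0_def)
      then have "card {j \<in> V. h0 j \<noteq> 0} < card {j \<in> V. h j \<noteq> 0}"
        using V by (intro psubset_card_mono) auto
      then show "card V * (card V + 1) + card {i \<in> V. h0 i \<noteq> 0} < card V * (card V + 1) + card {i \<in> V. h i \<noteq> 0}"
        by simp
    qed (use V p J h0 k c in auto)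
    \<comment> \<open>The additive constant \<open>J i i + k i\<close> drops out of the
      covariance.\<close>
    have e1: "energy V J k (y(i := 1)) = energy V' J k1 y + (J i i + k i)" for y
      unfolding V'_def k1_def by (rule energy_fun_upd[OF V i(1)])
    have IH1: "c * (zsum V' J h1 - wsum V' J h1 (\<lambda>y. (y(i := 1)) p)) * zsum V' J h1
      \<le> wsum V' J h1 (\<lambda>y. (y(i := 1)) p * energy V J k (y(i := 1))) * zsum V' J h1
      - wsum V' J h1 (\<lambda>y. (y(i := 1)) p) * wsum V' J h1 (\<lambda>y. energy V J k (y(i := 1)))"
    \<comment> \<open>If p itself is fixed, its spin is constant and both sides vanish.\<close>
    proof (cases "p = i")
      case True
      then show ?thesis by simp
    next
      case False
      then have p': "p \<in> V'" using p by (simp add: V'_def)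
      have "c * (zsum V' J h1 - wsum V' J h1 (\<lambda>x. x p)) * zsum V' J h1
        \<le> wsum V' J h1 (\<lambda>x. x p * energy V' J k1 x) * zsum V' J h1
        - wsum V' J h1 (\<lambda>x. x p) * wsum V' J h1 (energy V' J k1)"
      proof (rule less.hyps)
        have "card {i \<in> V'. h1 i \<noteq> 0} \<le> card V'" using V' by (intro card_mono) auto
        then show "card V' * (card V' + 1) + card {i \<in> V'. h1 i \<noteq> 0} < card V * (card V + 1) + card {i \<in> V. h i \<noteq> 0}"
          unfolding cV by simp
        show "0 \<le> J i j" if "i \<in> V'" "j \<in> V'" for i j using J that by (simp add: V'_def)
        show "0 \<le> h1 j" "0 \<le> k1 j" if "j \<in> V'" for j
          using that h0[of j] k[of j] J[of i j] J[of j i] i(1) by (simp_all add: V'_def h1_def k1_def)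
        fix S assume S: "S \<subseteq> V'" "p \<in> S"
        \<comment> \<open>The couplings of i move from the boundary sum into \<open>k1\<close>, so
          the lower bound c is inherited unchanged for every S avoiding i.\<close>
        have "k y + (\<Sum>x\<in>V - S. J x y + J y x) = k1 y + (\<Sum>x\<in>V' - S. J x y + J y x)" for y
        proof -
          have "i \<in> V - S" "V' - S = (V - S) - {i}" using S i by (auto simp: V'_def)
          then show ?thesis
            using V by (simp add: sum.remove[of "V - S" i] k1_def)
        qed
        moreover have "S \<subseteq> V" using S by (auto simp: V'_def)
        ultimately show "c \<le> (\<Sum>y\<in>S. (k1 y + (\<Sum>x\<in>V' - S. J x y + J y x)) * mean S J (\<lambda>_. 0) (\<lambda>s. s p * s y))"
          using c[of S] S(2) by simp
      qed (use V' p' in auto)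
      moreover have "wsum V' J h1 (\<lambda>y. (y(i := 1)) p * energy V J k (y(i := 1)))
         = wsum V' J h1 (\<lambda>x. x p * energy V' J k1 x) + (J i i + k i) * wsum V' J h1 (\<lambda>x. x p)"
        unfolding e1 wsum_scale[symmetric] wsum_add[symmetric]
        using False by (intro wsum_cong) (simp_all add: algebra_simps)
      moreover have "wsum V' J h1 (\<lambda>y. energy V J k (y(i := 1)))
         = wsum V' J h1 (energy V' J k1) + (J i i + k i) * zsum V' J h1"
        unfolding e1 wsum_scale[symmetric] wsum_add[symmetric]
        by (intro wsum_cong) simp_all
      moreover have "wsum V' J h1 (\<lambda>y. (y(i := 1)) p) = wsum V' J h1 (\<lambda>x. x p)"
        using False by simp
      ultimately show ?thesis by (simp add: algebra_simps)
    qed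
    have fE: "ferro V (energy V J k)" by (intro ferro_energy V J k)
    have fp: "ferro V (\<lambda>x. x p)" by (intro ferro_spin V p)
    have sc: "c * (u * z - u * q) * (u * z) \<le> (u * t) * (u * z) - (u * q) * (u * r)"
      if "c * (z - q) * z \<le> t * z - q * r" for u z q t r :: real
      using mult_left_mono[OF that, of "u * u"] by (simp add: algebra_simps)
    show ?thesis
      unfolding split[of "\<lambda>_. 1"] split[of "\<lambda>x. x p"] split[of "energy V J k"]
        split[of "\<lambda>x. x p * energy V J k x"]
    proof (rule mixture_covariance)
      show "0 < a * zsum V J h0" using ab zsum_pos[OF V] by simp
      show "0 < b * wsum V J h0 (\<lambda>x. (1 + x i) / 2 * 1)"
        unfolding plus using w zsum_pos[OF V'] by simp
      show "c * (a * zsum V J h0 - a * wsum V J h0 (\<lambda>x. x p)) * (a * zsum V J h0)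
        \<le> a * wsum V J h0 (\<lambda>x. x p * energy V J k x) * (a * zsum V J h0)
          - a * wsum V J h0 (\<lambda>x. x p) * (a * wsum V J h0 (energy V J k))"
        by (rule sc[OF IH0])
      show "c * (b * wsum V J h0 (\<lambda>x. (1 + x i) / 2 * 1) - b * wsum V J h0 (\<lambda>x. (1 + x i) / 2 * x p)) *
            (b * wsum V J h0 (\<lambda>x. (1 + x i) / 2 * 1))
        \<le> b * wsum V J h0 (\<lambda>x. (1 + x i) / 2 * (x p * energy V J k x)) *
          (b * wsum V J h0 (\<lambda>x. (1 + x i) / 2 * 1)) -
          b * wsum V J h0 (\<lambda>x. (1 + x i) / 2 * x p) * (b * wsum V J h0 (\<lambda>x. (1 + x i) / 2 * energy V J k x))"
        unfolding plus by (rule sc[OF IH1])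
    qed (rule mono[OF fp] mono[OF fE])+
  qed
qed

lemma covariance_energy_ge:
  fixes J :: "'v \<Rightarrow> 'v \<Rightarrow> real"
  assumes "finite V" "p \<in> V"
    and "\<And>i j. i \<in> V \<Longrightarrow> j \<in> V \<Longrightarrow> 0 \<le> J i j"
    and "\<And>i. i \<in> V \<Longrightarrow> 0 \<le> h i" "\<And>i. i \<in> V \<Longrightarrow> 0 \<le> k i"
    and "\<And>S. S \<subseteq> V \<Longrightarrow> p \<in> S \<Longrightarrow>
      c \<le> (\<Sum>y\<in>S. (k y + (\<Sum>x\<in>V - S. J x y + J y x)) * mean S J (\<lambda>_. 0) (\<lambda>s. s p * s y))"
  shows "c * (1 - mean V J h (\<lambda>x. x p))
    \<le> mean V J h (\<lambda>x. x p * energy V J k x) - mean V J h (\<lambda>x. x p) * mean V J h (energy V J k)"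
proof -
  have z: "0 < zsum V J h" by (rule zsum_pos[OF assms(1)])
  have "c * (1 - mean V J h (\<lambda>x. x p)) * (zsum V J h * zsum V J h)
    \<le> (mean V J h (\<lambda>x. x p * energy V J k x) - mean V J h (\<lambda>x. x p) * mean V J h (energy V J k))
       * (zsum V J h * zsum V J h)"
    using covariance_energy_ge_aux[of V p J h k c, OF assms]
    unfolding wsum_eq_mean[OF assms(1), of J h "\<lambda>x. x p"] wsum_eq_mean[OF assms(1), of J h "energy V J k"]
      wsum_eq_mean[OF assms(1), of J h "\<lambda>x. x p * energy V J k x"]
    by (simp add: algebra_simps)
  then show ?thesis using z by (simp add: mult_le_cancel_right)
qed

section \<open>The Simon--Lieb inequality\<close>

lemma wsum_mask:
  assumes V: "finite V" and S: "S \<subseteq> V"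
    and f: "\<And>x. f (restrict x S) = f x"
  shows "wsum V (mask2 S J) (mask1 S h) f = 2 ^ card (V - S) * wsum S J h f"
proof -
  have fin: "finite S" "finite (V - S)" using V S finite_subset by auto
  have card: "card (spins (V - S)) = 2 ^ card (V - S)"
    unfolding spins_def using fin by (simp add: card_PiE numeral_2_eq_2)
  have e: "energy V (mask2 S J) (mask1 S h) x = energy S J h x" for x
  proof -
    have "(\<Sum>i\<in>V. g i) = (\<Sum>i\<in>S. g i)" if "\<And>i. i \<notin> S \<Longrightarrow> g i = 0" for g :: "'a \<Rightarrow> real"
      by (rule sum.mono_neutral_right) (use V S that in auto)
    then show ?thesis
      unfolding energy_def by (simp add: mask2_def mask1_def cong: sum.cong)
  qed
  have r: "energy S J h (restrict x S) = energy S J h x" for x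
    unfolding energy_def by simp
  have "wsum V (mask2 S J) (mask1 S h) f = (\<Sum>x\<in>spins V. f (restrict x S) * exp (energy S J h (restrict x S)))"
    unfolding wsum_def e r f ..
  also have "\<dots> = (\<Sum>(y, w)\<in>spins S \<times> spins (V - S). f y * exp (energy S J h y))"
  proof (rule sum.reindex_bij_witness[of _ "\<lambda>(y, w) i. if i \<in> S then y i else w i"
        "\<lambda>x. (restrict x S, restrict x (V - S))"])
    fix x assume x: "x \<in> spins V"
    then show "(case (restrict x S, restrict x (V - S)) of (y, w) \<Rightarrow> \<lambda>i. if i \<in> S then y i else w i) = x"
      by (auto simp: fun_eq_iff spins_def PiE_def extensional_def)
    show "(restrict x S, restrict x (V - S)) \<in> spins S \<times> spins (V - S)"
      using x S by (auto simp: spins_def PiE_def Pi_def)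
    show "(case (restrict x S, restrict x (V - S)) of (y, w) \<Rightarrow> f y * exp (energy S J h y)) =
      f (restrict x S) * exp (energy S J h (restrict x S))" by simp
  next
    fix p assume p: "p \<in> spins S \<times> spins (V - S)"
    obtain y w where yw: "p = (y, w)" "y \<in> spins S" "w \<in> spins (V - S)" using p by auto
    show "(case p of (y, w) \<Rightarrow> \<lambda>i. if i \<in> S then y i else w i) \<in> spins V"
      using yw S by (auto simp: spins_def PiE_def Pi_def extensional_def)
    show "(restrict (case p of (y, w) \<Rightarrow> \<lambda>i. if i \<in> S then y i else w i) S,
         restrict (case p of (y, w) \<Rightarrow> \<lambda>i. if i \<in> S then y i else w i) (V - S)) = p"
      using yw by (auto simp: fun_eq_iff spins_def PiE_def extensional_def)
  qed
  also have "\<dots> = 2 ^ card (V - S) * wsum S J h f"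
    by (simp add: sum.cartesian_product[symmetric] card wsum_def sum_distrib_left)
  finally show ?thesis .
qed

lemma mean_mask:
  assumes "finite V" "S \<subseteq> V" "\<And>x. f (restrict x S) = f x"
  shows "mean V (mask2 S J) (mask1 S h) f = mean S J h f"
  unfolding mean_def wsum_mask[OF assms(1,2), of f J h, OF assms(3)]
    wsum_mask[OF assms(1,2), of "\<lambda>_. 1" J h, OF refl] by simp

lemma mask1_zero: "mask1 S (\<lambda>_. 0) = (\<lambda>_. 0)"
  by (simp add: mask1_def fun_eq_iff)

text \<open>Removing sites amounts to switching off their couplings and fields, so this is
  Griffiths' monotonicity.\<close>

lemma mean_mono_set:
  assumes V: "finite V" and S: "S \<subseteq> V"
    and J: "\<And>i j. i \<in> V \<Longrightarrow> j \<in> V \<Longrightarrow> 0 \<le> J i j" and h: "\<And>i. i \<in> V \<Longrightarrow> 0 \<le> h i"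
    and F: "ferro V f" and f: "\<And>x. f (restrict x S) = f x"
  shows "mean S J h f \<le> mean V J h f"
proof -
  have "mean V (mask2 S J) (mask1 S h) f \<le> mean V J h f"
    by (rule mean_mono[OF V F]) (use J h in \<open>auto simp: mask2_def mask1_def\<close>)
  then show ?thesis by (simp add: mean_mask[OF V S, of f J h, OF f])
qed

lemma sinh_le_mult_cosh:
  fixes c :: real assumes "0 \<le> c" shows "sinh c \<le> c * cosh c"
proof -
  have "(\<lambda>c. c * cosh c - sinh c) 0 \<le> (\<lambda>c. c * cosh c - sinh c) c"
  proof (rule DERIV_nonneg_imp_nondecreasing[OF assms])
    fix x :: real assume "0 \<le> x" "x \<le> c"
    then show "\<exists>y. ((\<lambda>c. c * cosh c - sinh c) has_real_derivative y) (at x) \<and> 0 \<le> y"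
      by (intro exI[of _ "x * sinh x"] conjI) (auto intro!: derivative_eq_intros)
  qed
  then show ?thesis by simp
qed

lemma cosh_minus_one_le:
  fixes c :: real shows "cosh c - 1 \<le> c * sinh c"
proof -
  have "1 - c \<le> exp (- c)" "1 + c \<le> exp c" using exp_ge_add_one_self[of c] exp_ge_add_one_self[of "-c"] by simp_all
  then have "(1 - c) * exp c \<le> exp (- c) * exp c" "(1 + c) * exp (- c) \<le> exp c * exp (- c)"
    by (intro mult_right_mono; simp)+
  then have "(1 - c) * exp c + (1 + c) * exp (- c) \<le> 2" by (simp add: exp_minus)
  then show ?thesis by (simp add: cosh_field_def sinh_field_def field_simps)
qed

text \<open>The tangent line inequality \<open>exp 0 \<ge> exp u - u * exp u\<close>, coefficientwise.\<close>

lemma ferro_exp_tangent: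
  assumes V: "finite V" and I: "\<And>e. e \<in> I \<Longrightarrow> 0 \<le> c e \<and> u e \<in> V \<and> v e \<in> V"
  shows "ferro V (\<lambda>x. ((\<Sum>e\<in>I. c e * (x (u e) * x (v e))) - 1) *
      exp (\<Sum>e\<in>I. c e * (x (u e) * x (v e))) + 1)"
  using I
proof (induction I rule: infinite_finite_induct)
  case (insert e I)
  define E where "E x = (\<Sum>e\<in>I. c e * (x (u e) * x (v e)))" for x :: "'a \<Rightarrow> real"
  define X where "X x = x (u e) * x (v e)" for x :: "'a \<Rightarrow> real"
  have e: "0 \<le> c e" "u e \<in> V" "v e \<in> V" using insert.prems by auto
  have X: "X x = 1 \<or> X x = -1" if "x \<in> spins V" for x
    using spins_cases[OF that e(2)] spins_cases[OF that e(3)] unfolding X_def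
    by (metis minus_mult_minus mult.right_neutral mult_1)
  have fX: "ferro V X" unfolding X_def[abs_def] using e V by (intro ferro_pair)
  have 1: "ferro V (\<lambda>x. (E x - 1) * exp (E x) + 1)"
    unfolding E_def using insert by auto
  have "ferro V (\<lambda>x. (\<Prod>e\<in>I. exp (c e * (x (u e) * x (v e)))) - 1)"
    using insert.prems V by (intro ferro_prod_minus_one ferro_exp_pair_minus_one) auto
  then have 2: "ferro V (\<lambda>x. exp (E x) - 1)"
    unfolding E_def using insert.hyps by (simp add: exp_sum)
  have 3: "ferro V (\<lambda>x. exp (c e * X x))"
    unfolding X_def using ferro_if_minus_one[OF V ferro_exp_pair_minus_one[OF V e(2,3,1)]] by simp
  \<comment> \<open>Constant and linear coefficient of the one-bond function; the two hyperbolic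
    inequalities give their signs.\<close>
  have "ferro V (\<lambda>x. (c e * sinh (c e) - cosh (c e) + 1) + (c e * cosh (c e) - sinh (c e)) * X x)"
    using sinh_le_mult_cosh[OF e(1)] cosh_minus_one_le[of "c e"] V
    by (intro ferro_add ferro_const ferro_scale fX) auto
  then have 4: "ferro V (\<lambda>x. (c e * X x - 1) * exp (c e * X x) + 1)"
  proof (rule ferro_cong)
    fix x assume "x \<in> spins V"
    have e1: "exp (c e) = cosh (c e) + sinh (c e)" and e2: "exp (- c e) = cosh (c e) - sinh (c e)"
      by (simp_all add: cosh_plus_sinh cosh_minus_sinh)
    show "(c e * sinh (c e) - cosh (c e) + 1) + (c e * cosh (c e) - sinh (c e)) * X x
        = (c e * X x - 1) * exp (c e * X x) + 1"
      using X[OF \<open>x \<in> spins V\<close>]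
    proof
      assume X: "X x = 1"
      show ?thesis unfolding X mult_1_right e1 by (simp add: algebra_simps)
    next
      assume X: "X x = -1"
      have m: "c e * -1 = - c e" by simp
      show ?thesis unfolding X m e2 by (simp add: algebra_simps)
    qed
  qed
  \<comment> \<open>With u = c X this is (E + u - 1) exp (E + u) + 1 = ((E - 1) exp E + 1) exp u +
    (exp E - 1) u exp u + ((u - 1) exp u + 1), every summand being ferromagnetic.\<close>
  have "ferro V (\<lambda>x. ((E x - 1) * exp (E x) + 1) * exp (c e * X x) +
      ((exp (E x) - 1) * (c e * (X x * exp (c e * X x))) + ((c e * X x - 1) * exp (c e * X x) + 1)))"
    by (rule ferro_add[OF ferro_mult[OF V 1 3]
        ferro_add[OF ferro_mult[OF V 2 ferro_scale[OF ferro_mult[OF V fX 3] e(1)]] 4]])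
  then have "ferro V (\<lambda>x. ((E x + c e * X x) - 1) * (exp (E x) * exp (c e * X x)) + 1)"
    by (rule ferro_cong) (simp add: algebra_simps)
  then show ?case
    using insert.hyps by (simp add: E_def X_def exp_add algebra_simps)
qed (simp_all add: ferro_const[OF V])

text \<open>Take a second replica on \<open>S\<close> and let \<open>\<theta>\<close> be the product of the
  two replicas. A bond \<open>e\<close> inside \<open>S\<close> contributes \<open>exp (J (1 + \<theta>\<^sub>e) x\<^sub>e) = 1 + [\<theta>\<^sub>e = 1] (exp (2 J x\<^sub>e) - 1)\<close>;
  expand over the set \<open>U\<close> of bonds where the second term is chosen. Given \<open>U\<close>, only the boundary
  bonds at the cluster \<open>K\<close> of \<open>p\<close> matter, since flipping \<open>K\<close> kills the terms without them.\<close>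

lemma simon_lieb:
  fixes J :: "'v \<Rightarrow> 'v \<Rightarrow> real"
  assumes V: "finite V" and S: "S \<subseteq> V" and p: "p \<in> S" and z: "z \<in> V - S"
    and J: "\<And>i j. i \<in> V \<Longrightarrow> j \<in> V \<Longrightarrow> 0 \<le> J i j"
  shows "mean V J (\<lambda>_. 0) (\<lambda>x. x p * x z) \<le>
    (\<Sum>y\<in>S. \<Sum>w\<in>V - S. (J y w + J w y) * mean S J (\<lambda>_. 0) (\<lambda>x. x p * x y) *
      mean V J (\<lambda>_. 0) (\<lambda>x. x w * x z))"
proof -
  have finS: "finite S" using V S finite_subset by blast
  define c where "c y w = J y w + J w y" for y w
  have c: "0 \<le> c y w" if "y \<in> V" "w \<in> V" for y w using J that by (simp add: c_def)
  \<comment> \<open>Bonds with an end outside S occur in one replica only and are not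
    doubled.\<close>
  define JR where "JR i j = (if i \<in> S \<and> j \<in> S then 0 else J i j)" for i j
  define A where "A e x = exp (2 * J (fst e) (snd e) * (x (fst e) * x (snd e))) - 1" for e and x :: "'v \<Rightarrow> real"
  define ok :: "'v \<times> 'v \<Rightarrow> ('v \<Rightarrow> real) \<Rightarrow> real" where "ok e \<theta> = of_bool (\<theta> (fst e) = \<theta> (snd e))" for e \<theta>
  define br where "br \<theta> x = (\<Sum>y\<in>S. \<Sum>w\<in>V - S. c y w * (\<theta> p * \<theta> y) * (x y * x w)) - 1" for \<theta> x :: "'v \<Rightarrow> real"
  define R where "R x = exp (energy V JR (\<lambda>_. 0) x)" for x
  define tm where "tm U x \<theta> = (\<Prod>e\<in>U. ok e \<theta>) * ((\<Prod>e\<in>U. A e x) * R x * (x p * x z) * br \<theta> x)" for U x \<theta>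
  have pV: "p \<in> V" and zV: "z \<in> V" using p z S by auto
  have finP: "finite (S \<times> S)" using finS by simp
  have weights: "exp (energy V J (\<lambda>_. 0) x) * exp (energy V (mask2 S J) (\<lambda>_. 0) (twist V x \<theta>))
      = R x * (\<Sum>U\<in>Pow (S \<times> S). (\<Prod>e\<in>U. ok e \<theta>) * (\<Prod>e\<in>U. A e x))"
    if x: "x \<in> spins V" and \<theta>: "\<theta> \<in> spins V" for x \<theta>
  proof -
    have "energy V J (\<lambda>_. 0) x + energy V (mask2 S J) (\<lambda>_. 0) (twist V x \<theta>)
      = energy V JR (\<lambda>_. 0) x + (\<Sum>i\<in>V. \<Sum>j\<in>V. mask2 S (\<lambda>i j. J i j * (1 + \<theta> i * \<theta> j) * (x i * x j)) i j)"
      unfolding energy_def sum.distrib[symmetric]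
      by (simp add: sum.distrib[symmetric]) (intro sum.cong refl, auto simp: twist_def mask2_def JR_def algebra_simps)
    also have "(\<Sum>i\<in>V. \<Sum>j\<in>V. mask2 S (\<lambda>i j. J i j * (1 + \<theta> i * \<theta> j) * (x i * x j)) i j)
      = (\<Sum>i\<in>S. \<Sum>j\<in>S. J i j * (1 + \<theta> i * \<theta> j) * (x i * x j))"
    proof -
      have r: "(\<Sum>i\<in>V. g i) = (\<Sum>i\<in>S. g i)" if "\<And>i. i \<notin> S \<Longrightarrow> g i = 0" for g :: "'v \<Rightarrow> real"
        by (rule sum.mono_neutral_right) (use V S that in auto)
      define g where "g i j = J i j * (1 + \<theta> i * \<theta> j) * (x i * x j)" for i j
      have "(\<Sum>i\<in>V. \<Sum>j\<in>V. mask2 S g i j) = (\<Sum>i\<in>S. \<Sum>j\<in>V. mask2 S g i j)"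
        by (rule r) (simp add: mask2_def)
      also have "\<dots> = (\<Sum>i\<in>S. \<Sum>j\<in>S. mask2 S g i j)"
        by (intro sum.cong refl r) (simp add: mask2_def)
      also have "\<dots> = (\<Sum>i\<in>S. \<Sum>j\<in>S. g i j)"
        by (simp add: mask2_def)
      finally show ?thesis by (simp add: g_def[abs_def])
    qed
    also have "\<dots> = (\<Sum>e\<in>S \<times> S. J (fst e) (snd e) * (1 + \<theta> (fst e) * \<theta> (snd e)) * (x (fst e) * x (snd e)))"
      by (simp add: sum.cartesian_product case_prod_unfold)
    finally have "exp (energy V J (\<lambda>_. 0) x) * exp (energy V (mask2 S J) (\<lambda>_. 0) (twist V x \<theta>))
      = R x * (\<Prod>e\<in>S \<times> S. exp (J (fst e) (snd e) * (1 + \<theta> (fst e) * \<theta> (snd e)) * (x (fst e) * x (snd e))))"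
      unfolding exp_add[symmetric] R_def using finP by (simp add: exp_add exp_sum)
    also have "(\<Prod>e\<in>S \<times> S. exp (J (fst e) (snd e) * (1 + \<theta> (fst e) * \<theta> (snd e)) * (x (fst e) * x (snd e))))
       = (\<Prod>e\<in>S \<times> S. ok e \<theta> * A e x + 1)"
    proof (intro prod.cong refl)
      fix e assume "e \<in> S \<times> S"
      then have e: "fst e \<in> V" "snd e \<in> V" using S by auto
      show "exp (J (fst e) (snd e) * (1 + \<theta> (fst e) * \<theta> (snd e)) * (x (fst e) * x (snd e))) = ok e \<theta> * A e x + 1"
        by (rule spins_cases[OF \<theta> e(1)]; rule spins_cases[OF \<theta> e(2)]) (auto simp: ok_def A_def algebra_simps)
    qed
    also have "\<dots> = (\<Sum>U\<in>Pow (S \<times> S). (\<Prod>e\<in>U. ok e \<theta>) * (\<Prod>e\<in>U. A e x))"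
      by (subst prod_add[OF finP]) (simp add: prod.distrib)
    finally show ?thesis .
  qed
  have main: "0 \<le> (\<Sum>x\<in>spins V. \<Sum>\<theta>\<in>spins V. tm U x \<theta>)"
    if U: "U \<subseteq> S \<times> S" for U
  proof -
    define H where "H = {\<theta>\<in>spins V. \<forall>e\<in>U. \<theta> (fst e) = \<theta> (snd e)}"
    have UV: "fst e \<in> V" "snd e \<in> V" if "e \<in> U" for e
      using subsetD[OF U that] subsetD[OF S] by (auto simp: mem_Times_iff)
    have finO: "finite U" using U finP finite_subset by blast
    have finH: "finite H" unfolding H_def using finite_spins[OF V] by simp
    have ok: "(\<Prod>e\<in>U. ok e \<theta>) = (if \<theta> \<in> H then 1 else 0)" if "\<theta> \<in> spins V" for \<theta>
      using that finO by (auto simp: H_def ok_def intro!: prod.neutral)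
    \<comment> \<open>The cluster is read off from H: the sites of S whose relative sign the
      constraints in U force to agree with that of p.\<close>
    define K where "K = {y\<in>S. \<forall>\<theta>\<in>H. \<theta> y = \<theta> p}"
    have KS: "K \<subseteq> S" and pK: "p \<in> K" using p by (auto simp: K_def)
    have OK: "fst e \<in> K \<longleftrightarrow> snd e \<in> K" if "e \<in> U" for e
    proof -
      have "\<theta> (fst e) = \<theta> (snd e)" if "\<theta> \<in> H" for \<theta> using that \<open>e \<in> U\<close> by (auto simp: H_def)
      moreover have "fst e \<in> S" "snd e \<in> S" using that U by auto
      ultimately show ?thesis unfolding K_def mem_Collect_eq by metis
    qed
    have sumH: "(\<Sum>\<theta>\<in>H. \<theta> p * \<theta> y) = (if y \<in> K then real (card H) else 0)" if y: "y \<in> S" for y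
    proof (cases "y \<in> K")
      case True
      have "\<theta> p * \<theta> y = 1" if "\<theta> \<in> H" for \<theta>
        using True that spins_sq[of \<theta> V p] pV by (auto simp: K_def H_def)
      then show ?thesis using True by simp
    next
      case False
      then obtain \<eta> where \<eta>: "\<eta> \<in> H" "\<eta> y \<noteq> \<eta> p" using y by (auto simp: K_def)
      have \<eta>V: "\<eta> \<in> spins V" using \<eta> by (simp add: H_def)
      have yV: "y \<in> V" using y S by auto
      have m: "\<eta> p * \<eta> y = -1"
        by (rule spins_cases[OF \<eta>V pV]; rule spins_cases[OF \<eta>V yV]) (use \<eta>(2) in auto)
      \<comment> \<open>H is closed under multiplication, so twisting by an element that separates y
        from p permutes H and reverses the sign of the sum.\<close>
      have tw: "twist V \<eta> \<theta> \<in> H" if "\<theta> \<in> H" for \<theta>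
      proof -
        have "\<theta> \<in> spins V" using that by (simp add: H_def)
        then show ?thesis
          using UV that \<eta>(1) twist_spins[OF \<eta>V] by (auto simp: H_def twist_def)
      qed
      have "(\<Sum>\<theta>\<in>H. \<theta> p * \<theta> y) = (\<Sum>\<theta>\<in>H. twist V \<eta> \<theta> p * twist V \<eta> \<theta> y)"
        by (rule sum.reindex_bij_witness[of _ "twist V \<eta>" "twist V \<eta>"])
           (use tw twist_twist[OF \<eta>V] in \<open>auto simp: H_def\<close>)
      also have "\<dots> = (\<Sum>\<theta>\<in>H. (\<eta> p * \<eta> y) * (\<theta> p * \<theta> y))"
        using pV yV by (simp add: twist_def mult_ac)
      also have "\<dots> = - (\<Sum>\<theta>\<in>H. \<theta> p * \<theta> y)" by (simp add: m sum_negf)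
      finally show ?thesis using False by simp
    qed
    define EK where "EK x = (\<Sum>e\<in>K \<times> (V - S). c (fst e) (snd e) * (x (fst e) * x (snd e)))" for x :: "'v \<Rightarrow> real"
    define JR' where "JR' i j = (if i \<in> K \<or> j \<in> K then 0 else JR i j)" for i j
    define R' where "R' x = exp (energy V JR' (\<lambda>_. 0) x)" for x
    have EK_alt: "EK x = (\<Sum>y\<in>K. \<Sum>w\<in>V - S. c y w * (x y * x w))" for x
      by (simp add: EK_def sum.cartesian_product case_prod_unfold)
    have R: "R x = exp (EK x) * R' x" for x
    proof -
      have 1: "JR i j = JR' i j + (of_bool (i \<in> K \<and> j \<in> V - S) * J i j + of_bool (j \<in> K \<and> i \<in> V - S) * J i j)"
        if "i \<in> V" "j \<in> V" for i j
        using that KS by (auto simp: JR'_def JR_def)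
      have ind: "(\<Sum>i\<in>V. \<Sum>j\<in>V. of_bool (i \<in> K \<and> j \<in> V - S) * g i j) = (\<Sum>i\<in>K. \<Sum>j\<in>V - S. g i j)"
        for g :: "'v \<Rightarrow> 'v \<Rightarrow> real"
      proof -
        have "(\<Sum>i\<in>V. \<Sum>j\<in>V. of_bool (i \<in> K \<and> j \<in> V - S) * g i j)
            = (\<Sum>i\<in>V. of_bool (i \<in> K) * (\<Sum>j\<in>V. of_bool (j \<in> V - S) * g i j))"
          by (intro sum.cong refl) (auto simp: sum_distrib_left)
        also have "\<dots> = (\<Sum>i\<in>K. (\<Sum>j\<in>V. of_bool (j \<in> V - S) * g i j))"
          by (rule sum.mono_neutral_cong_right) (use V KS S in auto)
        also have "\<dots> = (\<Sum>i\<in>K. \<Sum>j\<in>V - S. g i j)"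
          by (intro sum.cong refl sum.mono_neutral_cong_right) (use V in auto)
        finally show ?thesis .
      qed
      have "energy V JR (\<lambda>_. 0) x = (\<Sum>i\<in>V. \<Sum>j\<in>V. JR' i j * (x i * x j) +
         (of_bool (i \<in> K \<and> j \<in> V - S) * (J i j * (x i * x j)) + of_bool (j \<in> K \<and> i \<in> V - S) * (J i j * (x i * x j))))"
        unfolding energy_def by (simp add: 1 algebra_simps cong: sum.cong)
      also have "\<dots> = energy V JR' (\<lambda>_. 0) x + ((\<Sum>i\<in>V. \<Sum>j\<in>V. of_bool (i \<in> K \<and> j \<in> V - S) * (J i j * (x i * x j)))
          + (\<Sum>i\<in>V. \<Sum>j\<in>V. of_bool (j \<in> K \<and> i \<in> V - S) * (J i j * (x i * x j))))"
        unfolding energy_def by (simp add: sum.distrib)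
      also have "(\<Sum>i\<in>V. \<Sum>j\<in>V. of_bool (j \<in> K \<and> i \<in> V - S) * (J i j * (x i * x j)))
          = (\<Sum>i\<in>K. \<Sum>j\<in>V - S. J j i * (x j * x i))"
        by (subst sum.swap) (rule ind)
      also have "(\<Sum>i\<in>V. \<Sum>j\<in>V. of_bool (i \<in> K \<and> j \<in> V - S) * (J i j * (x i * x j)))
          = (\<Sum>i\<in>K. \<Sum>j\<in>V - S. J i j * (x i * x j))" by (rule ind)
      also have "(\<Sum>i\<in>K. \<Sum>j\<in>V - S. J i j * (x i * x j)) + (\<Sum>i\<in>K. \<Sum>j\<in>V - S. J j i * (x j * x i)) = EK x"
        unfolding EK_alt sum.distrib[symmetric] c_def by (intro sum.cong refl) (simp add: algebra_simps)
      finally show ?thesis by (simp add: R_def R'_def exp_add)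
    qed
    define B where "B x = (\<Prod>e\<in>U. A e x) * R' x * (x p * x z)" for x
    have fA: "ferro V (\<lambda>x. \<Prod>e\<in>U. A e x)"
    proof (rule ferro_prod[OF V])
      fix e assume e: "e \<in> U"
      show "ferro V (A e)"
        unfolding A_def[abs_def] using J UV[OF e] by (intro ferro_exp_pair_minus_one V) auto
    qed
    have fB: "ferro V B"
      unfolding B_def[abs_def] R'_def using J pV zV
      by (intro ferro_mult fA V ferro_exp_energy ferro_pair) (auto simp: JR'_def JR_def)
    \<comment> \<open>With the boundary bonds of K taken out, flipping K preserves the weight and
      reverses \<open>x p * x z\<close>, as z lies outside S.\<close>
    have odd: "(\<Sum>x\<in>spins V. B x) = 0"
    proof -
      have "B (flip V K x) = - B x" if "x \<in> spins V" for x
      proof -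
        have "A e (flip V K x) = A e x" if "e \<in> U" for e
          using OK[OF that] UV[OF that] by (auto simp: A_def flip_def)
        moreover have "R' (flip V K x) = R' x"
          unfolding R'_def energy_def
          by (simp, intro sum.cong refl) (auto simp: JR'_def flip_def)
        moreover have "flip V K x p * flip V K x z = - (x p * x z)"
          using pK pV z KS by (auto simp: flip_def)
        ultimately show ?thesis by (simp add: B_def)
      qed
      then have "(\<Sum>x\<in>spins V. B x) = - (\<Sum>x\<in>spins V. B x)"
        using sum_flip[of B V K] by (simp add: sum_negf)
      then show ?thesis by simp
    qed
    \<comment> \<open>The \<open>+ 1\<close> of the tangent inequality contributes nothing, by the
      antisymmetry just shown.\<close>
    have "ferro V (\<lambda>x. B x * ((EK x - 1) * exp (EK x) + 1))"
      unfolding EK_def using c KS S by (intro ferro_mult V fB ferro_exp_tangent) auto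
    then have "0 \<le> (\<Sum>x\<in>spins V. B x * ((EK x - 1) * exp (EK x) + 1))" by (rule ferro_sum_nonneg[OF V])
    then have pos: "0 \<le> (\<Sum>x\<in>spins V. B x * exp (EK x) * (EK x - 1))"
      using odd by (simp add: distrib_left sum.distrib mult_ac)
    have "(\<Sum>x\<in>spins V. \<Sum>\<theta>\<in>spins V. tm U x \<theta>)
      = (\<Sum>x\<in>spins V. (B x * exp (EK x)) * (\<Sum>\<theta>\<in>H. br \<theta> x))"
    proof (intro sum.cong refl)
      fix x
      have "(\<Sum>\<theta>\<in>spins V. tm U x \<theta>)
         = (\<Sum>\<theta>\<in>H. (\<Prod>e\<in>U. A e x) * R x * (x p * x z) * br \<theta> x)"
        unfolding tm_def
        by (rule sum.mono_neutral_cong_right) (use finite_spins[OF V] ok in \<open>auto simp: H_def\<close>)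
      also have "\<dots> = (B x * exp (EK x)) * (\<Sum>\<theta>\<in>H. br \<theta> x)"
        unfolding B_def R sum_distrib_left by (intro sum.cong refl) (simp only: mult_ac)
      finally show "(\<Sum>\<theta>\<in>spins V. tm U x \<theta>)
        = (B x * exp (EK x)) * (\<Sum>\<theta>\<in>H. br \<theta> x)" .
    qed
    also have "\<dots> = (\<Sum>x\<in>spins V. (B x * exp (EK x)) * (real (card H) * (EK x - 1)))"
    proof (intro sum.cong refl arg_cong2[where f = "(*)"])
      fix x
      have "(\<Sum>\<theta>\<in>H. br \<theta> x) = (\<Sum>\<theta>\<in>H. \<Sum>y\<in>S. \<Sum>w\<in>V - S. c y w * (\<theta> p * \<theta> y) * (x y * x w)) - real (card H)"
        by (simp add: br_def sum_subtractf)
      also have "(\<Sum>\<theta>\<in>H. \<Sum>y\<in>S. \<Sum>w\<in>V - S. c y w * (\<theta> p * \<theta> y) * (x y * x w))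
         = (\<Sum>y\<in>S. \<Sum>\<theta>\<in>H. (\<theta> p * \<theta> y) * (\<Sum>w\<in>V - S. c y w * (x y * x w)))"
        by (subst sum.swap) (simp add: sum_distrib_left mult_ac)
      also have "\<dots> = (\<Sum>y\<in>S. (if y \<in> K then real (card H) else 0) * (\<Sum>w\<in>V - S. c y w * (x y * x w)))"
        by (simp add: sum_distrib_right[symmetric] sumH cong: sum.cong)
      also have "\<dots> = (\<Sum>y\<in>K. real (card H) * (\<Sum>w\<in>V - S. c y w * (x y * x w)))"
        by (rule sum.mono_neutral_cong_right) (use finS KS in auto)
      also have "\<dots> = real (card H) * EK x"
        by (simp add: EK_alt sum_distrib_left)
      finally show "(\<Sum>\<theta>\<in>H. br \<theta> x) = real (card H) * (EK x - 1)" by (simp add: algebra_simps)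
    qed
    also have "\<dots> = real (card H) * (\<Sum>x\<in>spins V. B x * exp (EK x) * (EK x - 1))"
      by (simp add: sum_distrib_left mult_ac)
    also have "\<dots> \<ge> 0" using pos by simp
    finally show ?thesis .
  qed
  define WS where "WS y = wsum V (mask2 S J) (\<lambda>_. 0) (\<lambda>x. x p * x y)" for y
  define ZS where "ZS = zsum V (mask2 S J) (\<lambda>_. 0)"
  have ZS: "0 < ZS" unfolding ZS_def by (rule zsum_pos[OF V])
  have WS: "WS y / ZS = mean S J (\<lambda>_. 0) (\<lambda>x. x p * x y)" if "y \<in> S" for y
    using mean_mask[OF V S, of "\<lambda>x. x p * x y" J "\<lambda>_. 0"] p that
    by (simp add: WS_def ZS_def mean_def mask1_zero)
  define T where "T g = (\<Sum>x\<in>spins V. \<Sum>y\<in>spins V. g x y *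
     (exp (energy V J (\<lambda>_. 0) x) * exp (energy V (mask2 S J) (\<lambda>_. 0) y)))" for g :: "('v \<Rightarrow> real) \<Rightarrow> ('v \<Rightarrow> real) \<Rightarrow> real"
  have T: "T (\<lambda>x y. f x * g y) = wsum V J (\<lambda>_. 0) f * wsum V (mask2 S J) (\<lambda>_. 0) g" for f g
    unfolding T_def wsum_def sum_product by (intro sum.cong refl) (simp only: mult_ac)
  have "0 \<le> (\<Sum>U\<in>Pow (S \<times> S). \<Sum>x\<in>spins V. \<Sum>\<theta>\<in>spins V. tm U x \<theta>)"
    by (rule sum_nonneg) (use main in auto)
  also have "\<dots> = (\<Sum>x\<in>spins V. \<Sum>\<theta>\<in>spins V. (x p * x z) * br \<theta> x *
      (R x * (\<Sum>U\<in>Pow (S \<times> S). (\<Prod>e\<in>U. ok e \<theta>) * (\<Prod>e\<in>U. A e x))))"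
    unfolding sum_distrib_left tm_def
    by (subst sum.swap, intro sum.cong refl, subst sum.swap, intro sum.cong refl) (simp only: mult_ac)
  also have "\<dots> = (\<Sum>x\<in>spins V. \<Sum>\<theta>\<in>spins V. (x p * x z) * br \<theta> x *
      (exp (energy V J (\<lambda>_. 0) x) * exp (energy V (mask2 S J) (\<lambda>_. 0) (twist V x \<theta>))))"
    by (intro sum.cong refl) (simp only: weights)
  also have "\<dots> = (\<Sum>x\<in>spins V. \<Sum>\<theta>\<in>spins V.
      ((\<Sum>y\<in>S. \<Sum>w\<in>V - S. c y w * ((x w * x z) * (twist V x \<theta> p * twist V x \<theta> y))) - x p * x z) *
      (exp (energy V J (\<lambda>_. 0) x) * exp (energy V (mask2 S J) (\<lambda>_. 0) (twist V x \<theta>))))"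
  proof (intro sum.cong refl arg_cong2[where f = "(*)"])
    fix x \<theta> assume x: "x \<in> spins V" and \<theta>: "\<theta> \<in> spins V"
    have e: "(x p * x z) * (c y w * (\<theta> p * \<theta> y) * (x y * x w)) = c y w * ((x w * x z) * (twist V x \<theta> p * twist V x \<theta> y))"
      if "y \<in> S" for y w
      using that pV S by (auto simp: twist_def mult_ac)
    show "(x p * x z) * br \<theta> x = (\<Sum>y\<in>S. \<Sum>w\<in>V - S. c y w * ((x w * x z) * (twist V x \<theta> p * twist V x \<theta> y))) - x p * x z"
      unfolding br_def right_diff_distrib sum_distrib_left mult_1_right
      by (intro arg_cong2[where f = "(-)"] sum.cong refl e)
  qed
  also have "\<dots> = T (\<lambda>x y'. (\<Sum>y\<in>S. \<Sum>w\<in>V - S. c y w * ((x w * x z) * (y' p * y' y))) - x p * x z)"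
    unfolding T_def by (rule sum.cong[OF refl], rule sum_twist[symmetric])
  also have "\<dots> = (\<Sum>y\<in>S. \<Sum>w\<in>V - S. c y w * T (\<lambda>x y'. (x w * x z) * (y' p * y' y))) - T (\<lambda>x y'. (x p * x z) * 1)"
  proof -
    have d: "T (\<lambda>x y. g x y - g' x y) = T g - T g'" for g g'
      by (simp add: T_def sum_subtractf left_diff_distrib)
    have s: "T (\<lambda>x y. \<Sum>k\<in>I. g k x y) = (\<Sum>k\<in>I. T (g k))" for I :: "'v set" and g
    proof -
      have "T (\<lambda>x y. \<Sum>k\<in>I. g k x y) = (\<Sum>x\<in>spins V. \<Sum>k\<in>I. \<Sum>y\<in>spins V. g k x y *
         (exp (energy V J (\<lambda>_. 0) x) * exp (energy V (mask2 S J) (\<lambda>_. 0) y)))"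
        unfolding T_def sum_distrib_right by (intro sum.cong refl sum.swap)
      then show ?thesis unfolding T_def by (simp add: sum.swap[of _ I])
    qed
    have m: "T (\<lambda>x y. a * g x y) = a * T g" for a g
      by (simp add: T_def sum_distrib_left mult.assoc)
    show ?thesis by (simp add: d s m)
  qed
  also have "\<dots> = (\<Sum>y\<in>S. \<Sum>w\<in>V - S. c y w * (wsum V J (\<lambda>_. 0) (\<lambda>x. x w * x z) * WS y)) - wsum V J (\<lambda>_. 0) (\<lambda>x. x p * x z) * ZS"
    unfolding T WS_def ZS_def ..
  finally have "wsum V J (\<lambda>_. 0) (\<lambda>x. x p * x z) * ZS \<le> (\<Sum>y\<in>S. \<Sum>w\<in>V - S. c y w * (wsum V J (\<lambda>_. 0) (\<lambda>x. x w * x z) * WS y))"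
    by simp
  then have "wsum V J (\<lambda>_. 0) (\<lambda>x. x p * x z) * ZS / (ZS * zsum V J (\<lambda>_. 0))
      \<le> (\<Sum>y\<in>S. \<Sum>w\<in>V - S. c y w * (wsum V J (\<lambda>_. 0) (\<lambda>x. x w * x z) * WS y)) / (ZS * zsum V J (\<lambda>_. 0))"
    using ZS zsum_pos[OF V, of J "\<lambda>_. 0"] by (intro divide_right_mono) auto
  also have "\<dots> = (\<Sum>y\<in>S. \<Sum>w\<in>V - S. c y w * (WS y / ZS) * mean V J (\<lambda>_. 0) (\<lambda>x. x w * x z))"
    unfolding sum_divide_distrib mean_def by (intro sum.cong refl) (simp add: mult_ac)
  finally show ?thesis
    using ZS by (simp add: WS mean_def c_def cong: sum.cong)
qed

section \<open>The lattice model\<close>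

lemma mean_add: "mean V J h (\<lambda>x. f x + g x) = mean V J h f + mean V J h g"
  by (simp add: mean_def wsum_add add_divide_distrib)

lemma mean_scale: "mean V J h (\<lambda>x. a * f x) = a * mean V J h f"
  by (simp add: mean_def wsum_scale)

lemma mean_sum: "mean V J h (\<lambda>x. \<Sum>k\<in>I. f k x) = (\<Sum>k\<in>I. mean V J h (f k))"
  by (simp add: mean_def wsum_sum sum_divide_distrib)

lemma mean_const: "finite V \<Longrightarrow> mean V J h (\<lambda>_. a) = a"
  using wsum_scale[of V J h a "\<lambda>_. 1"] zsum_pos[of V J h] by (simp add: mean_def)

lemma mean_le:
  assumes "finite V" "\<And>x. x \<in> spins V \<Longrightarrow> f x \<le> g x"
  shows "mean V J h f \<le> mean V J h g"
  unfolding mean_def wsum_def using assms zsum_pos[OF assms(1), of J h]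
  by (intro divide_right_mono sum_mono mult_right_mono) (auto simp: wsum_def)

lemma mean_nonneg:
  assumes "finite V" "\<And>i j. i \<in> V \<Longrightarrow> j \<in> V \<Longrightarrow> 0 \<le> J i j" "\<And>i. i \<in> V \<Longrightarrow> 0 \<le> h i" "ferro V f"
  shows "0 \<le> mean V J h f"
  unfolding mean_def using wsum_nonneg[OF assms] zsum_pos[OF assms(1), of J h] by simp

lemma mean_spin_le_one:
  assumes "finite V" "i \<in> V" shows "mean V J h (\<lambda>x. x i) \<le> 1"
proof -
  have "mean V J h (\<lambda>x. x i) \<le> mean V J h (\<lambda>x. 1)"
    using spins_cases[OF _ assms(2)] by (intro mean_le assms) force
  then show ?thesis by (simp add: mean_const assms)
qed

lemma mean_pair_le_one:
  assumes "finite V" "i \<in> V" "j \<in> V" shows "mean V J h (\<lambda>x. x i * x j) \<le> 1"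
proof -
  have "x i * x j \<le> 1" if "x \<in> spins V" for x
    by (rule spins_cases[OF that assms(2)]; rule spins_cases[OF that assms(3)]) auto
  then have "mean V J h (\<lambda>x. x i * x j) \<le> mean V J h (\<lambda>x. 1)"
    by (intro mean_le assms)
  then show ?thesis by (simp add: mean_const assms)
qed

text \<open>Jensen's inequality, from the tangent line of exp at the mean.\<close>

lemma exp_mean_le:
  assumes "finite V"
  shows "exp (mean V J h f) \<le> mean V J h (\<lambda>x. exp (f x))"
proof -
  define m where "m = mean V J h f"
  have "exp m * 1 = mean V J h (\<lambda>x. exp m * (1 - m) + exp m * f x)"
    unfolding mean_add mean_scale mean_const[OF assms] m_def[symmetric] by (simp add: algebra_simps)
  also have "\<dots> \<le> mean V J h (\<lambda>x. exp (f x))"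
  proof (rule mean_le[OF assms])
    fix x
    have "exp m * (1 + (f x - m)) \<le> exp m * exp (f x - m)"
      by (intro mult_left_mono exp_ge_add_one_self) simp
    then show "exp m * (1 - m) + exp m * f x \<le> exp (f x)"
      by (simp add: exp_diff algebra_simps)
  qed
  finally show ?thesis by (simp add: m_def)
qed

lemma wsum_reindex:
  assumes g: "bij_betw g S T"
    and J: "\<And>i j. i \<in> S \<Longrightarrow> j \<in> S \<Longrightarrow> J' (g i) (g j) = J i j" and h: "\<And>i. i \<in> S \<Longrightarrow> h' (g i) = h i"
    and f: "\<And>x. x \<in> spins T \<Longrightarrow> f' x = f (\<lambda>i\<in>S. x (g i))"
  shows "wsum T J' h' f' = wsum S J h f"
proof -
  define G where "G x = (\<lambda>i\<in>S. x (g i))" for x :: "'b \<Rightarrow> real"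
  define H where "H y = (\<lambda>j\<in>T. y (inv_into S g j))" for y :: "'a \<Rightarrow> real"
  have inj: "inj_on g S" and img: "g ` S = T" using g by (auto simp: bij_betw_def)
  have gi: "g i \<in> T" "inv_into S g (g i) = i" if "i \<in> S" for i using inj img that by auto
  have ig: "inv_into S g j \<in> S" "g (inv_into S g j) = j" if "j \<in> T" for j
    using img that by (auto simp: inv_into_into f_inv_into_f)
  have e: "energy S J h (G x) = energy T J' h' x" for x
  proof -
    have r: "(\<Sum>i\<in>S. u (g i)) = (\<Sum>j\<in>T. u j)" for u :: "'b \<Rightarrow> real"
      by (rule sum.reindex_bij_betw[OF g])
    show ?thesis
      unfolding energy_def r[symmetric] by (simp add: G_def J h cong: sum.cong)
  qed
  have "wsum T J' h' f' = (\<Sum>x\<in>spins T. f (G x) * exp (energy S J h (G x)))"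
    unfolding wsum_def e by (intro sum.cong refl) (simp add: f G_def)
  also have "\<dots> = wsum S J h f"
    unfolding wsum_def
  proof (rule sum.reindex_bij_witness[of _ H G])
    fix x assume x: "x \<in> spins T"
    show "H (G x) = x" using x ig by (auto simp: H_def G_def fun_eq_iff spins_def PiE_def extensional_def)
    show "G x \<in> spins S" using x gi by (auto simp: G_def spins_def PiE_def Pi_def)
  next
    fix y assume y: "y \<in> spins S"
    show "G (H y) = y" using y gi by (auto simp: H_def G_def fun_eq_iff spins_def PiE_def extensional_def)
    show "H y \<in> spins T" using y ig by (auto simp: H_def spins_def PiE_def Pi_def)
  qed simp
  finally show ?thesis .
qed

lemma mean_reindex:
  assumes "bij_betw g S T"
    and "\<And>i j. i \<in> S \<Longrightarrow> j \<in> S \<Longrightarrow> J' (g i) (g j) = J i j" and "\<And>i. i \<in> S \<Longrightarrow> h' (g i) = h i"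
    and "\<And>x. x \<in> spins T \<Longrightarrow> f' x = f (\<lambda>i\<in>S. x (g i))"
  shows "mean T J' h' f' = mean S J h f"
  unfolding mean_def using wsum_reindex[of g S T J' J h' h f' f, OF assms]
    wsum_reindex[of g S T J' J h' h "\<lambda>_. 1" "\<lambda>_. 1", OF assms(1-3) refl] by simp

abbreviation corr :: "'v set \<Rightarrow> ('v \<Rightarrow> 'v \<Rightarrow> real) \<Rightarrow> 'v \<Rightarrow> 'v \<Rightarrow> real" where
  "corr V J i j \<equiv> mean V J (\<lambda>_. 0) (\<lambda>x. x i * x j)"

text \<open>Couplings and field carry the same factor b, because the field exerted by a plus
  boundary scales with the inverse temperature as the couplings do. The derivative is then the
  covariance with the full energy.\<close>

lemma mean_has_derivative:
  assumes V: "finite V"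
  shows "((\<lambda>b. mean V (\<lambda>i j. b * J i j) (\<lambda>i. b * h i) f) has_real_derivative
     (mean V (\<lambda>i j. b * J i j) (\<lambda>i. b * h i) (\<lambda>x. f x * energy V J h x)
       - mean V (\<lambda>i j. b * J i j) (\<lambda>i. b * h i) f * mean V (\<lambda>i j. b * J i j) (\<lambda>i. b * h i) (energy V J h))) (at b)"
proof -
  have e: "energy V (\<lambda>i j. b * J i j) (\<lambda>i. b * h i) x = b * energy V J h x" for b x
    by (simp add: energy_def sum_distrib_left algebra_simps)
  have d: "((\<lambda>b. wsum V (\<lambda>i j. b * J i j) (\<lambda>i. b * h i) f) has_real_derivative
     wsum V (\<lambda>i j. b * J i j) (\<lambda>i. b * h i) (\<lambda>x. f x * energy V J h x)) (at b)" for f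
    unfolding wsum_def e by (auto intro!: derivative_eq_intros sum.cong simp: mult_ac)
  have z: "zsum V (\<lambda>i j. b * J i j) (\<lambda>i. b * h i) \<noteq> 0" using zsum_pos[OF V] by (metis less_irrefl)
  show ?thesis
    unfolding mean_def
    by (rule DERIV_cong[OF DERIV_divide[OF d d z]]) (use z in \<open>simp add: field_simps\<close>)
qed

section \<open>Cubes, neighbourhoods and translations of the lattice\<close>

definition points :: "nat \<Rightarrow> (nat \<Rightarrow> int) set" where
  "points d = ({..<d} \<rightarrow>\<^sub>E UNIV)"

definition cube :: "nat \<Rightarrow> nat \<Rightarrow> (nat \<Rightarrow> int) set" where
  "cube d r = ({..<d} \<rightarrow>\<^sub>E {- int r..int r})"

lemma finite_cube: "finite (cube d r)"
  unfolding cube_def by (intro finite_PiE) auto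

lemma cube_points: "cube d r \<subseteq> points d"
  by (auto simp: cube_def points_def PiE_def)

lemma card_cube: "card (cube d r) = (2 * r + 1) ^ d"
proof -
  have "card {- int r..int r} = 2 * r + 1" by simp
  then show ?thesis
    unfolding cube_def using card_PiE[of "{..<d}" "\<lambda>_. {- int r..int r}"] by simp
qed

lemma cube_mono: "r \<le> r' \<Longrightarrow> cube d r \<subseteq> cube d r'"
  unfolding cube_def by (intro PiE_mono) auto

lemma box_eq_cube:
  assumes "1 \<le> d"
  shows "box d n = cube d (nat \<lfloor>root d (real n)\<rfloor>)"
proof -
  define R where "R = root d (real n)"
  have R: "0 \<le> \<lfloor>R\<rfloor>" using assms by (simp add: R_def)
  have "\<bar>real_of_int k\<bar> \<le> R \<longleftrightarrow> k \<in> {- int (nat \<lfloor>R\<rfloor>)..int (nat \<lfloor>R\<rfloor>)}" for k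
  proof -
    have "\<bar>real_of_int k\<bar> \<le> R \<longleftrightarrow> \<bar>k\<bar> \<le> \<lfloor>R\<rfloor>" by (simp add: le_floor_iff)
    also have "\<dots> \<longleftrightarrow> k \<in> {- int (nat \<lfloor>R\<rfloor>)..int (nat \<lfloor>R\<rfloor>)}"
      unfolding int_nat_eq if_P[OF R] atLeastAtMost_iff by linarith
    finally show ?thesis .
  qed
  then have "{k. \<bar>real_of_int k\<bar> \<le> R} = {- int (nat \<lfloor>R\<rfloor>)..int (nat \<lfloor>R\<rfloor>)}"
    by blast
  then have "{k. \<bar>real_of_int k\<bar> \<le> root d (real n)} = {- int (nat \<lfloor>root d (real n)\<rfloor>)..int (nat \<lfloor>root d (real n)\<rfloor>)}"
    unfolding R_def .
  then show ?thesis by (simp add: box_def cube_def)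
qed

lemma l1_dist_commute: "l1_dist d x y = l1_dist d y x"
  unfolding l1_dist_def by (simp add: abs_minus_commute)

lemma coupling_commute: "coupling d L x y = coupling d L y x"
  unfolding coupling_def by (simp add: l1_dist_commute)

definition nbrs :: "nat \<Rightarrow> nat \<Rightarrow> (nat \<Rightarrow> int) \<Rightarrow> (nat \<Rightarrow> int) set" where
  "nbrs d L y = {x\<in>points d. 0 < l1_dist d y x \<and> l1_dist d y x \<le> int L}"

lemma coupling_eq: "x \<in> points d \<Longrightarrow> coupling d L y x = of_bool (x \<in> nbrs d L y)"
  by (simp add: coupling_def nbrs_def)

lemma nbrs_coord:
  assumes "x \<in> nbrs d L y" "k < d"
  shows "\<bar>x k - y k\<bar> \<le> int L"
proof -
  have "\<bar>y k - x k\<bar> \<le> (\<Sum>k<d. \<bar>y k - x k\<bar>)"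
    using assms(2) by (intro member_le_sum) auto
  then show ?thesis using assms(1) by (simp add: nbrs_def l1_dist_def abs_minus_commute)
qed

lemma nbrs_subset: "nbrs d L y \<subseteq> (\<Pi>\<^sub>E k\<in>{..<d}. {y k - int L..y k + int L})"
proof
  fix x assume x: "x \<in> nbrs d L y"
  then have "x \<in> points d" by (simp add: nbrs_def)
  moreover have "x k \<in> {y k - int L..y k + int L}" if "k < d" for k
    using nbrs_coord[OF x that] by (simp add: abs_le_iff)
  ultimately show "x \<in> (\<Pi>\<^sub>E k\<in>{..<d}. {y k - int L..y k + int L})"
    by (simp add: points_def PiE_iff)
qed

lemma finite_nbrs: "finite (nbrs d L y)"
  by (rule finite_subset[OF nbrs_subset]) (auto intro: finite_PiE)

lemma card_nbrs_le: "card (nbrs d L y) \<le> (2 * L + 1) ^ d"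
proof -
  have "card (nbrs d L y) \<le> card (\<Pi>\<^sub>E k\<in>{..<d}. {y k - int L..y k + int L})"
    by (intro card_mono nbrs_subset finite_PiE) auto
  also have "\<dots> = (2 * L + 1) ^ d"
  proof -
    have "card {y k - int L..y k + int L} = 2 * L + 1" for k by simp
    then show ?thesis
      using card_PiE[of "{..<d}" "\<lambda>k. {y k - int L..y k + int L}"] by simp
  qed
  finally show ?thesis .
qed

definition outdeg :: "nat \<Rightarrow> nat \<Rightarrow> (nat \<Rightarrow> int) set \<Rightarrow> (nat \<Rightarrow> int) \<Rightarrow> real" where
  "outdeg d L S y = real (card (nbrs d L y - S))"

definition lat :: "nat \<Rightarrow> nat \<Rightarrow> real \<Rightarrow> (nat \<Rightarrow> int) \<Rightarrow> (nat \<Rightarrow> int) \<Rightarrow> real" where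
  "lat d L \<beta> i j = \<beta> / 2 * coupling d L i j"

lemma lat_nonneg: "0 \<le> \<beta> \<Longrightarrow> 0 \<le> lat d L \<beta> i j"
  by (simp add: lat_def coupling_def)

text \<open>Each bond is met in both orders, which turns the \<beta>/2 of the weight into the
  \<beta> of \<open>phi\<close>.\<close>

lemma sum_coupling:
  assumes "W \<subseteq> points d" "finite W"
  shows "(\<Sum>x\<in>W. lat d L \<beta> x y + lat d L \<beta> y x) = \<beta> * real (card (nbrs d L y \<inter> W))"
proof -
  have "(\<Sum>x\<in>W. lat d L \<beta> x y + lat d L \<beta> y x) = (\<Sum>x\<in>W. \<beta> * of_bool (x \<in> nbrs d L y))"
    using assms by (intro sum.cong refl) (auto simp: lat_def coupling_commute[of d L _ y] coupling_eq)
  also have "\<dots> = \<beta> * real (card (nbrs d L y \<inter> W))"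
    using assms by (simp add: sum_distrib_left[symmetric] Int_commute)
  finally show ?thesis .
qed

definition phi :: "nat \<Rightarrow> nat \<Rightarrow> real \<Rightarrow> (nat \<Rightarrow> int) \<Rightarrow> (nat \<Rightarrow> int) set \<Rightarrow> real" where
  "phi d L \<beta> p S = (\<Sum>y\<in>S. \<beta> * outdeg d L S y * corr S (lat d L \<beta>) p y)"

definition shift :: "nat \<Rightarrow> (nat \<Rightarrow> int) \<Rightarrow> (nat \<Rightarrow> int) \<Rightarrow> nat \<Rightarrow> int" where
  "shift d a p = (\<lambda>k\<in>{..<d}. p k + a k)"

lemma shift_points: "shift d a p \<in> points d"
  by (simp add: shift_def points_def)

lemma shift_inverse: "p \<in> points d \<Longrightarrow> shift d (\<lambda>k. - a k) (shift d a p) = p"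
  by (auto simp: shift_def points_def fun_eq_iff PiE_def extensional_def)

lemma inj_on_shift: "inj_on (shift d a) (points d)"
  by (rule inj_on_inverseI[of _ "shift d (\<lambda>k. - a k)"]) (rule shift_inverse)

lemma l1_dist_shift: "l1_dist d (shift d a x) (shift d a y) = l1_dist d x y"
  by (simp add: l1_dist_def shift_def)

lemma coupling_shift: "coupling d L (shift d a x) (shift d a y) = coupling d L x y"
  by (simp add: coupling_def l1_dist_shift)

lemma shift_surj: "x \<in> points d \<Longrightarrow> x \<in> shift d a ` points d"
  using shift_inverse[of x d "\<lambda>k. - a k"] shift_points[of d "\<lambda>k. - a k" x] by force

lemma nbrs_shift: "nbrs d L (shift d a y) = shift d a ` nbrs d L y"
proof
  show "nbrs d L (shift d a y) \<subseteq> shift d a ` nbrs d L y"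
    using shift_surj by (fastforce simp: nbrs_def l1_dist_shift)
qed (auto simp: nbrs_def l1_dist_shift shift_points)

lemma bij_shift: "S \<subseteq> points d \<Longrightarrow> bij_betw (shift d a) S (shift d a ` S)"
  by (metis inj_on_imp_bij_betw inj_on_shift inj_on_subset)

lemma outdeg_shift:
  assumes "S \<subseteq> points d" shows "outdeg d L (shift d a ` S) (shift d a y) = outdeg d L S y"
proof -
  have n: "nbrs d L y \<subseteq> points d" by (auto simp: nbrs_def)
  have "shift d a ` nbrs d L y - shift d a ` S = shift d a ` (nbrs d L y - S)"
    using inj_on_image_set_diff[OF inj_on_shift[of d a], of "nbrs d L y" S] n assms by auto
  moreover have "card (shift d a ` (nbrs d L y - S)) = card (nbrs d L y - S)"
    by (rule card_image) (use n in \<open>auto intro: inj_on_subset[OF inj_on_shift]\<close>)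
  ultimately show ?thesis by (simp add: outdeg_def nbrs_shift)
qed

lemma corr_shift:
  assumes "S \<subseteq> points d" "p \<in> S" "q \<in> S"
  shows "corr (shift d a ` S) (lat d L \<beta>) (shift d a p) (shift d a q) = corr S (lat d L \<beta>) p q"
  by (rule mean_reindex[OF bij_shift[OF assms(1)]]) (use assms in \<open>auto simp: lat_def coupling_shift\<close>)

lemma mean_spin_shift:
  assumes "S \<subseteq> points d" "p \<in> S"
  shows "mean (shift d a ` S) (lat d L \<beta>) (\<lambda>_. h) (\<lambda>x. x (shift d a p)) = mean S (lat d L \<beta>) (\<lambda>_. h) (\<lambda>x. x p)"
  by (rule mean_reindex[OF bij_shift[OF assms(1)]]) (use assms in \<open>auto simp: lat_def coupling_shift\<close>)

lemma phi_shift: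
  assumes "S \<subseteq> points d" "p \<in> S"
  shows "phi d L \<beta> (shift d a p) (shift d a ` S) = phi d L \<beta> p S"
proof -
  have "inj_on (shift d a) S" using inj_on_shift assms(1) inj_on_subset by blast
  then show ?thesis
    unfolding phi_def using assms
    by (simp add: sum.reindex outdeg_shift corr_shift)
qed

lemma corr_nonneg:
  assumes "finite V" "p \<in> V" "q \<in> V" "0 \<le> \<beta>"
  shows "0 \<le> corr V (lat d L \<beta>) p q"
  using assms by (intro mean_nonneg ferro_pair lat_nonneg) auto

lemma phi_mono:
  assumes "finite S" "p \<in> S" "0 \<le> \<beta>" "\<beta> \<le> \<beta>'"
  shows "phi d L \<beta> p S \<le> phi d L \<beta>' p S"
  unfolding phi_def
proof (intro sum_mono mult_mono)
  fix y assume "y \<in> S"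
  then show "corr S (lat d L \<beta>) p y \<le> corr S (lat d L \<beta>') p y"
    using assms by (intro mean_mono ferro_pair) (auto simp: lat_def coupling_def mult_right_mono)
  show "0 \<le> corr S (lat d L \<beta>) p y" using assms \<open>y \<in> S\<close> by (intro corr_nonneg)
qed (use assms in \<open>auto simp: outdeg_def\<close>)

text \<open>The field \<open>\<beta> * outdeg d L V\<close> represents the plus boundary condition on \<open>V\<close>. For it,
  \<open>\<beta> * (1 - m)\<close> decreases in \<open>\<beta>\<close>.\<close>

lemma plus_magnetization_ge:
  assumes V: "finite V" "V \<subseteq> points d" and p: "p \<in> V" and b: "0 < b0" "b0 \<le> b1"
    and phi: "\<And>S. S \<subseteq> V \<Longrightarrow> p \<in> S \<Longrightarrow> 1 \<le> phi d L b0 p S"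
  shows "1 - b0 / b1 \<le> mean V (lat d L b1) (\<lambda>y. b1 * outdeg d L V y) (\<lambda>x. x p)"
proof -
  define J where "J = lat d L 1"
  define k where "k = outdeg d L V"
  define m where "m b = mean V (\<lambda>i j. b * J i j) (\<lambda>i. b * k i) (\<lambda>x. x p)" for b
  define m' where "m' b = mean V (\<lambda>i j. b * J i j) (\<lambda>i. b * k i) (\<lambda>x. x p * energy V J k x)
       - m b * mean V (\<lambda>i j. b * J i j) (\<lambda>i. b * k i) (energy V J k)" for b
  have lat: "(\<lambda>i j. b * J i j) = lat d L b" for b
    by (simp add: J_def lat_def fun_eq_iff)
  have k: "0 \<le> k i" for i by (simp add: k_def outdeg_def)
  have J: "0 \<le> J i j" for i j by (simp add: J_def lat_nonneg)
  have d: "(m has_real_derivative m' b) (at b)" for b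
    unfolding m_def m'_def by (rule mean_has_derivative[OF V(1)])
  have ge: "1 - m b \<le> b * m' b" if "b0 \<le> b" for b
  proof -
    have b: "0 \<le> b" using that assms by simp
    have e: "energy V (\<lambda>i j. b * J i j) (\<lambda>i. b * k i) x = b * energy V J k x" for x
      by (simp add: energy_def sum_distrib_left algebra_simps)
    have "1 * (1 - m b) \<le> mean V (\<lambda>i j. b * J i j) (\<lambda>i. b * k i) (\<lambda>x. x p * energy V (\<lambda>i j. b * J i j) (\<lambda>i. b * k i) x)
       - m b * mean V (\<lambda>i j. b * J i j) (\<lambda>i. b * k i) (energy V (\<lambda>i j. b * J i j) (\<lambda>i. b * k i))"
      unfolding m_def
    proof (rule covariance_energy_ge)
      fix S assume S: "S \<subseteq> V" "p \<in> S"
      have finS: "finite S" using S V finite_subset by blast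
      have "1 \<le> phi d L b0 p S" by (rule phi[OF S])
      \<comment> \<open>By Griffiths the hypothesis at \<open>b0\<close> persists at every larger
        b.\<close>
      also have "\<dots> \<le> phi d L b p S" using finS S that assms by (intro phi_mono) auto
      also have "\<dots> = (\<Sum>y\<in>S. (b * k y + (\<Sum>x\<in>V - S. b * J x y + b * J y x)) * corr S (\<lambda>i j. b * J i j) p y)"
        unfolding phi_def
      proof (intro sum.cong refl arg_cong2[where f = "(*)"])
        fix y assume "y \<in> S"
        have "(\<Sum>x\<in>V - S. b * J x y + b * J y x) = (\<Sum>x\<in>V - S. lat d L b x y + lat d L b y x)"
          by (simp add: lat[symmetric])
        also have "\<dots> = b * real (card (nbrs d L y \<inter> (V - S)))"
          using V by (intro sum_coupling) auto
        finally have 1: "(\<Sum>x\<in>V - S. b * J x y + b * J y x) = b * real (card (nbrs d L y \<inter> (V - S)))" .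
        \<comment> \<open>A neighbour outside S is either outside V, where it feeds the boundary
          field, or in V - S.\<close>
        have "nbrs d L y - S = (nbrs d L y - V) \<union> (nbrs d L y \<inter> (V - S))" using S by auto
        then have "card (nbrs d L y - S) = card (nbrs d L y - V) + card (nbrs d L y \<inter> (V - S))"
          by (simp add: card_Un_disjoint finite_nbrs disjoint_iff)
        then show "b * outdeg d L S y = b * k y + (\<Sum>x\<in>V - S. b * J x y + b * J y x)"
          unfolding 1 by (simp add: outdeg_def k_def algebra_simps)
      qed (simp_all add: lat)
      finally show "1 \<le> (\<Sum>y\<in>S. (b * k y + (\<Sum>x\<in>V - S. b * J x y + b * J y x)) * corr S (\<lambda>i j. b * J i j) p y)" .
    qed (use V p b k J in auto)
    also have "\<dots> = b * m' b"
      unfolding e m'_def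
      using mean_scale[of V "\<lambda>i j. b * J i j" "\<lambda>i. b * k i" b "\<lambda>x. x p * energy V J k x"]
        mean_scale[of V "\<lambda>i j. b * J i j" "\<lambda>i. b * k i" b "energy V J k"]
      by (simp add: algebra_simps)
    finally show ?thesis by simp
  qed
  have "b1 * (1 - m b1) \<le> b0 * (1 - m b0)"
  proof (rule DERIV_nonpos_imp_nonincreasing[OF b(2), of "\<lambda>b. b * (1 - m b)"])
    fix x assume "b0 \<le> x" "x \<le> b1"
    then show "\<exists>y. ((\<lambda>b. b * (1 - m b)) has_real_derivative y) (at x) \<and> y \<le> 0"
      using ge[of x]
      by (intro exI[of _ "(1 - m x) - x * m' x"] conjI)
         (auto intro!: derivative_eq_intros d simp: algebra_simps)
  qed
  also have "\<dots> \<le> b0 * 1"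
  proof -
    have "0 \<le> m b0" unfolding m_def
      using V p b k J by (intro mean_nonneg ferro_spin) auto
    then show ?thesis using b by (intro mult_left_mono) auto
  qed
  finally have "1 - m b1 \<le> b0 / b1" using b by (simp add: field_simps)
  then show ?thesis by (simp add: m_def lat k_def)
qed

text \<open>Convexity of \<open>ln Z\<close> in the field compares the magnetization without boundary condition with
  the one under the plus boundary condition, up to the boundary energy.\<close>

lemma free_magnetization_ge:
  assumes V: "finite V" and J: "\<And>i j. i \<in> V \<Longrightarrow> j \<in> V \<Longrightarrow> 0 \<le> J i j"
    and k: "\<And>i. i \<in> V \<Longrightarrow> 0 \<le> k i" and h: "0 < h"
    and m: "\<And>i. i \<in> V \<Longrightarrow> m \<le> mean V J k (\<lambda>x. x i)"
  shows "real (card V) * m - (\<Sum>i\<in>V. k i) / h \<le> (\<Sum>i\<in>V. mean V J (\<lambda>_. h) (\<lambda>x. x i))"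
proof -
  define K where "K = (\<Sum>i\<in>V. k i)"
  define M where "M = (\<Sum>i\<in>V. mean V J (\<lambda>_. h) (\<lambda>x. x i))"
  have e: "energy V J (\<lambda>i. a i + t) x = energy V J a x + t * (\<Sum>i\<in>V. x i)" for a t x
    by (simp add: energy_def sum.distrib algebra_simps sum_distrib_left)
  have m1: "mean V J a (\<lambda>x. t * (\<Sum>i\<in>V. x i)) = t * (\<Sum>i\<in>V. mean V J a (\<lambda>x. x i))" for a t
    by (simp add: mean_scale mean_sum)
  have ratio: "mean V J a (\<lambda>x. exp (t * (\<Sum>i\<in>V. x i))) = zsum V J (\<lambda>i. a i + t) / zsum V J a" for a t
    by (simp add: mean_def wsum_def e exp_add mult.commute)
  have 1: "exp (h * (real (card V) * m)) * zsum V J k \<le> zsum V J (\<lambda>i. k i + h)"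
  proof -
    have "real (card V) * m \<le> (\<Sum>i\<in>V. mean V J k (\<lambda>x. x i))"
      using m sum_mono[of V "\<lambda>_. m"] by simp
    then have "exp (h * (real (card V) * m)) \<le> exp (mean V J k (\<lambda>x. h * (\<Sum>i\<in>V. x i)))"
      using h by (simp add: m1)
    also have "\<dots> \<le> zsum V J (\<lambda>i. k i + h) / zsum V J k"
      using exp_mean_le[OF V, of J k] by (simp add: ratio[symmetric])
    finally show ?thesis using zsum_pos[OF V, of J k] by (simp add: field_simps)
  qed
  have 2: "zsum V J (\<lambda>i. k i + h) \<le> exp K * zsum V J (\<lambda>_. h)"
    unfolding wsum_def sum_distrib_left
  proof (intro sum_mono)
    fix x assume x: "x \<in> spins V"
    have "energy V J (\<lambda>i. k i + h) x = (\<Sum>i\<in>V. k i * x i) + energy V J (\<lambda>_. h) x"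
      by (simp add: energy_def sum.distrib algebra_simps)
    moreover have "(\<Sum>i\<in>V. k i * x i) \<le> K"
      unfolding K_def
    proof (rule sum_mono)
      fix i assume i: "i \<in> V"
      show "k i * x i \<le> k i" by (rule spins_cases[OF x i]) (use k[OF i] in auto)
    qed
    ultimately show "1 * exp (energy V J (\<lambda>i. k i + h) x) \<le> exp K * (1 * exp (energy V J (\<lambda>_. h) x))"
      by (simp add: exp_add[symmetric])
  qed
  have 3: "zsum V J (\<lambda>_. 0) \<le> zsum V J k"
    using J k by (intro wsum_mono V ferro_const) auto
  have 4: "exp (- h * M) * zsum V J (\<lambda>_. h) \<le> zsum V J (\<lambda>_. 0)"
  proof -
    have "exp (- h * M) \<le> zsum V J (\<lambda>i. h + - h) / zsum V J (\<lambda>_. h)"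
      using exp_mean_le[OF V, of J "\<lambda>_. h" "\<lambda>x. - h * (\<Sum>i\<in>V. x i)"] unfolding ratio m1 M_def .
    then show ?thesis using zsum_pos[OF V, of J "\<lambda>_. h"] by (simp add: field_simps)
  qed
  \<comment> \<open>Jensen is used upwards from the field k and downwards from the field h. Adding k
    on top of h costs at most a factor exp K, while adding it at zero field only increases the
    partition function.\<close>
  have "exp (h * (real (card V) * m)) * (exp (- h * M) * zsum V J (\<lambda>_. h))
      \<le> exp (h * (real (card V) * m)) * zsum V J k"
    using 3 4 by (intro mult_left_mono) auto
  also have "\<dots> \<le> exp K * zsum V J (\<lambda>_. h)" using 1 2 by simp
  finally have "exp (h * (real (card V) * m)) * exp (- h * M) \<le> exp K"
    using zsum_pos[OF V, of J "\<lambda>_. h"] by (simp add: mult.assoc[symmetric])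
  then have "h * (real (card V) * m) - h * M \<le> K" by (simp add: exp_add[symmetric])
  then show ?thesis using h by (simp add: K_def M_def field_simps)
qed

lemma expectation_ising:
  assumes "finite V"
  shows "measure_pmf.expectation (ising V \<beta> Q \<mu>) f = mean V (\<lambda>i j. \<beta> / 2 * Q i j) \<mu> f"
proof -
  have w: "ising_weight V \<beta> Q \<mu> x = exp (energy V (\<lambda>i j. \<beta> / 2 * Q i j) \<mu> x)" for x
    by (simp add: ising_weight_def energy_def sum_distrib_left algebra_simps)
  have Z: "ising_Z V \<beta> Q \<mu> = zsum V (\<lambda>i j. \<beta> / 2 * Q i j) \<mu>"
    by (simp add: ising_Z_def wsum_def w)
  have "measure_pmf.expectation (ising V \<beta> Q \<mu>) f = (\<Sum>x\<in>spins V. pmf (ising V \<beta> Q \<mu>) x *\<^sub>R f x)"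
    using finite_spins[OF assms] by (intro integral_measure_pmf) (auto simp: set_pmf_iff pmf_ising[OF assms] split: if_splits)
  also have "\<dots> = (\<Sum>x\<in>spins V. f x * exp (energy V (\<lambda>i j. \<beta> / 2 * Q i j) \<mu> x)) / zsum V (\<lambda>i j. \<beta> / 2 * Q i j) \<mu>"
    unfolding sum_divide_distrib by (intro sum.cong refl) (simp add: pmf_ising[OF assms] w Z)
  finally show ?thesis by (simp add: mean_def wsum_def)
qed

section \<open>Sharpness of the phase transition\<close>

definition origin :: "nat \<Rightarrow> nat \<Rightarrow> int" where
  "origin d = (\<lambda>k\<in>{..<d}. 0)"

lemma origin_cube: "origin d \<in> cube d r"
  by (simp add: origin_def cube_def)

lemma origin_points: "origin d \<in> points d"
  by (simp add: origin_def points_def)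

lemma shift_origin: "p \<in> points d \<Longrightarrow> shift d p (origin d) = p"
  by (auto simp: shift_def origin_def points_def fun_eq_iff PiE_def extensional_def)

lemma cube_iff: "x \<in> cube d r \<longleftrightarrow> x \<in> points d \<and> (\<forall>k<d. \<bar>x k\<bar> \<le> int r)"
proof -
  have "j \<in> {- int r..int r} \<longleftrightarrow> \<bar>j\<bar> \<le> int r" for j by auto
  then show ?thesis by (auto simp only: cube_def points_def PiE_iff lessThan_iff UNIV_I simp_thms)
qed

lemma shift_cube_subset:
  assumes "p \<in> cube d r" "r + k \<le> r'"
  shows "shift d p ` cube d k \<subseteq> cube d r'"
proof -
  have "\<bar>x j + p j\<bar> \<le> int r'" if "x \<in> cube d k" "j < d" for x j
  proof -
    have "\<bar>x j\<bar> \<le> int k" "\<bar>p j\<bar> \<le> int r" using that assms by (auto simp: cube_iff)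
    then show ?thesis using assms(2) by linarith
  qed
  then show ?thesis by (auto simp: cube_iff[of _ d r'] shift_points) (simp add: shift_def)
qed

lemma cube_subset_shift_cube:
  assumes "p \<in> cube d r"
  shows "cube d r \<subseteq> shift d p ` cube d (2 * r)"
proof
  fix x assume x: "x \<in> cube d r"
  have "\<bar>x j - p j\<bar> \<le> int (2 * r)" if "j < d" for j
  proof -
    have "\<bar>x j\<bar> \<le> int r" "\<bar>p j\<bar> \<le> int r" using that assms x by (auto simp: cube_iff)
    then show ?thesis by linarith
  qed
  then have "shift d (\<lambda>k. - p k) x \<in> cube d (2 * r)"
    by (simp add: cube_iff shift_points) (simp add: shift_def)
  moreover have "shift d p (shift d (\<lambda>k. - p k) x) = x"
    using shift_inverse[of x d "\<lambda>k. - p k"] x by (simp add: cube_iff)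
  ultimately show "x \<in> shift d p ` cube d (2 * r)" by force
qed

section \<open>Infinite-volume limit of the magnetization with free boundary\<close>

abbreviation spin :: "nat \<Rightarrow> nat \<Rightarrow> real \<Rightarrow> real \<Rightarrow> (nat \<Rightarrow> int) set \<Rightarrow> (nat \<Rightarrow> int) \<Rightarrow> real" where
  "spin d L \<beta> h V i \<equiv> mean V (lat d L \<beta>) (\<lambda>_. h) (\<lambda>x. x i)"

definition centre :: "nat \<Rightarrow> nat \<Rightarrow> real \<Rightarrow> real \<Rightarrow> nat \<Rightarrow> real" where
  "centre d L \<beta> h r = spin d L \<beta> h (cube d r) (origin d)"

definition average :: "nat \<Rightarrow> nat \<Rightarrow> real \<Rightarrow> real \<Rightarrow> nat \<Rightarrow> real" where
  "average d L \<beta> h r =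
     (\<Sum>i\<in>cube d r. spin d L \<beta> h (cube d r) i) / real (card (cube d r))"

lemma magnetization_eq:
  assumes "1 \<le> d"
  shows "magnetization d L \<beta> h n = average d L \<beta> h (nat \<lfloor>root d (real n)\<rfloor>)"
proof -
  define V where "V = cube d (nat \<lfloor>root d (real n)\<rfloor>)"
  have "magnetization d L \<beta> h n = mean V (lat d L \<beta>) (\<lambda>_. h) (\<lambda>x. 1 / real (card V) * (\<Sum>i\<in>V. x i))"
    unfolding magnetization_def lattice_ising_def box_eq_cube[OF assms] V_def[symmetric]
    by (subst expectation_ising) (simp_all add: V_def finite_cube lat_def[abs_def])
  also have "\<dots> = 1 / real (card V) * (\<Sum>i\<in>V. spin d L \<beta> h V i)"
    unfolding mean_scale mean_sum ..
  finally show ?thesis by (simp add: average_def V_def)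
qed

lemma mean_spin_mono_set:
  assumes "finite V" "S \<subseteq> V" "p \<in> S" "0 \<le> \<beta>" "0 \<le> h"
  shows "spin d L \<beta> h S p \<le> spin d L \<beta> h V p"
  using assms by (intro mean_mono_set ferro_spin lat_nonneg) auto

lemma mean_shift_cube:
  assumes "p \<in> points d"
  shows "spin d L \<beta> h (shift d p ` cube d r) p = centre d L \<beta> h r"
  using mean_spin_shift[OF cube_points origin_cube, of d p r L \<beta> h]
  by (simp add: shift_origin[OF assms] centre_def)

text \<open>Centred at any point of the cube, the cube of twice the radius covers it; monotonicity
  in the volume and translation invariance do the rest.\<close>

lemma mean_le_centre:
  assumes p: "p \<in> cube d r" and "0 \<le> \<beta>" "0 \<le> h"
  shows "spin d L \<beta> h (cube d r) p \<le> centre d L \<beta> h (2 * r)"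
proof -
  have "spin d L \<beta> h (cube d r) p
      \<le> spin d L \<beta> h (shift d p ` cube d (2 * r)) p"
    using assms by (intro mean_spin_mono_set cube_subset_shift_cube finite_imageI finite_cube)
  then show ?thesis using p cube_points by (simp add: mean_shift_cube subset_iff)
qed

lemma centre_le_mean:
  assumes p: "p \<in> cube d (r - k)" and "k \<le> r" "0 \<le> \<beta>" "0 \<le> h"
  shows "centre d L \<beta> h k \<le> spin d L \<beta> h (cube d r) p"
proof -
  have pp: "p \<in> points d" using p by (simp add: cube_iff)
  have "p \<in> shift d p ` cube d k"
    using shift_origin[OF pp] origin_cube by (metis image_eqI)
  then have "spin d L \<beta> h (shift d p ` cube d k) p
      \<le> spin d L \<beta> h (cube d r) p"
    using assms by (intro mean_spin_mono_set finite_cube shift_cube_subset[OF p]) auto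
  then show ?thesis by (simp add: mean_shift_cube[OF pp])
qed

lemma cube_ratio_tendsto:
  "(\<lambda>r. real (card (cube d (r - k))) / real (card (cube d r))) \<longlonglongrightarrow> 1"
proof -
  have "(\<lambda>r. (2 * real r - 2 * real k + 1) / (2 * real r + 1)) \<longlonglongrightarrow> 1" by real_asymp
  then have "(\<lambda>r. ((2 * real r - 2 * real k + 1) / (2 * real r + 1)) ^ d) \<longlonglongrightarrow> 1 ^ d" by (rule tendsto_power)
  moreover have "\<forall>\<^sub>F r in sequentially. ((2 * real r - 2 * real k + 1) / (2 * real r + 1)) ^ d
      = real (card (cube d (r - k))) / real (card (cube d r))"
    using eventually_ge_at_top[of k]
    by eventually_elim (simp add: card_cube power_divide of_nat_diff algebra_simps)
  ultimately show ?thesis by (simp add: tendsto_cong)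
qed

text \<open>Sites at distance at least k from the boundary have magnetization at least that of the
  centre of a cube of radius k, and they fill almost the whole cube. Conversely no site exceeds the
  limit of the increasing sequence of central magnetizations.\<close>

lemma average_tendsto:
  assumes \<beta>: "0 \<le> \<beta>" and h: "0 \<le> h"
  shows "\<exists>M. average d L \<beta> h \<longlonglongrightarrow> M"
proof -
  define a where "a = centre d L \<beta> h"
  have nn: "0 \<le> spin d L \<beta> h (cube d r) i" if "i \<in> cube d r" for i r
    using \<beta> h that by (intro mean_nonneg ferro_spin lat_nonneg finite_cube) auto
  have a0: "0 \<le> a r" for r unfolding a_def centre_def by (rule nn[OF origin_cube])
  have inc: "incseq a"
    unfolding a_def centre_def incseq_def using \<beta> h
    by (auto intro!: mean_spin_mono_set finite_cube cube_mono origin_cube)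
  have le1: "a r \<le> 1" for r
    unfolding a_def centre_def by (rule mean_spin_le_one[OF finite_cube origin_cube])
  obtain M where M: "a \<longlonglongrightarrow> M" "\<And>r. a r \<le> M"
    using incseq_convergent[OF inc, of 1] le1 by auto
  have card: "0 < real (card (cube d r))" for r
    by (simp add: card_cube)
  have up: "average d L \<beta> h r \<le> M" for r
  proof -
    have "(\<Sum>i\<in>cube d r. spin d L \<beta> h (cube d r) i) \<le> (\<Sum>i\<in>cube d r. M)"
      using mean_le_centre[OF _ \<beta> h] M(2) unfolding a_def by (intro sum_mono) (meson order_trans)
    then show ?thesis using card[of r] by (simp add: average_def field_simps)
  qed
  have low: "real (card (cube d (r - k))) / real (card (cube d r)) * a k \<le> average d L \<beta> h r" if "k \<le> r" for k r
  proof -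
    have "real (card (cube d (r - k))) * a k = (\<Sum>i\<in>cube d (r - k). a k)" by simp
    also have "\<dots> \<le> (\<Sum>i\<in>cube d (r - k). spin d L \<beta> h (cube d r) i)"
      using centre_le_mean[OF _ that \<beta> h] unfolding a_def by (intro sum_mono)
    also have "\<dots> \<le> (\<Sum>i\<in>cube d r. spin d L \<beta> h (cube d r) i)"
      using nn by (intro sum_mono2 finite_cube cube_mono) auto
    finally show ?thesis using card[of r] by (simp add: average_def divide_right_mono)
  qed
  have "average d L \<beta> h \<longlonglongrightarrow> M"
  proof (rule order_tendstoI)
    fix y assume "y < M"
    then obtain k where k: "y < a k"
      using order_tendstoD(1)[OF M(1)] by (metis eventually_sequentially order_refl)
    have "(\<lambda>r. real (card (cube d (r - k))) / real (card (cube d r)) * a k) \<longlonglongrightarrow> 1 * a k"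
      by (intro tendsto_mult cube_ratio_tendsto tendsto_const)
    then have "\<forall>\<^sub>F r in sequentially. y < real (card (cube d (r - k))) / real (card (cube d r)) * a k"
      using k by (intro order_tendstoD(1)) auto
    then show "\<forall>\<^sub>F r in sequentially. y < average d L \<beta> h r"
      using eventually_ge_at_top[of k] by eventually_elim (use low in force)
  next
    fix y assume "M < y"
    then show "\<forall>\<^sub>F r in sequentially. average d L \<beta> h r < y"
      using up by (intro always_eventually allI) (meson le_less_trans)
  qed
  then show ?thesis by blast
qed

lemma floor_root_at_top:
  assumes "1 \<le> d"
  shows "filterlim (\<lambda>n. nat \<lfloor>root d (real n)\<rfloor>) at_top sequentially"
  unfolding filterlim_at_top eventually_sequentially
proof
  fix m
  have "m \<le> nat \<lfloor>root d (real n)\<rfloor>" if "m ^ d \<le> n" for n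
  proof -
    have "real m = root d (real m ^ d)" using assms by (simp add: real_root_power_cancel)
    also have "\<dots> \<le> root d (real n)" using that assms by (simp add: of_nat_power[symmetric] del: of_nat_power)
    finally show ?thesis using le_nat_floor by blast
  qed
  then show "\<exists>N. \<forall>n\<ge>N. m \<le> nat \<lfloor>root d (real n)\<rfloor>" by blast
qed

text \<open>Only a layer of width L sees the outside, so the boundary energy is of lower order than
  the volume.\<close>

lemma sum_outdeg_cube_le:
  assumes "L \<le> r"
  shows "(\<Sum>i\<in>cube d r. outdeg d L (cube d r) i)
    \<le> real ((2 * L + 1) ^ d) * (real (card (cube d r)) - real (card (cube d (r - L))))"
proof -
  have sub: "cube d (r - L) \<subseteq> cube d r" by (rule cube_mono) simp
  have zero: "outdeg d L (cube d r) i = 0" if i: "i \<in> cube d (r - L)" for i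
  proof -
    have "nbrs d L i \<subseteq> cube d r"
    proof
      fix x assume x: "x \<in> nbrs d L i"
      have "\<bar>x k\<bar> \<le> int r" if "k < d" for k
      proof -
        have "\<bar>x k - i k\<bar> \<le> int L" "\<bar>i k\<bar> \<le> int (r - L)"
          using nbrs_coord[OF x that] i that by (auto simp: cube_iff)
        then show ?thesis using assms by linarith
      qed
      then show "x \<in> cube d r" using x by (simp add: cube_iff nbrs_def)
    qed
    then have "nbrs d L i - cube d r = {}" by blast
    then show ?thesis unfolding outdeg_def by (simp only: card.empty of_nat_0)
  qed
  have "(\<Sum>i\<in>cube d r. outdeg d L (cube d r) i) = (\<Sum>i\<in>cube d r - cube d (r - L). outdeg d L (cube d r) i)"
    by (rule sum.mono_neutral_right) (use zero finite_cube in auto)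
  also have "\<dots> \<le> (\<Sum>i\<in>cube d r - cube d (r - L). real ((2 * L + 1) ^ d))"
  proof (rule sum_mono)
    fix i
    have "card (nbrs d L i - cube d r) \<le> card (nbrs d L i)"
      by (intro card_mono finite_nbrs) auto
    then show "outdeg d L (cube d r) i \<le> real ((2 * L + 1) ^ d)"
      unfolding outdeg_def using card_nbrs_le[of d L i] by (simp only: of_nat_le_iff)
  qed
  also have "\<dots> = real ((2 * L + 1) ^ d) * (real (card (cube d r)) - real (card (cube d (r - L))))"
    using card_mono[OF finite_cube sub] by (simp add: card_Diff_subset finite_cube sub of_nat_diff)
  finally show ?thesis .
qed

lemma average_mono_field:
  assumes "0 \<le> \<beta>" "0 \<le> h" "h \<le> h'"
  shows "average d L \<beta> h r \<le> average d L \<beta> h' r"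
  unfolding average_def using assms
  by (intro divide_right_mono sum_mono mean_mono ferro_spin finite_cube) (auto simp: lat_nonneg)

lemma phi_translate:
  assumes "p \<in> points d" "finite S" "S \<subseteq> points d" "p \<in> S"
  shows "\<exists>S'. finite S' \<and> S' \<subseteq> points d \<and> origin d \<in> S' \<and> phi d L \<beta> (origin d) S' = phi d L \<beta> p S"
proof (intro exI conjI)
  let ?g = "shift d (\<lambda>k. - p k)"
  have o: "?g p = origin d"
    by (simp add: shift_def origin_def)
  show "origin d \<in> ?g ` S" using assms(4) o by (metis image_eqI)
  show "phi d L \<beta> (origin d) (?g ` S) = phi d L \<beta> p S"
    using phi_shift[OF assms(3,4), of L \<beta> "\<lambda>k. - p k"] by (simp add: o)
qed (use assms shift_points in auto)

text \<open>The limits are taken in the order of the definition: at fixed h > 0 the boundary term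
  divided by h vanishes as the cube grows, leaving a bound \<kappa> free of h. Monotonicity in h
  then makes the right limit at 0 exist as an infimum, so that \<open>Lim\<close> really denotes
  it.\<close>

lemma spontaneous_magnetization:
  assumes d: "1 \<le> d" and b: "0 < b0" "b0 < b1"
    and phi: "\<And>S. finite S \<Longrightarrow> S \<subseteq> points d \<Longrightarrow> origin d \<in> S \<Longrightarrow> 1 \<le> phi d L b0 (origin d) S"
  shows "0 < Lim (at_right 0) (\<lambda>h. lim (\<lambda>n. magnetization d L b1 h n))"
proof -
  define \<kappa> where "\<kappa> = 1 - b0 / b1"
  have \<kappa>: "0 < \<kappa>" using b by (simp add: \<kappa>_def)
  define G where "G h = lim (\<lambda>n. magnetization d L b1 h n)" for h
  have b1: "0 \<le> b1" using b by simp
  have ex: "\<forall>h. \<exists>m. 0 \<le> h \<longrightarrow> average d L b1 h \<longlonglongrightarrow> m"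
    using average_tendsto[OF b1] by blast
  obtain M where M: "\<And>h. 0 \<le> h \<Longrightarrow> average d L b1 h \<longlonglongrightarrow> M h"
    using choice[OF ex] by blast
  have GM: "G h = M h" if "0 \<le> h" for h
  proof -
    have "(\<lambda>n. magnetization d L b1 h n) \<longlonglongrightarrow> M h"
      unfolding magnetization_eq[OF d]
      by (rule filterlim_compose[OF M[OF that] floor_root_at_top[OF d]])
    then show ?thesis unfolding G_def by (rule limI)
  qed
  have mono: "M h \<le> M h'" if "0 \<le> h" "h \<le> h'" for h h'
    using that b M[of h] M[of h'] by (intro LIMSEQ_le[of "average d L b1 h" _ "average d L b1 h'"])
      (auto intro!: average_mono_field)
  have ge: "\<kappa> \<le> M h" if h: "0 < h" for h
  proof -
    define D where "D = real ((2 * L + 1) ^ d)"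
    define \<rho> where "\<rho> r = real (card (cube d (r - L))) / real (card (cube d r))" for r
    have low: "\<kappa> - b1 * D * (1 - \<rho> r) / h \<le> average d L b1 h r" if r: "L \<le> r" for r
    proof -
      let ?V = "cube d r"
      have c: "0 < real (card ?V)" by (simp add: card_cube)
      have "real (card ?V) * \<kappa> - (\<Sum>i\<in>?V. b1 * outdeg d L ?V i) / h
          \<le> (\<Sum>i\<in>?V. spin d L b1 h ?V i)"
      proof (rule free_magnetization_ge)
        fix i assume i: "i \<in> ?V"
        show "\<kappa> \<le> mean ?V (lat d L b1) (\<lambda>i. b1 * outdeg d L ?V i) (\<lambda>x. x i)"
          unfolding \<kappa>_def
        proof (rule plus_magnetization_ge)
          fix S assume S: "S \<subseteq> ?V" "i \<in> S"
          have "i \<in> points d" "finite S" "S \<subseteq> points d"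
            using i cube_points finite_subset[OF S(1) finite_cube] subset_trans[OF S(1) cube_points] by auto
          then obtain S' where "finite S'" "S' \<subseteq> points d" "origin d \<in> S'"
            "phi d L b0 (origin d) S' = phi d L b0 i S" using phi_translate[of i d S L b0] S by blast
          then show "1 \<le> phi d L b0 i S" using phi by metis
        qed (use i b in \<open>auto simp: finite_cube cube_points\<close>)
      qed (use b h in \<open>auto simp: finite_cube lat_nonneg outdeg_def\<close>)
      moreover have "(\<Sum>i\<in>?V. b1 * outdeg d L ?V i) \<le> b1 * (D * (1 - \<rho> r)) * real (card ?V)"
      proof -
        have "(\<Sum>i\<in>?V. b1 * outdeg d L ?V i) = b1 * (\<Sum>i\<in>?V. outdeg d L ?V i)"
          by (simp add: sum_distrib_left)
        also have "\<dots> \<le> b1 * (D * (real (card ?V) - real (card (cube d (r - L)))))"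
          using sum_outdeg_cube_le[OF r, of d] b unfolding D_def by (intro mult_left_mono) auto
        also have "\<dots> = b1 * (D * (1 - \<rho> r)) * real (card ?V)"
          using c by (simp add: \<rho>_def field_simps)
        finally show ?thesis .
      qed
      then have "(\<Sum>i\<in>?V. b1 * outdeg d L ?V i) / h \<le> b1 * (D * (1 - \<rho> r)) * real (card ?V) / h"
        using h by (intro divide_right_mono) auto
      ultimately have "(\<kappa> - b1 * D * (1 - \<rho> r) / h) * real (card ?V)
          \<le> (\<Sum>i\<in>?V. spin d L b1 h ?V i)"
        by (simp add: algebra_simps)
      then show ?thesis using c by (simp add: average_def pos_le_divide_eq)
    qed
    have "(\<lambda>r. \<kappa> - b1 * D * (1 - \<rho> r) / h) \<longlonglongrightarrow> \<kappa> - b1 * D * (1 - 1) / h"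
      unfolding \<rho>_def by (intro tendsto_intros cube_ratio_tendsto) (use h in auto)
    then have "\<kappa> - b1 * D * (1 - 1) / h \<le> M h"
      using M[of h] h low by (intro LIMSEQ_le[OF _ M]) auto
    then show ?thesis by simp
  qed
  define l where "l = Inf (M ` {0<..})"
  have bdd: "bdd_below (M ` {0<..})" using ge by (intro bdd_belowI[of _ \<kappa>]) auto
  have l: "\<kappa> \<le> l" unfolding l_def using ge by (intro cInf_greatest) auto
  have "(G \<longlongrightarrow> l) (at_right 0)"
  proof (rule order_tendstoI)
    fix y assume "y < l"
    moreover have "l \<le> G h" if "0 < h" for h
      using that bdd unfolding l_def by (auto simp: GM intro!: cInf_lower)
    ultimately show "\<forall>\<^sub>F h in at_right 0. y < G h"
      using eventually_at_right_less[of "0::real"] by (auto elim!: eventually_mono intro: less_le_trans)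
  next
    fix y assume "l < y"
    then obtain h0 where h0: "0 < h0" "M h0 < y"
      unfolding l_def using cInf_lessD[of "M ` {0<..}" y] by auto
    have "\<forall>\<^sub>F h in at_right 0. 0 < h \<and> h < h0"
      using h0(1) by (auto simp: eventually_at_right_field intro!: exI[of _ h0])
    then show "\<forall>\<^sub>F h in at_right 0. G h < y"
    proof eventually_elim
      case (elim h)
      then have "G h \<le> M h0" using mono[of h h0] GM[of h] by simp
      then show ?case using h0 by simp
    qed
  qed
  then have "Lim (at_right 0) G = l" by (intro tendsto_Lim) (auto simp: trivial_limit_at_right_real)
  then show ?thesis using l \<kappa> by (simp add: G_def[abs_def])
qed

text \<open>If no S has \<open>phi\<close> below 1 at \<beta>, there is spontaneous magnetization at
  every larger b, and some such b still lies below \<open>beta_c\<close>.\<close>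

lemma exists_phi_less_one:
  assumes d: "1 \<le> d" and \<beta>: "0 \<le> \<beta>" "ereal \<beta> < beta_c d L"
  shows "\<exists>S. finite S \<and> S \<subseteq> points d \<and> origin d \<in> S \<and> phi d L \<beta> (origin d) S < 1"
proof (rule ccontr)
  assume "\<not> ?thesis"
  then have phi: "1 \<le> phi d L \<beta> (origin d) S" if "finite S" "S \<subseteq> points d" "origin d \<in> S" for S
    using that by force
  \<comment> \<open>At zero inverse temperature \<open>phi\<close> vanishes on a single
    site.\<close>
  have "\<beta> \<noteq> 0" using phi[of "{origin d}"] origin_points by (auto simp: phi_def)
  then have pos: "0 < \<beta>" using \<beta> by simp
  obtain b where b: "ereal \<beta> < ereal b" "ereal b < beta_c d L"
    using ereal_dense2[OF \<beta>(2)] by blast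
  have "0 < Lim (at_right 0) (\<lambda>h. lim (\<lambda>n. magnetization d L b h n))"
    using b pos phi by (intro spontaneous_magnetization[OF d, of \<beta>]) auto
  then have "ereal b \<in> ereal ` {\<beta>. 0 < \<beta> \<and> 0 < Lim (at_right 0) (\<lambda>h. lim (\<lambda>n. magnetization d L \<beta> h n))}"
    using b pos by auto
  then have "beta_c d L \<le> ereal b" unfolding beta_c_def by (rule Inf_lower)
  then show False using b by simp
qed

text \<open>Simon--Lieb around q, summed over the far endpoint, gives
  \<open>sus q \<le> card S + \<phi> * X\<close> with X the largest susceptibility in the cube. In
  finite volume X is finite, and \<phi> < 1 allows solving for it.\<close>

lemma susceptibility_bound:
  assumes \<beta>: "0 \<le> \<beta>" and S: "finite S" "S \<subseteq> points d" "origin d \<in> S"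
    and phi: "phi d L \<beta> (origin d) S < 1" and p: "p \<in> cube d r"
  shows "(\<Sum>z\<in>cube d r. corr (cube d r) (lat d L \<beta>) p z) \<le> real (card S) / (1 - phi d L \<beta> (origin d) S)"
proof -
  let ?V = "cube d r" and ?J = "lat d L \<beta>"
  define sus where "sus p = (\<Sum>z\<in>?V. corr ?V ?J p z)" for p
  define X where "X = Max (sus ` ?V)"
  define \<phi> where "\<phi> = phi d L \<beta> (origin d) S"
  have V: "finite ?V" "?V \<noteq> {}" using finite_cube origin_cube by blast+
  have X: "sus q \<le> X" if "q \<in> ?V" for q unfolding X_def using that V by (intro Max_ge) auto
  have X0: "0 \<le> X"
  proof -
    have "0 \<le> sus (origin d)" unfolding sus_def by (intro sum_nonneg corr_nonneg V \<beta> origin_cube)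
    then show ?thesis using X[OF origin_cube] by linarith
  qed
  have step: "sus q \<le> real (card S) + \<phi> * X" if q: "q \<in> ?V" for q
  proof -
    have qp: "q \<in> points d" using q by (simp add: cube_iff)
    define Sq where "Sq = shift d q ` S"
    \<comment> \<open>Near the boundary the translate of S sticks out of the cube and is cut
      off.\<close>
    define T where "T = Sq \<inter> ?V"
    have Sq: "finite Sq" "Sq \<subseteq> points d" using S shift_points by (auto simp: Sq_def)
    have qS: "q \<in> Sq" unfolding Sq_def using shift_origin[OF qp] S(3) by (metis image_eqI)
    have T: "finite T" "T \<subseteq> ?V" "q \<in> T" "T \<subseteq> Sq" using Sq q qS by (auto simp: T_def)
    have phiq: "phi d L \<beta> q Sq = \<phi>"
      using phi_shift[OF S(2,3), of L \<beta> q] by (simp add: shift_origin[OF qp] Sq_def \<phi>_def)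
    have cT: "card T \<le> card S"
      using card_mono[OF Sq(1) T(4)] card_image_le[OF S(1), of "shift d q"] by (simp add: Sq_def)
    have "(\<Sum>z\<in>T. corr ?V ?J q z) \<le> (\<Sum>z\<in>T. 1)"
      using T q by (intro sum_mono mean_pair_le_one V) auto
    then have 1: "(\<Sum>z\<in>T. corr ?V ?J q z) \<le> real (card S)" using cT by simp
    have "(\<Sum>z\<in>?V - T. corr ?V ?J q z) \<le> (\<Sum>z\<in>?V - T. \<Sum>y\<in>T. \<Sum>w\<in>?V - T. (?J y w + ?J w y) * corr T ?J q y * corr ?V ?J w z)"
      using T \<beta> by (intro sum_mono simon_lieb V lat_nonneg) auto
    also have "\<dots> = (\<Sum>y\<in>T. \<Sum>w\<in>?V - T. \<Sum>z\<in>?V - T. (?J y w + ?J w y) * corr T ?J q y * corr ?V ?J w z)"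
      by (rule trans[OF sum.swap], rule sum.cong[OF refl], rule sum.swap)
    also have "\<dots> \<le> (\<Sum>y\<in>T. \<Sum>w\<in>?V - T. (?J y w + ?J w y) * corr T ?J q y * X)"
    proof (intro sum_mono)
      fix y w assume y: "y \<in> T" and w: "w \<in> ?V - T"
      have nn: "0 \<le> (?J y w + ?J w y) * corr T ?J q y"
        using T y \<beta> by (intro mult_nonneg_nonneg add_nonneg_nonneg lat_nonneg corr_nonneg)
      have "(\<Sum>z\<in>?V - T. corr ?V ?J w z) \<le> sus w"
        unfolding sus_def using V w \<beta> by (intro sum_mono2 corr_nonneg) auto
      also have "\<dots> \<le> X" using w by (intro X) auto
      finally show "(\<Sum>z\<in>?V - T. (?J y w + ?J w y) * corr T ?J q y * corr ?V ?J w z)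
          \<le> (?J y w + ?J w y) * corr T ?J q y * X"
        unfolding sum_distrib_left[symmetric] using nn by (intro mult_left_mono)
    qed
    also have "\<dots> = (\<Sum>y\<in>T. \<beta> * real (card (nbrs d L y \<inter> (?V - T))) * corr T ?J q y) * X"
    proof -
      have "(\<Sum>w\<in>?V - T. (?J y w + ?J w y) * corr T ?J q y * X)
          = \<beta> * real (card (nbrs d L y \<inter> (?V - T))) * corr T ?J q y * X" for y
      proof -
        have "(\<Sum>w\<in>?V - T. ?J y w + ?J w y) = (\<Sum>w\<in>?V - T. ?J w y + ?J y w)" by (simp add: add.commute)
        also have "\<dots> = \<beta> * real (card (nbrs d L y \<inter> (?V - T)))"
          using cube_points V by (intro sum_coupling) auto
        finally show ?thesis by (simp add: sum_distrib_right[symmetric])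
      qed
      then show ?thesis by (simp add: sum_distrib_right)
    qed
    also have "\<dots> \<le> \<phi> * X"
    proof (rule mult_right_mono[OF _ X0])
      \<comment> \<open>The cut decreases both factors: fewer bonds leave T inside the cube than
        leave the full translate, and correlations drop with the volume.\<close>
      have "(\<Sum>y\<in>T. \<beta> * real (card (nbrs d L y \<inter> (?V - T))) * corr T ?J q y)
          \<le> (\<Sum>y\<in>T. \<beta> * outdeg d L Sq y * corr Sq ?J q y)"
      proof (intro sum_mono mult_mono)
        fix y assume y: "y \<in> T"
        have "nbrs d L y \<inter> (?V - T) \<subseteq> nbrs d L y - Sq" by (auto simp: T_def)
        then show "real (card (nbrs d L y \<inter> (?V - T))) \<le> outdeg d L Sq y"
          unfolding outdeg_def by (intro of_nat_mono card_mono) (auto simp: finite_nbrs)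
        show "corr T ?J q y \<le> corr Sq ?J q y"
          using T y Sq \<beta> by (intro mean_mono_set ferro_pair lat_nonneg) auto
        show "0 \<le> corr T ?J q y" using T y \<beta> by (intro corr_nonneg)
      qed (use \<beta> in \<open>auto simp: outdeg_def\<close>)
      also have "\<dots> \<le> (\<Sum>y\<in>Sq. \<beta> * outdeg d L Sq y * corr Sq ?J q y)"
        using Sq T qS \<beta> by (intro sum_mono2 mult_nonneg_nonneg corr_nonneg) (auto simp: outdeg_def)
      finally show "(\<Sum>y\<in>T. \<beta> * real (card (nbrs d L y \<inter> (?V - T))) * corr T ?J q y) \<le> \<phi>"
        by (simp add: phiq[symmetric] phi_def)
    qed
    finally have 2: "(\<Sum>z\<in>?V - T. corr ?V ?J q z) \<le> \<phi> * X" .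
    have "sus q = (\<Sum>z\<in>?V - T. corr ?V ?J q z) + (\<Sum>z\<in>T. corr ?V ?J q z)"
      unfolding sus_def using V T by (intro sum.subset_diff) auto
    then show ?thesis using 1 2 by simp
  qed
  have "X \<le> real (card S) + \<phi> * X"
    using V step by (subst (1) X_def, subst Max_le_iff) auto
  then have "X \<le> real (card S) / (1 - \<phi>)"
    using phi by (simp add: \<phi>_def field_simps)
  then show ?thesis using X[OF p] by (simp add: sus_def \<phi>_def)
qed

section \<open>Likelihood ratios and moments of block sums\<close>

definition boost :: "real \<Rightarrow> 'v set \<Rightarrow> ('v \<Rightarrow> real) \<Rightarrow> 'v \<Rightarrow> real" where
  "boost A S h i = h i + A * of_bool (i \<in> S)"

lemma boost_insert: "i \<notin> S \<Longrightarrow> boost A (insert i S) h = boost A {i} (boost A S h)"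
  by (auto simp: fun_eq_iff boost_def)

lemma boost_commute: "boost A S (boost B T h) = boost B T (boost A S h)"
  by (auto simp: fun_eq_iff boost_def)

lemma boost_empty [simp]: "boost A {} h = h"
  by (simp add: fun_eq_iff boost_def)

lemma boost_nonneg: "0 \<le> h k \<Longrightarrow> 0 \<le> A \<Longrightarrow> 0 \<le> boost A S h k"
  by (simp add: boost_def)

lemma tanh_le_self: "0 \<le> (x::real) \<Longrightarrow> tanh x \<le> x"
  using sinh_le_mult_cosh[of x] cosh_real_pos[of x] by (simp add: tanh_def field_simps)

lemma energy_boost:
  assumes "finite V" "S \<subseteq> V"
  shows "energy V J (boost A S h) x = energy V J h x + A * (\<Sum>i\<in>S. x i)"
proof -
  have "(\<Sum>i\<in>V. A * of_bool (i \<in> S) * x i) = (\<Sum>i\<in>S. A * x i)"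
    by (rule sum.mono_neutral_cong_right) (use assms in auto)
  then show ?thesis
    by (simp add: energy_def boost_def sum.distrib distrib_right sum_distrib_left)
qed

text \<open>For a spin x, exp (A x) = cosh A (1 + tanh A x). The cosh cancels in every mean and in
  the ratios of partition functions below, so A enters there through tanh A alone.\<close>

lemma wsum_boost:
  assumes "finite V" "i \<in> V"
  shows "wsum V J (boost A {i} h) f = cosh A * wsum V J h (\<lambda>x. (1 + tanh A * x i) * f x)"
proof -
  have "exp (A * x i) = cosh A * (1 + tanh A * x i)" if x: "x \<in> spins V" for x
  proof -
    have ct: "cosh A * tanh A = sinh A"
      using cosh_real_pos[of A] by (simp add: tanh_def)
    have p: "exp A = cosh A + sinh A" "exp (- A) = cosh A - sinh A"
      by (simp_all add: cosh_plus_sinh cosh_minus_sinh)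
    have e: "cosh A * (1 + tanh A * x i) = cosh A + sinh A * x i"
      by (simp add: distrib_left mult.assoc[symmetric] ct)
    show ?thesis
      unfolding e by (rule spins_cases[OF x assms(2)]) (simp_all add: p)
  qed
  then show ?thesis
    using energy_boost[OF assms(1), of "{i}" J A h] assms(2)
    unfolding wsum_def sum_distrib_left by (intro sum.cong refl) (simp add: exp_add)
qed

lemma mean_boost:
  assumes "finite V" "i \<in> V"
  shows "mean V J (boost A {i} h) f =
    (mean V J h f + tanh A * mean V J h (\<lambda>x. x i * f x)) / (1 + tanh A * mean V J h (\<lambda>x. x i))"
proof -
  have e: "wsum V J h (\<lambda>x. (1 + tanh A * x i) * f x) = wsum V J h f + tanh A * wsum V J h (\<lambda>x. x i * f x)" for f
    unfolding wsum_scale[symmetric] wsum_add[symmetric] by (simp add: algebra_simps)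
  have z: "0 < zsum V J h" by (rule zsum_pos[OF assms(1)])
  define F G M where "F = wsum V J h f" and "G = wsum V J h (\<lambda>x. x i * f x)" and "M = wsum V J h (\<lambda>x. x i)"
  have c: "cosh A \<noteq> 0" using cosh_real_pos[of A] by simp
  have "mean V J (boost A {i} h) f = (F + tanh A * G) / (zsum V J h + tanh A * M)"
    unfolding mean_def wsum_boost[OF assms] e F_def G_def M_def using c by simp
  also have "\<dots> = ((F + tanh A * G) / zsum V J h) / ((zsum V J h + tanh A * M) / zsum V J h)"
    using z by simp
  also have "(F + tanh A * G) / zsum V J h = mean V J h f + tanh A * mean V J h (\<lambda>x. x i * f x)"
    by (simp add: mean_def F_def G_def add_divide_distrib)
  also have "(zsum V J h + tanh A * M) / zsum V J h = 1 + tanh A * mean V J h (\<lambda>x. x i)"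
    using z by (simp add: mean_def M_def add_divide_distrib)
  finally show ?thesis .
qed

lemma zsum_boost:
  assumes "finite V" "i \<in> V"
  shows "zsum V J (boost A {i} h) = cosh A * zsum V J h * (1 + tanh A * mean V J h (\<lambda>x. x i))"
proof -
  have "wsum V J h (\<lambda>x. (1 + tanh A * x i) * 1) = zsum V J h + tanh A * wsum V J h (\<lambda>x. x i)"
    unfolding wsum_scale[symmetric] wsum_add[symmetric] by (simp add: algebra_simps)
  then show ?thesis
    unfolding wsum_boost[OF assms] using zsum_pos[OF assms(1), of J h] by (simp add: mean_def field_simps)
qed

section \<open>Adding tilts site by site\<close>

locale ferromagnet =
  fixes V :: "'v set" and J :: "'v \<Rightarrow> 'v \<Rightarrow> real"
  assumes V: "finite V" and J: "\<And>i j. i \<in> V \<Longrightarrow> j \<in> V \<Longrightarrow> 0 \<le> J i j"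
begin

abbreviation c where "c \<equiv> corr V J"

lemma cov_le:
  "i \<in> V \<Longrightarrow> j \<in> V \<Longrightarrow> (\<And>k. k \<in> V \<Longrightarrow> 0 \<le> h k) \<Longrightarrow>
    mean V J h (\<lambda>x. x i * x j) \<le> mean V J h (\<lambda>x. x i) * mean V J h (\<lambda>x. x j) + c i j"
  using covariance_le_zero_field[OF V, of i j J h] J by simp

lemma spin_nonneg:
  "i \<in> V \<Longrightarrow> (\<And>k. k \<in> V \<Longrightarrow> 0 \<le> h k) \<Longrightarrow> 0 \<le> mean V J h (\<lambda>x. x i)"
  using V J by (intro mean_nonneg ferro_spin) auto

lemma c_nonneg: "i \<in> V \<Longrightarrow> j \<in> V \<Longrightarrow> 0 \<le> c i j"
  using V J by (intro mean_nonneg ferro_pair) auto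

text \<open>Apart from powers of cosh A, the left side has the factor 1 + t mi + t mj + t^2 mij and
  the right side (1 + t mi)(1 + t mj). The excess is t^2 times the truncated correlation in the
  field h, at most the zero-field one; as means are nonnegative the product is at least 1, so the
  excess may be put into the exponential.\<close>

lemma zsum_boost_pair:
  assumes i: "i \<in> V" and j: "j \<in> V" and h: "\<And>k. k \<in> V \<Longrightarrow> 0 \<le> h k" and A: "0 \<le> A"
  shows "zsum V J (boost A {i} (boost A {j} h)) * zsum V J h
    \<le> zsum V J (boost A {i} h) * zsum V J (boost A {j} h) * exp ((tanh A)\<^sup>2 * c i j)"
proof -
  define t where "t = tanh A"
  define mi mj mij where "mi = mean V J h (\<lambda>x. x i)" and "mj = mean V J h (\<lambda>x. x j)"
    and "mij = mean V J h (\<lambda>x. x i * x j)"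
  have t: "0 \<le> t" using A by (simp add: t_def)
  have m: "0 \<le> mi" "0 \<le> mj" using spin_nonneg h i j by (auto simp: mi_def mj_def)
  have Z: "0 < zsum V J h" by (rule zsum_pos[OF V])
  have cij: "0 \<le> c i j" using c_nonneg i j .
  have "zsum V J (boost A {i} (boost A {j} h)) =
      cosh A * (cosh A * zsum V J h * (1 + t * mj)) * (1 + t * ((mi + t * mij) / (1 + t * mj)))"
    unfolding zsum_boost[OF V i] zsum_boost[OF V j] mean_boost[OF V j] t_def mi_def mj_def mij_def
    by (simp add: mult.commute)
  also have "\<dots> = (cosh A)\<^sup>2 * zsum V J h * (1 + t * mj + t * (mi + t * mij))"
  proof -
    have p: "0 < 1 + t * mj" using t m by (simp add: add_pos_nonneg)
    have "(1 + t * mj) * (1 + t * ((mi + t * mij) / (1 + t * mj))) = 1 + t * mj + t * (mi + t * mij)"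
      using p by (simp add: distrib_left[of "1 + t * mj"])
    then show ?thesis by (simp add: power2_eq_square mult.assoc)
  qed
  also have "\<dots> \<le> (cosh A)\<^sup>2 * zsum V J h * ((1 + t * mi) * (1 + t * mj) * exp (t\<^sup>2 * c i j))"
  proof (intro mult_left_mono)
    have "mij \<le> mi * mj + c i j" using cov_le[OF i j h] by (simp add: mij_def mi_def mj_def)
    then have "t * (t * mij) \<le> t * (t * (mi * mj + c i j))" using t by (intro mult_left_mono)
    then have "1 + t * mj + t * (mi + t * mij) \<le> (1 + t * mi) * (1 + t * mj) * 1 + 1 * (t\<^sup>2 * c i j)"
      by (simp add: algebra_simps power2_eq_square)
    also have "\<dots> \<le> (1 + t * mi) * (1 + t * mj) * 1 + (1 + t * mi) * (1 + t * mj) * (t\<^sup>2 * c i j)"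
    proof -
      have "1 * 1 \<le> (1 + t * mi) * (1 + t * mj)" using t m by (intro mult_mono) auto
      then show ?thesis using cij by (intro add_left_mono mult_right_mono) auto
    qed
    also have "\<dots> = (1 + t * mi) * (1 + t * mj) * (1 + t\<^sup>2 * c i j)"
      by (simp only: distrib_left)
    also have "\<dots> \<le> (1 + t * mi) * (1 + t * mj) * exp (t\<^sup>2 * c i j)"
      using t m by (intro mult_left_mono exp_ge_add_one_self) auto
    finally show "1 + t * mj + t * (mi + t * mij) \<le> (1 + t * mi) * (1 + t * mj) * exp (t\<^sup>2 * c i j)" .
  qed (use Z in auto)
  finally have "zsum V J (boost A {i} (boost A {j} h)) * zsum V J h
      \<le> (cosh A)\<^sup>2 * zsum V J h * ((1 + t * mi) * (1 + t * mj) * exp (t\<^sup>2 * c i j)) * zsum V J h"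
    using Z by (intro mult_right_mono) auto
  also have "\<dots> = zsum V J (boost A {i} h) * zsum V J (boost A {j} h) * exp ((tanh A)\<^sup>2 * c i j)"
    unfolding zsum_boost[OF V i] zsum_boost[OF V j] t_def mi_def mj_def
    by (simp only: power2_eq_square mult_ac)
  finally show ?thesis .
qed

lemma mult_chain:
  fixes a b e1 e2 z w u v y :: real
  assumes "a * z \<le> u * w * e1" "u * y \<le> v * z * e2" "0 < z" "0 \<le> w" "0 \<le> e1" "0 \<le> y"
  shows "a * y \<le> v * w * (e1 * e2)"
proof -
  have "(a * y) * z \<le> (u * w * e1) * y" using assms mult_right_mono[OF assms(1), of y] by (simp add: mult_ac)
  also have "\<dots> = (u * y) * (w * e1)" by simp
  also have "\<dots> \<le> (v * z * e2) * (w * e1)" using assms by (intro mult_right_mono) auto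
  also have "\<dots> = (v * w * (e1 * e2)) * z" by simp
  finally show ?thesis using assms(3) by (simp only: mult_le_cancel_right_pos)
qed

text \<open>The sites of T join the background field one at a time. The exponents add up because the
  pair bound involves the zero-field correlation whatever the background is.\<close>

lemma zsum_boost_single_set:
  assumes i: "i \<in> V" and T: "T \<subseteq> V" and h: "\<And>k. k \<in> V \<Longrightarrow> 0 \<le> h k" and A: "0 \<le> A"
  shows "zsum V J (boost A {i} (boost A T h)) * zsum V J h
    \<le> zsum V J (boost A {i} h) * zsum V J (boost A T h) * exp ((tanh A)\<^sup>2 * (\<Sum>j\<in>T. c i j))"
proof -
  have "finite T" using T V finite_subset by blast
  then show ?thesis using T
  proof (induction T)
    case empty
    then show ?case by (simp add: mult.commute)
  next
    case (insert j T)
    define g where "g = boost A T h"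
    have g: "0 \<le> g k" if "k \<in> V" for k using h A that by (simp add: g_def boost_nonneg)
    have j: "j \<in> V" using insert by simp
    have 1: "zsum V J (boost A {i} (boost A {j} g)) * zsum V J g
        \<le> zsum V J (boost A {i} g) * zsum V J (boost A {j} g) * exp ((tanh A)\<^sup>2 * c i j)"
      by (rule zsum_boost_pair[OF i j g A])
    have 2: "zsum V J (boost A {i} g) * zsum V J h
        \<le> zsum V J (boost A {i} h) * zsum V J g * exp ((tanh A)\<^sup>2 * (\<Sum>j\<in>T. c i j))"
      using insert unfolding g_def by simp
    have "zsum V J (boost A {i} (boost A {j} g)) * zsum V J h
        \<le> zsum V J (boost A {i} h) * zsum V J (boost A {j} g) *
          (exp ((tanh A)\<^sup>2 * c i j) * exp ((tanh A)\<^sup>2 * (\<Sum>j\<in>T. c i j)))"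
      by (rule mult_chain[OF 1 2]) (simp_all add: zsum_pos[OF V] less_imp_le)
    moreover have "exp ((tanh A)\<^sup>2 * c i j) * exp ((tanh A)\<^sup>2 * (\<Sum>j\<in>T. c i j))
        = exp ((tanh A)\<^sup>2 * (\<Sum>j\<in>insert j T. c i j))"
      using insert.hyps by (simp add: exp_add[symmetric] distrib_left)
    ultimately show ?case
      unfolding boost_insert[OF insert.hyps(2)] g_def by simp
  qed
qed

lemma zsum_boost_sets:
  assumes S: "S \<subseteq> V" and T: "T \<subseteq> V" and h: "\<And>k. k \<in> V \<Longrightarrow> 0 \<le> h k" and A: "0 \<le> A"
  shows "zsum V J (boost A S (boost A T h)) * zsum V J h
    \<le> zsum V J (boost A S h) * zsum V J (boost A T h) * exp ((tanh A)\<^sup>2 * (\<Sum>i\<in>S. \<Sum>j\<in>T. c i j))"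
proof -
  have "finite S" using S V finite_subset by blast
  then show ?thesis using S
  proof (induction S)
    case empty
    then show ?case by (simp add: mult.commute)
  next
    case (insert i S)
    define g where "g = boost A S h"
    have g: "0 \<le> g k" if "k \<in> V" for k using h A that by (simp add: g_def boost_nonneg)
    have i: "i \<in> V" using insert by simp
    have 1: "zsum V J (boost A {i} (boost A T g)) * zsum V J g
        \<le> zsum V J (boost A T g) * zsum V J (boost A {i} g) * exp ((tanh A)\<^sup>2 * (\<Sum>j\<in>T. c i j))"
      using zsum_boost_single_set[OF i T g A] by (simp only: mult_ac)
    have 2: "zsum V J (boost A T g) * zsum V J h
        \<le> zsum V J (boost A T h) * zsum V J g * exp ((tanh A)\<^sup>2 * (\<Sum>i\<in>S. \<Sum>j\<in>T. c i j))"
      using insert unfolding g_def boost_commute[of A T A S h] by (simp add: mult_ac)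
    have "zsum V J (boost A {i} (boost A T g)) * zsum V J h
        \<le> zsum V J (boost A T h) * zsum V J (boost A {i} g) *
          (exp ((tanh A)\<^sup>2 * (\<Sum>j\<in>T. c i j)) * exp ((tanh A)\<^sup>2 * (\<Sum>i\<in>S. \<Sum>j\<in>T. c i j)))"
      by (rule mult_chain[OF 1 2]) (simp_all add: zsum_pos[OF V] less_imp_le)
    moreover have "exp ((tanh A)\<^sup>2 * (\<Sum>j\<in>T. c i j)) * exp ((tanh A)\<^sup>2 * (\<Sum>i\<in>S. \<Sum>j\<in>T. c i j))
        = exp ((tanh A)\<^sup>2 * (\<Sum>i\<in>insert i S. \<Sum>j\<in>T. c i j))"
      using insert.hyps by (simp add: exp_add[symmetric] distrib_left)
    ultimately show ?case
      unfolding boost_insert[OF insert.hyps(2)] g_def boost_commute[of A T A S h]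
      by (simp add: mult_ac)
  qed
qed

text \<open>Each further tilted site j raises the mean by tanh A times a truncated correlation,
  divided by a denominator that is at least 1.\<close>

lemma spin_boost_le:
  assumes k: "k \<in> V" and T: "T \<subseteq> V" and A: "0 \<le> A"
  shows "mean V J (boost A T (\<lambda>_. 0)) (\<lambda>x. x k) \<le> tanh A * (\<Sum>j\<in>T. c j k)"
proof -
  have "finite T" using T V finite_subset by blast
  then show ?thesis using T
  proof (induction T)
    case empty
    have "wsum V J (\<lambda>_. 0) (\<lambda>x. x k) = 0"
      using k by (intro wsum_odd_zero) (simp add: flip_def)
    then show ?case by (simp add: mean_def)
  next
    case (insert j T)
    define g where "g = boost A T (\<lambda>_. 0 :: real)"
    define t where "t = tanh A"
    define mk mj mjk where "mk = mean V J g (\<lambda>x. x k)" and "mj = mean V J g (\<lambda>x. x j)"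
      and "mjk = mean V J g (\<lambda>x. x j * x k)"
    have g: "0 \<le> g i" if "i \<in> V" for i using A that by (simp add: g_def boost_nonneg)
    have j: "j \<in> V" using insert by simp
    have t: "0 \<le> t" using A by (simp add: t_def)
    have m: "0 \<le> mj" using spin_nonneg g j by (simp add: mj_def)
    have le: "mjk \<le> mj * mk + c j k" using cov_le[OF j k g] by (simp add: mk_def mj_def mjk_def)
    have p: "1 \<le> 1 + t * mj" using t m by simp
    have "mk + t * mjk \<le> mk + t * (mj * mk + c j k)" using le t by (simp add: mult_left_mono)
    also have "\<dots> = mk * (1 + t * mj) + t * c j k * 1" by (simp add: algebra_simps)
    also have "\<dots> \<le> mk * (1 + t * mj) + t * c j k * (1 + t * mj)"
      using p t c_nonneg[OF j k] by (intro add_left_mono mult_left_mono) auto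
    also have "\<dots> = (mk + t * c j k) * (1 + t * mj)" by (simp add: distrib_right)
    finally have "(mk + t * mjk) / (1 + t * mj) \<le> mk + t * c j k" using p by (simp add: pos_divide_le_eq)
    then have "mean V J (boost A {j} g) (\<lambda>x. x k) \<le> mk + t * c j k"
      by (simp add: mean_boost[OF V j] mk_def mj_def mjk_def t_def)
    also have "mk \<le> t * (\<Sum>j\<in>T. c j k)" using insert by (simp add: mk_def g_def t_def)
    finally show ?case
      unfolding boost_insert[OF insert.hyps(2)] using insert.hyps by (simp add: g_def t_def distrib_left)
  qed
qed

end

lemma cosh_le_exp_square:
  fixes x :: real assumes "0 \<le> x" "x \<le> 1"
  shows "cosh x \<le> exp (x\<^sup>2)"
proof -
  have "exp x \<le> 1 + x + x\<^sup>2" by (rule exp_bound[OF assms])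
  moreover have "exp (- x) \<le> 1 - x + x\<^sup>2"
  proof -
    have "exp (- x) \<le> inverse (1 + x)"
      using exp_ge_add_one_self[of x] assms by (simp add: exp_minus le_imp_inverse_le)
    also have "\<dots> \<le> 1 - x + x\<^sup>2"
    proof -
      have "1 \<le> (1 - x + x\<^sup>2) * (1 + x)"
        using assms by (simp add: algebra_simps power2_eq_square)
      then show ?thesis using assms by (simp add: inverse_eq_divide pos_divide_le_eq)
    qed
    finally show ?thesis .
  qed
  ultimately have "cosh x \<le> 1 + x\<^sup>2" by (simp add: cosh_field_def)
  then show ?thesis using exp_ge_add_one_self[of "x\<^sup>2"] by linarith
qed

section \<open>Deviation bounds for block sums\<close>

locale bounded_susceptibility = ferromagnet +
  fixes sus :: real
  assumes sus: "\<And>i. i \<in> V \<Longrightarrow> (\<Sum>j\<in>V. c i j) \<le> sus"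
begin

lemma sum_c_le:
  assumes "i \<in> V" "T \<subseteq> V" shows "(\<Sum>j\<in>T. c i j) \<le> sus"
proof -
  have "(\<Sum>j\<in>T. c i j) \<le> (\<Sum>j\<in>V. c i j)"
    using assms V by (intro sum_mono2 c_nonneg) auto
  then show ?thesis using sus[OF assms(1)] by linarith
qed

lemma sum_sum_c_le:
  assumes "S \<subseteq> V" "T \<subseteq> V" shows "(\<Sum>i\<in>S. \<Sum>j\<in>T. c i j) \<le> real (card S) * sus"
proof -
  have "(\<Sum>i\<in>S. \<Sum>j\<in>T. c i j) \<le> (\<Sum>i\<in>S. sus)" using assms by (intro sum_mono sum_c_le) auto
  then show ?thesis by simp
qed

text \<open>Tilting site by site, each new site contributes
  \<open>cosh l * (1 + tanh l * m)\<close>, where its mean m under the earlier tilts is at most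
  \<open>l * sus\<close>. Block sums are thus subgaussian with variance of the order of the block
  size, as for independent spins.\<close>

lemma exponential_moment_le:
  assumes S: "S \<subseteq> V" and l: "0 \<le> l" "l \<le> 1"
  shows "zsum V J (boost l S (\<lambda>_. 0)) \<le> zsum V J (\<lambda>_. 0) * exp (real (card S) * ((1 + sus) * l\<^sup>2))"
proof -
  have "finite S" using S V finite_subset by blast
  then show ?thesis using S
  proof (induction S)
    case (insert k S)
    define g where "g = boost l S (\<lambda>_. 0 :: real)"
    define t where "t = tanh l"
    have k: "k \<in> V" and SV: "S \<subseteq> V" using insert by auto
    have t: "0 \<le> t" "t \<le> l" using l tanh_le_self by (auto simp: t_def)
    have sum: "(\<Sum>j\<in>S. c j k) \<le> sus"
      using sum_c_le[OF k SV] by (simp add: mult.commute)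
    have s0: "0 \<le> sus" using sum_c_le[OF k, of "{}"] by simp
    have "mean V J g (\<lambda>x. x k) \<le> t * (\<Sum>j\<in>S. c j k)"
      using spin_boost_le[OF k SV l(1)] by (simp add: g_def t_def)
    also have "\<dots> \<le> l * sus" using t sum s0 by (intro mult_mono sum_nonneg c_nonneg) (use k SV in auto)
    finally have "t * mean V J g (\<lambda>x. x k) \<le> l * (l * sus)"
      using t l spin_nonneg[OF k, of g] by (intro mult_mono) (auto simp: g_def boost_nonneg)
    then have "1 + t * mean V J g (\<lambda>x. x k) \<le> exp (sus * l\<^sup>2)"
    proof -
      have "l * (l * sus) = sus * l\<^sup>2" by (simp add: power2_eq_square)
      then show ?thesis
        using exp_ge_add_one_self[of "sus * l\<^sup>2"] \<open>t * mean V J g (\<lambda>x. x k) \<le> l * (l * sus)\<close> by linarith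
    qed
    moreover have nn: "0 \<le> 1 + t * mean V J g (\<lambda>x. x k)"
      using t l spin_nonneg[OF k, of g] by (auto simp: g_def boost_nonneg)
    ultimately have "cosh l * (1 + t * mean V J g (\<lambda>x. x k)) \<le> exp (l\<^sup>2) * exp (sus * l\<^sup>2)"
      using cosh_le_exp_square[OF l] by (intro mult_mono) auto
    also have "\<dots> = exp ((1 + sus) * l\<^sup>2)" by (simp add: exp_add[symmetric] algebra_simps)
    finally have 1: "cosh l * (1 + t * mean V J g (\<lambda>x. x k)) \<le> exp ((1 + sus) * l\<^sup>2)" .
    have "zsum V J (boost l (insert k S) (\<lambda>_. 0)) = zsum V J g * (cosh l * (1 + t * mean V J g (\<lambda>x. x k)))"
      unfolding boost_insert[OF insert.hyps(2)] zsum_boost[OF V k] by (simp add: g_def t_def mult_ac)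
    also have "\<dots> \<le> (zsum V J (\<lambda>_. 0) * exp (real (card S) * ((1 + sus) * l\<^sup>2))) * exp ((1 + sus) * l\<^sup>2)"
      using insert 1 nn zsum_pos[OF V] by (intro mult_mono) (auto simp: g_def less_imp_le)
    also have "\<dots> = zsum V J (\<lambda>_. 0) * exp (real (card (insert k S)) * ((1 + sus) * l\<^sup>2))"
      using insert.hyps by (simp add: mult.assoc exp_add[symmetric] algebra_simps)
    finally show ?case .
  qed simp
qed

lemma chernoff:
  assumes S: "S \<subseteq> V" and l: "0 \<le> l" "l \<le> 1"
  shows "mean V J (\<lambda>_. 0) (\<lambda>x. of_bool (a \<le> (\<Sum>i\<in>S. x i)))
    \<le> exp (real (card S) * ((1 + sus) * l\<^sup>2) - l * a)"
proof -
  have "mean V J (\<lambda>_. 0) (\<lambda>x. of_bool (a \<le> (\<Sum>i\<in>S. x i))) \<le> mean V J (\<lambda>_. 0) (\<lambda>x. exp (- l * a) * exp (l * (\<Sum>i\<in>S. x i)))"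
  proof (rule mean_le[OF V])
    fix x
    have "1 \<le> exp (- l * a) * exp (l * (\<Sum>i\<in>S. x i))" if "a \<le> (\<Sum>i\<in>S. x i)"
      using mult_left_mono[OF that l(1)] by (simp add: exp_add[symmetric])
    then show "of_bool (a \<le> (\<Sum>i\<in>S. x i)) \<le> exp (- l * a) * exp (l * (\<Sum>i\<in>S. x i))"
      by auto
  qed
  also have "\<dots> = exp (- l * a) * (zsum V J (boost l S (\<lambda>_. 0)) / zsum V J (\<lambda>_. 0))"
    unfolding mean_scale mean_def wsum_def energy_boost[OF V S] exp_add by (simp add: mult.commute)
  also have "\<dots> \<le> exp (- l * a) * exp (real (card S) * ((1 + sus) * l\<^sup>2))"
    using exponential_moment_le[OF S l] zsum_pos[OF V, of J "\<lambda>_. 0"]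
    by (intro mult_left_mono) (auto simp: field_simps)
  finally show ?thesis by (simp add: exp_add[symmetric])
qed

text \<open>In any nonnegative field the variance of a block sum is at most the double sum of
  zero-field correlations, hence at most \<open>card S * sus\<close>.\<close>

lemma chebyshev:
  assumes S: "S \<subseteq> V" and h: "\<And>k. k \<in> V \<Longrightarrow> 0 \<le> h k"
    and g: "0 < g" "a + g \<le> (\<Sum>i\<in>S. mean V J h (\<lambda>x. x i))"
  shows "mean V J h (\<lambda>x. of_bool ((\<Sum>i\<in>S. x i) < a)) \<le> real (card S) * sus / g\<^sup>2"
proof -
  define m where "m = (\<Sum>i\<in>S. mean V J h (\<lambda>x. x i))"
  have sq: "(\<Sum>i\<in>S. x i) * (\<Sum>i\<in>S. x i) = (\<Sum>i\<in>S. \<Sum>j\<in>S. x i * x j)" for x :: "'a \<Rightarrow> real"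
    by (simp add: sum_product)
  have "mean V J h (\<lambda>x. of_bool ((\<Sum>i\<in>S. x i) < a)) \<le> mean V J h (\<lambda>x. (1 / g\<^sup>2) *
     ((\<Sum>i\<in>S. \<Sum>j\<in>S. x i * x j) + ((- 2 * m) * (\<Sum>i\<in>S. x i) + m\<^sup>2)))"
  proof (rule mean_le[OF V])
    fix x
    have e: "(\<Sum>i\<in>S. \<Sum>j\<in>S. x i * x j) + ((- 2 * m) * (\<Sum>i\<in>S. x i) + m\<^sup>2) = (m - (\<Sum>i\<in>S. x i))\<^sup>2"
      unfolding sq[symmetric] by (simp add: power2_eq_square algebra_simps)
    have "g\<^sup>2 \<le> (m - (\<Sum>i\<in>S. x i))\<^sup>2" if "(\<Sum>i\<in>S. x i) < a"
      using g that unfolding m_def[symmetric] by (intro power_mono) auto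
    then show "of_bool ((\<Sum>i\<in>S. x i) < a) \<le> (1 / g\<^sup>2) * ((\<Sum>i\<in>S. \<Sum>j\<in>S. x i * x j) + ((- 2 * m) * (\<Sum>i\<in>S. x i) + m\<^sup>2))"
      unfolding e using g by (auto simp: field_simps)
  qed
  also have "\<dots> = (1 / g\<^sup>2) * ((\<Sum>i\<in>S. \<Sum>j\<in>S. mean V J h (\<lambda>x. x i * x j)) + ((- 2 * m) * m + m\<^sup>2))"
    unfolding mean_scale mean_add mean_sum mean_const[OF V] m_def ..
  also have "\<dots> = (1 / g\<^sup>2) * (\<Sum>i\<in>S. \<Sum>j\<in>S. mean V J h (\<lambda>x. x i * x j) - mean V J h (\<lambda>x. x i) * mean V J h (\<lambda>x. x j))"
  proof -
    have "m\<^sup>2 = (\<Sum>i\<in>S. \<Sum>j\<in>S. mean V J h (\<lambda>x. x i) * mean V J h (\<lambda>x. x j))"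
      by (simp add: m_def power2_eq_square sum_product)
    then show ?thesis by (simp add: sum_subtractf power2_eq_square)
  qed
  also have "\<dots> \<le> (1 / g\<^sup>2) * (\<Sum>i\<in>S. \<Sum>j\<in>S. c i j)"
  proof (intro mult_left_mono sum_mono)
    fix i j assume "i \<in> S" "j \<in> S"
    then have "i \<in> V" "j \<in> V" using S by auto
    from cov_le[OF this, of h] h
    show "mean V J h (\<lambda>x. x i * x j) - mean V J h (\<lambda>x. x i) * mean V J h (\<lambda>x. x j) \<le> c i j"
      by simp
  qed simp
  also have "\<dots> \<le> (1 / g\<^sup>2) * (real (card S) * sus)"
    by (intro mult_left_mono sum_sum_c_le S) simp
  finally show ?thesis by simp
qed

text \<open>Griffiths comparison with a single uncoupled spin in the field A.\<close>

lemma tanh_le_mean: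
  assumes i: "i \<in> V" and h: "\<And>k. k \<in> V \<Longrightarrow> 0 \<le> h k" and A: "0 \<le> A" "A \<le> h i"
  shows "tanh A \<le> mean V J h (\<lambda>x. x i)"
proof -
  let ?O = "\<lambda>_ _. 0 :: real"
  have "wsum V ?O (\<lambda>_. 0) (\<lambda>x. x i) = 0"
    using i by (intro wsum_odd_zero) (simp add: flip_def)
  then have 0: "mean V ?O (\<lambda>_. 0) (\<lambda>x. x i) = 0" by (simp add: mean_def)
  have "wsum V ?O (\<lambda>_. 0) (\<lambda>x. x i * x i) = zsum V ?O (\<lambda>_. 0)"
    by (intro wsum_cong) (simp_all add: spins_sq i)
  then have 1: "mean V ?O (\<lambda>_. 0) (\<lambda>x. x i * x i) = 1"
    using zsum_pos[OF V, of ?O "\<lambda>_. 0"] by (simp add: mean_def)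
  have "tanh A = mean V ?O (boost A {i} (\<lambda>_. 0)) (\<lambda>x. x i)"
    unfolding mean_boost[OF V i] by (simp add: 0 1)
  also have "\<dots> \<le> mean V J h (\<lambda>x. x i)"
    using J h A i by (intro mean_mono V ferro_spin) (auto simp: boost_def)
  finally show ?thesis .
qed

text \<open>The likelihood ratio of the uniform mixture over the family \<open>S\<close> is close to \<open>1\<close> in mean square.\<close>

lemma second_moment:
  fixes S :: "'k \<Rightarrow> 'a set" and T :: "('a \<Rightarrow> real) \<Rightarrow> bool"
  assumes I: "finite I" "I \<noteq> {}" and S: "\<And>k. k \<in> I \<Longrightarrow> S k \<subseteq> V"
    and card: "\<And>k. k \<in> I \<Longrightarrow> real (card (S k)) \<le> s"
    and mult: "\<And>j. j \<in> V \<Longrightarrow> real (card {k\<in>I. j \<in> S k}) \<le> s"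
    and A: "0 \<le> A" and e: "0 < e" and sus0: "0 \<le> sus" and B: "(tanh A)\<^sup>2 * (s * sus) \<le> B" and s: "0 \<le> s"
  shows "1 - e / 2 - exp B * B * s / (real (card I) * (2 * e))
    \<le> mean V J (\<lambda>_. 0) (\<lambda>x. of_bool (T x)) +
      (\<Sum>k\<in>I. mean V J (boost A (S k) (\<lambda>_. 0)) (\<lambda>x. of_bool (\<not> T x))) / real (card I)"
proof -
  define N where "N = real (card I)"
  have N: "0 < N" using I by (simp add: N_def card_gt_0_iff)
  define t where "t = (tanh A)\<^sup>2"
  have t: "0 \<le> t" by (simp add: t_def)
  define Z where "Z h = zsum V J h" for h
  have Z: "0 < Z h" for h unfolding Z_def by (rule zsum_pos[OF V])
  define b where "b k = boost A (S k) (\<lambda>_. 0 :: real)" for k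
  define R where "R k x = Z (\<lambda>_. 0) / Z (b k) * exp (A * (\<Sum>i\<in>S k. x i))" for k and x :: "'a \<Rightarrow> real"
  define E where "E = mean V J (\<lambda>_. 0)"
  have meanb: "mean V J (b k) f = E (\<lambda>x. R k x * f x)" if "k \<in> I" for k f
  proof -
    have "wsum V J (b k) f = wsum V J (\<lambda>_. 0) (\<lambda>x. exp (A * (\<Sum>i\<in>S k. x i)) * f x)"
      unfolding wsum_def b_def energy_boost[OF V S[OF that]] exp_add by (simp add: mult_ac)
    then have "wsum V J (b k) f * (Z (\<lambda>_. 0) / Z (b k)) = wsum V J (\<lambda>_. 0) (\<lambda>x. R k x * f x)"
      unfolding R_def mult.assoc wsum_scale by simp
    then show ?thesis using Z[of "\<lambda>_. 0"] Z[of "b k"]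
      by (simp add: mean_def E_def Z_def field_simps)
  qed
  define x where "x k l = t * (\<Sum>i\<in>S k. \<Sum>j\<in>S l. c i j)" for k l
  \<comment> \<open>The mixed moment of two likelihood ratios is a ratio of four partition
    functions; where the blocks overlap the two tilts add.\<close>
  have RR: "E (\<lambda>y. R k y * R l y) \<le> exp (x k l)" if k: "k \<in> I" and l: "l \<in> I" for k l
  proof -
    have "wsum V J (\<lambda>_. 0) (\<lambda>y. R k y * R l y) = (Z (\<lambda>_. 0) / Z (b k)) * (Z (\<lambda>_. 0) / Z (b l)) * Z (boost A (S k) (b l))"
      unfolding wsum_def Z_def R_def b_def energy_boost[OF V S[OF k]] energy_boost[OF V S[OF l]] exp_add
        sum_distrib_left by (intro sum.cong refl) (simp add: mult_ac)
    then have "E (\<lambda>y. R k y * R l y) = Z (boost A (S k) (b l)) * Z (\<lambda>_. 0) / (Z (b k) * Z (b l))"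
      using Z[of "\<lambda>_. 0"] Z[of "b k"] Z[of "b l"] by (simp add: E_def mean_def Z_def field_simps)
    also have "\<dots> \<le> exp (x k l)"
      using zsum_boost_sets[OF S[OF k] S[OF l], of "\<lambda>_. 0" A] A Z[of "b k"] Z[of "b l"]
      by (simp add: Z_def b_def x_def t_def pos_divide_le_eq mult_ac)
    finally show ?thesis .
  qed
  have x0: "0 \<le> x k l" if "k \<in> I" "l \<in> I" for k l
    unfolding x_def using t S[OF that(1)] S[OF that(2)] by (intro mult_nonneg_nonneg sum_nonneg c_nonneg) auto
  have xB: "x k l \<le> B" if k: "k \<in> I" and l: "l \<in> I" for k l
  proof -
    have "(\<Sum>i\<in>S k. \<Sum>j\<in>S l. c i j) \<le> real (card (S k)) * sus" by (rule sum_sum_c_le[OF S[OF k] S[OF l]])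
    also have "\<dots> \<le> s * sus" using card[OF k] sus0 by (intro mult_right_mono)
    finally have "x k l \<le> t * (s * sus)" unfolding x_def using t by (intro mult_left_mono)
    then show ?thesis using B by (simp add: t_def)
  qed
  \<comment> \<open>A site lies in at most s blocks, so for fixed k the sum over all blocks costs a
    factor s and not the number of blocks. This makes the error of order s / N.\<close>
  have sumx: "(\<Sum>k\<in>I. \<Sum>l\<in>I. x k l) \<le> N * (B * s)"
  proof -
    have "(\<Sum>l\<in>I. x k l) \<le> B * s" if k: "k \<in> I" for k
    proof -
      have "(\<Sum>l\<in>I. \<Sum>i\<in>S k. \<Sum>j\<in>S l. c i j) = (\<Sum>i\<in>S k. \<Sum>l\<in>I. \<Sum>j\<in>V. of_bool (j \<in> S l) * c i j)"
      proof (subst sum.swap, rule sum.cong[OF refl], rule sum.cong[OF refl])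
        fix i l assume "l \<in> I"
        then show "(\<Sum>j\<in>S l. c i j) = (\<Sum>j\<in>V. of_bool (j \<in> S l) * c i j)"
          by (intro sum.mono_neutral_cong_left) (use V S in auto)
      qed
      also have "\<dots> = (\<Sum>i\<in>S k. \<Sum>j\<in>V. c i j * real (card {l\<in>I. j \<in> S l}))"
      proof (intro sum.cong refl)
        fix i
        have "(\<Sum>l\<in>I. \<Sum>j\<in>V. of_bool (j \<in> S l) * c i j) = (\<Sum>j\<in>V. \<Sum>l\<in>I. of_bool (j \<in> S l) * c i j)"
          by (rule sum.swap)
        also have "\<dots> = (\<Sum>j\<in>V. c i j * real (card {l\<in>I. j \<in> S l}))"
          using I by (intro sum.cong refl) (simp add: sum_distrib_right[symmetric] Int_def mult.commute)
        finally show "(\<Sum>l\<in>I. \<Sum>j\<in>V. of_bool (j \<in> S l) * c i j) = (\<Sum>j\<in>V. c i j * real (card {l\<in>I. j \<in> S l}))" .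
      qed
      also have "\<dots> \<le> (\<Sum>i\<in>S k. \<Sum>j\<in>V. c i j * s)"
        using S[OF k] by (intro sum_mono mult_left_mono mult c_nonneg) auto
      also have "\<dots> = (\<Sum>i\<in>S k. \<Sum>j\<in>V. c i j) * s" by (simp add: sum_distrib_right)
      also have "\<dots> \<le> (real (card (S k)) * sus) * s"
        using s by (intro mult_right_mono sum_sum_c_le[OF S[OF k]]) auto
      also have "\<dots> \<le> (s * sus) * s"
        using card[OF k] sus0 s by (intro mult_right_mono) auto
      finally have "(\<Sum>l\<in>I. x k l) \<le> t * ((s * sus) * s)"
        unfolding x_def sum_distrib_left[symmetric] using t by (intro mult_left_mono)
      also have "\<dots> \<le> B * s" using B s mult_right_mono[OF B s] by (simp add: t_def mult_ac)
      finally show ?thesis .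
    qed
    then have "(\<Sum>k\<in>I. \<Sum>l\<in>I. x k l) \<le> (\<Sum>k\<in>I. B * s)" by (rule sum_mono)
    then show ?thesis by (simp add: N_def)
  qed
  \<comment> \<open>Linearising the exponential on the range of the exponents, so that only their
    sum matters.\<close>
  have exp1: "exp u - 1 \<le> u * exp B" if "0 \<le> u" "u \<le> B" for u
  proof -
    have "(1 + - u) * exp u \<le> exp (- u) * exp u"
      by (intro mult_right_mono exp_ge_add_one_self) simp
    then have "exp u - 1 \<le> u * exp u" by (simp add: exp_minus algebra_simps)
    also have "\<dots> \<le> u * exp B" using that by (intro mult_left_mono) auto
    finally show ?thesis .
  qed
  define Q where "Q y = (\<Sum>k\<in>I. R k y) / N" for y
  have ER: "E (R k) = 1" if "k \<in> I" for k
    using meanb[OF that, of "\<lambda>_. 1"] by (simp add: mean_const[OF V])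
  have Escale: "E (\<lambda>y. a * f y) = a * E f" and Eadd: "E (\<lambda>y. f y + g y) = E f + E g"
    and Esum: "E (\<lambda>y. \<Sum>k\<in>K. f' k y) = (\<Sum>k\<in>K. E (f' k))"
    and Econst: "E (\<lambda>_. a) = a" for a f g K and f' :: "'k \<Rightarrow> ('a \<Rightarrow> real) \<Rightarrow> real"
    by (simp_all add: E_def mean_scale mean_add mean_sum mean_const[OF V])
  have EQ: "E Q = 1"
  proof -
    have "E Q = (1 / N) * (\<Sum>k\<in>I. E (R k))"
      unfolding Q_def[abs_def] using Escale[of "1 / N" "\<lambda>y. \<Sum>k\<in>I. R k y"] by (simp add: Esum)
    then show ?thesis using N by (simp add: ER N_def)
  qed
  have EQQ: "E (\<lambda>y. Q y * Q y) \<le> 1 + exp B * B * s / N"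
  proof -
    have "E (\<lambda>y. Q y * Q y) = E (\<lambda>y. (1 / (N * N)) * (\<Sum>k\<in>I. \<Sum>l\<in>I. R k y * R l y))"
      by (simp add: Q_def sum_product)
    also have "\<dots> = (1 / (N * N)) * (\<Sum>k\<in>I. \<Sum>l\<in>I. E (\<lambda>y. R k y * R l y))"
      unfolding Escale Esum ..
    also have "\<dots> \<le> (1 / (N * N)) * (\<Sum>k\<in>I. \<Sum>l\<in>I. 1 + x k l * exp B)"
    proof (intro mult_left_mono sum_mono)
      fix k l assume kl: "k \<in> I" "l \<in> I"
      show "E (\<lambda>y. R k y * R l y) \<le> 1 + x k l * exp B"
        using RR[OF kl] exp1[OF x0[OF kl] xB[OF kl]] by linarith
    qed simp
    also have "\<dots> = (1 / (N * N)) * (N * N + (\<Sum>k\<in>I. \<Sum>l\<in>I. x k l) * exp B)"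
      by (simp add: sum.distrib N_def sum_distrib_right)
    also have "\<dots> \<le> (1 / (N * N)) * (N * N + (N * (B * s)) * exp B)"
      using N sumx by (intro mult_left_mono add_left_mono mult_right_mono) auto
    also have "\<dots> = 1 + exp B * B * s / N" using N by (simp add: field_simps)
    finally show ?thesis .
  qed
  have "1 - e / 2 - exp B * B * s / (N * (2 * e)) \<le> 1 - e / 2 - (E (\<lambda>y. Q y * Q y) - 1) / (2 * e)"
  proof -
    have "(E (\<lambda>y. Q y * Q y) - 1) / (2 * e) \<le> (exp B * B * s / N) / (2 * e)"
      using EQQ e by (intro divide_right_mono) auto
    then show ?thesis by simp
  qed
  also have "\<dots> = E (\<lambda>y. (1 - e / 2 - 1 / (2 * e)) + ((1 / e) * Q y + (- 1 / (2 * e)) * (Q y * Q y)))"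
    unfolding Eadd Escale Econst EQ using e by (simp add: field_simps)
  also have "\<dots> \<le> E (\<lambda>y. of_bool (T y) + Q y * of_bool (\<not> T y))"
    unfolding E_def
  proof (rule mean_le[OF V])
    fix y
    \<comment> \<open>The bound \<open>\<bar>1 - Q y\<bar> \<le> e / 2 + (1 - Q y)\<^sup>2 / (2 *
      e)\<close> stands in for Cauchy--Schwarz and keeps everything linear in means.\<close>
    have "0 \<le> (e - \<bar>1 - Q y\<bar>)\<^sup>2 / (2 * e)" using e by simp
    also have "\<dots> = e / 2 - \<bar>1 - Q y\<bar> + (1 - Q y)\<^sup>2 / (2 * e)"
      using e by (simp add: power2_diff field_simps power2_eq_square)
    finally have "1 - e / 2 - (1 - Q y)\<^sup>2 / (2 * e) \<le> 1 - \<bar>1 - Q y\<bar>" by simp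
    also have "\<dots> \<le> of_bool (T y) + Q y * of_bool (\<not> T y)" by (cases "T y") auto
    also have "1 - e / 2 - (1 - Q y)\<^sup>2 / (2 * e) = (1 - e / 2 - 1 / (2 * e)) + ((1 / e) * Q y + (- 1 / (2 * e)) * (Q y * Q y))"
      using e by (simp add: power2_eq_square field_simps)
    finally show "(1 - e / 2 - 1 / (2 * e)) + ((1 / e) * Q y + (- 1 / (2 * e)) * (Q y * Q y))
        \<le> of_bool (T y) + Q y * of_bool (\<not> T y)" .
  qed
  also have "\<dots> = E (\<lambda>y. of_bool (T y)) + (\<Sum>k\<in>I. mean V J (b k) (\<lambda>y. of_bool (\<not> T y))) / N"
  proof -
    have "E (\<lambda>y. Q y * of_bool (\<not> T y)) = E (\<lambda>y. (1 / N) * (\<Sum>k\<in>I. R k y * of_bool (\<not> T y)))"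
      by (simp add: Q_def sum_distrib_right)
    also have "\<dots> = (\<Sum>k\<in>I. mean V J (b k) (\<lambda>y. of_bool (\<not> T y))) / N"
      unfolding Escale Esum by (simp add: meanb cong: sum.cong)
    finally show ?thesis by (simp add: Eadd)
  qed
  finally show ?thesis by (simp add: E_def b_def N_def)
qed

end

section \<open>The testing problem\<close>

definition block :: "nat \<Rightarrow> nat \<Rightarrow> (nat \<Rightarrow> int) \<Rightarrow> (nat \<Rightarrow> int) set" where
  "block d l a = (\<Pi>\<^sub>E k\<in>{..<d}. {a k..a k + int l})"

definition corners :: "nat \<Rightarrow> nat \<Rightarrow> nat \<Rightarrow> (nat \<Rightarrow> int) set" where
  "corners d r l = ({..<d} \<rightarrow>\<^sub>E {- int r..int r - int l})"

definition side :: "nat \<Rightarrow> nat \<Rightarrow> nat" where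
  "side d s = nat \<lceil>root d (real s)\<rceil>"

definition radius :: "nat \<Rightarrow> nat \<Rightarrow> nat" where
  "radius d n = nat \<lfloor>root d (real n)\<rfloor>"

lemma card_block: "card (block d l a) = (l + 1) ^ d"
proof -
  have "card {a k..a k + int l} = l + 1" for k by simp
  then show ?thesis
    unfolding block_def using card_PiE[of "{..<d}" "\<lambda>k. {a k..a k + int l}"] by simp
qed

lemma block_subset_cube:
  assumes "a \<in> corners d r l" shows "block d l a \<subseteq> cube d r"
  unfolding block_def cube_def
proof (rule PiE_mono)
  fix k assume "k \<in> {..<d}"
  then have "a k \<in> {- int r..int r - int l}" using assms by (auto simp: corners_def PiE_iff)
  then show "{a k..a k + int l} \<subseteq> {- int r..int r}" by simp
qed

lemma corners_subset_cube: "corners d r l \<subseteq> cube d r"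
  unfolding corners_def cube_def by (intro PiE_mono) auto

lemma finite_corners: "finite (corners d r l)"
  by (rule finite_subset[OF corners_subset_cube finite_cube])

lemma card_corners:
  assumes "l \<le> 2 * r + 1" shows "card (corners d r l) = (2 * r + 1 - l) ^ d"
proof -
  have "card {- int r..int r - int l} = 2 * r + 1 - l" using assms by simp
  then show ?thesis
    unfolding corners_def using card_PiE[of "{..<d}" "\<lambda>_. {- int r..int r - int l}"] by simp
qed

text \<open>The corner of a block containing j lies at most l below j in each coordinate.\<close>

lemma card_block_containing_le: "card {a\<in>corners d r l. j \<in> block d l a} \<le> (l + 1) ^ d"
proof -
  have "{a\<in>corners d r l. j \<in> block d l a} \<subseteq> block d l (\<lambda>k. j k - int l)"
  proof
    fix a assume a: "a \<in> {a\<in>corners d r l. j \<in> block d l a}"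
    show "a \<in> block d l (\<lambda>k. j k - int l)"
      unfolding block_def
    proof (rule PiE_I)
      fix k assume k: "k \<in> {..<d}"
      have "j \<in> (\<Pi>\<^sub>E k\<in>{..<d}. {a k..a k + int l})" using a by (simp add: block_def)
      from PiE_mem[OF this k] show "a k \<in> {j k - int l..j k - int l + int l}" by simp
    next
      fix k assume "k \<notin> {..<d}"
      then show "a k = undefined" using a PiE_arb[of a "{..<d}"] by (auto simp: corners_def)
    qed
  qed
  then have "card {a\<in>corners d r l. j \<in> block d l a} \<le> card (block d l (\<lambda>k. j k - int l))"
    by (rule card_mono[rotated]) (auto simp: block_def intro: finite_PiE)
  then show ?thesis by (simp add: card_block)
qed

lemma cubes_eq:
  assumes d: "1 \<le> d"
  shows "cubes d n s = block d (side d s) ` corners d (radius d n) (side d s)"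
proof -
  let ?l = "side d s" and ?r = "radius d n"
  have "0 \<le> root d (real s)" by (simp add: real_root_ge_zero)
  then have "- 1 < root d (real s)" by linarith
  then have l: "\<lceil>root d (real s)\<rceil> = int ?l"
    by (simp add: side_def)
  have box: "box d n = cube d ?r" using box_eq_cube[OF d] by (simp add: radius_def)
  show ?thesis
  proof (intro equalityI subsetI)
    fix S assume "S \<in> cubes d n s"
    then obtain a b where S: "S \<subseteq> cube d ?r" "\<And>j. j < d \<Longrightarrow> b j - a j = int ?l"
      "S = (\<Pi>\<^sub>E j\<in>{..<d}. {a j..b j})"
      unfolding cubes_def box l by auto
    define a' where "a' = restrict a {..<d}"
    have b: "b j = a j + int ?l" if "j < d" for j using S(2)[OF that] by simp
    have Sb: "S = block d ?l a'"
      unfolding S(3) block_def by (intro PiE_cong) (simp add: b a'_def)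
    \<comment> \<open>The two extreme corners belong to the block; that they lie in the cube bounds
      a from below and from above.\<close>
    have "a' \<in> S" "(\<lambda>j\<in>{..<d}. a j + int ?l) \<in> S"
      unfolding Sb block_def by (auto simp: a'_def)
    then have "a' \<in> cube d ?r" "(\<lambda>j\<in>{..<d}. a j + int ?l) \<in> cube d ?r" using S(1) by auto
    then have "a' \<in> corners d ?r ?l" unfolding cube_def corners_def by (force simp: PiE_iff a'_def)
    then show "S \<in> block d ?l ` corners d ?r ?l" using Sb by blast
  next
    fix S assume "S \<in> block d ?l ` corners d ?r ?l"
    then obtain a where a: "a \<in> corners d ?r ?l" "S = block d ?l a" by blast
    show "S \<in> cubes d n s"
      unfolding cubes_def box l a(2)
    proof (intro CollectI conjI)
      show "\<exists>a' b. (\<forall>j<d. b j - a' j = int ?l) \<and> block d ?l a = (\<Pi>\<^sub>E j\<in>{..<d}. {a' j..b j})"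
        by (rule exI[of _ a], rule exI[of _ "\<lambda>k. a k + int ?l"]) (simp add: block_def)
    qed (rule block_subset_cube[OF a(1)])
  qed
qed

lemma root_pow: "1 \<le> d \<Longrightarrow> root d (real n) ^ d = real n"
  by (simp add: real_root_pow_pos2)

text \<open>A block has \<open>side + 1\<close> points per direction, and with \<rho> the root of s
  one has side + 1 \<le> \<rho> + 2 \<le> 3\<rho>, since \<rho> is at least 1.\<close>

lemma block_size:
  assumes d: "1 \<le> d" and s: "0 < s"
  shows "real s \<le> real ((side d s + 1) ^ d)" "real ((side d s + 1) ^ d) \<le> 3 ^ d * real s"
proof -
  define \<rho> where "\<rho> = root d (real s)"
  have \<rho>: "1 \<le> \<rho>" using d s by (simp add: \<rho>_def)
  have l: "\<rho> \<le> real (side d s)" "real (side d s) \<le> \<rho> + 1"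
    using \<rho> by (simp_all add: side_def \<rho>_def[symmetric] of_nat_nat)
  have "\<rho> ^ d \<le> (real (side d s) + 1) ^ d" using \<rho> l by (intro power_mono) auto
  then show "real s \<le> real ((side d s + 1) ^ d)" by (simp add: \<rho>_def root_pow[OF d] add.commute)
  have "(real (side d s) + 1) ^ d \<le> (3 * \<rho>) ^ d" using \<rho> l by (intro power_mono) auto
  then show "real ((side d s + 1) ^ d) \<le> 3 ^ d * real s"
    by (simp add: \<rho>_def power_mult_distrib root_pow[OF d] add.commute)
qed

lemma radius_bounds:
  assumes d: "1 \<le> d" and n: "0 < n"
  shows "1 \<le> radius d n" "real (radius d n) \<le> root d (real n)" "root d (real n) < real (radius d n) + 1"
proof -
  define \<rho> where "\<rho> = root d (real n)"
  have \<rho>: "1 \<le> \<rho>" using d n by (simp add: \<rho>_def)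
  then have "1 \<le> \<lfloor>\<rho>\<rfloor>" by simp
  then show "1 \<le> radius d n" "real (radius d n) \<le> root d (real n)" "root d (real n) < real (radius d n) + 1"
    unfolding radius_def \<rho>_def[symmetric] by (simp_all add: of_nat_nat) linarith
qed

text \<open>As s is at most n, the side is at most r + 1, which leaves at least r corners per
  direction, while the root of n is below r + 1 \<le> 2r.\<close>

lemma card_corners_ge:
  assumes d: "1 \<le> d" and s: "0 < s" "s \<le> n"
  shows "real n \<le> 2 ^ d * real (card (corners d (radius d n) (side d s)))"
proof -
  let ?r = "radius d n" and ?l = "side d s"
  have n: "0 < n" using s by simp
  note r = radius_bounds[OF d n]
  have "root d (real s) \<le> root d (real n)" using d s by simp
  then have "root d (real s) \<le> real (?r + 1)" using r by simp
  then have "\<lceil>root d (real s)\<rceil> \<le> int (?r + 1)" by (simp add: ceiling_le_iff)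
  then have l: "?l \<le> ?r + 1" unfolding side_def nat_le_iff .
  have "root d (real n) \<le> real (2 * ?r)" using r by simp
  also have "\<dots> \<le> real (2 * (2 * ?r + 1 - ?l))" using l by (intro of_nat_mono) simp
  finally have "root d (real n) ^ d \<le> (real (2 * (2 * ?r + 1 - ?l))) ^ d"
    using d by (intro power_mono) auto
  then have "real n \<le> 2 ^ d * real ((2 * ?r + 1 - ?l) ^ d)"
    by (simp add: root_pow[OF d] power_mult_distrib del: of_nat_diff)
  moreover have "card (corners d ?r ?l) = (2 * ?r + 1 - ?l) ^ d"
    using l r by (intro card_corners) simp
  ultimately show ?thesis by simp
qed

lemma card_cube_radius_le:
  assumes d: "1 \<le> d" and n: "0 < n"
  shows "real (card (cube d (radius d n))) \<le> 3 ^ d * real n"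
proof -
  note r = radius_bounds[OF d n]
  have "(2 * real (radius d n) + 1) ^ d \<le> (3 * root d (real n)) ^ d"
    using r by (intro power_mono) auto
  then show ?thesis by (simp add: card_cube power_mult_distrib root_pow[OF d] add.commute)
qed

lemma prob_lattice_ising:
  "measure_pmf.prob (lattice_ising d L \<beta> n \<mu>) {X. T X}
    = mean (box d n) (lat d L \<beta>) \<mu> (\<lambda>x. of_bool (T x))"
proof -
  have "measure_pmf.prob (lattice_ising d L \<beta> n \<mu>) {X. T X}
      = measure_pmf.expectation (lattice_ising d L \<beta> n \<mu>) (indicator {X. T X})"
    by simp
  also have "\<dots> = mean (box d n) (lat d L \<beta>) \<mu> (indicator {X. T X})"
    unfolding lattice_ising_def expectation_ising[OF finite_box] lat_def[abs_def] ..
  also have "(indicator {X. T X} :: _ \<Rightarrow> real) = (\<lambda>x. of_bool (T x))"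
    by (auto simp: indicator_def)
  finally show ?thesis .
qed

lemma bdd_above_prob:
  "bdd_above ((\<lambda>\<mu>. measure_pmf.prob (P \<mu>) (B \<mu>)) ` M)"
  by (intro bdd_aboveI[of _ 1]) auto

text \<open>Subcriticality enters the testing problem in this form only: one susceptibility bound
  for all cubes.\<close>

locale high_temperature =
  fixes d L :: nat and \<beta> sus :: real
  assumes d: "1 \<le> d" and \<beta>: "0 \<le> \<beta>" and sus_pos: "0 < sus"
    and sus: "\<And>r p. p \<in> cube d r \<Longrightarrow> (\<Sum>z\<in>cube d r. corr (cube d r) (lat d L \<beta>) p z) \<le> sus"
begin

sublocale model: bounded_susceptibility "cube d r" "lat d L \<beta>" sus for r
  by unfold_locales (use finite_cube lat_nonneg[OF \<beta>] sus in auto)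

lemma box_eq: "box d n = cube d (radius d n)"
  using box_eq_cube[OF d] by (simp add: radius_def)

text \<open>The restriction matches the extensional signals in \<open>alternatives\<close>; the law
  is not affected by it.\<close>

definition spike :: "nat \<Rightarrow> real \<Rightarrow> (nat \<Rightarrow> int) set \<Rightarrow> (nat \<Rightarrow> int) \<Rightarrow> real" where
  "spike n A S = restrict (boost A S (\<lambda>_. 0)) (box d n)"

lemma spike_alternative:
  assumes "S \<in> cubes d n s" "0 < A"
  shows "spike n A S \<in> alternatives (box d n) (cubes d n s) A"
proof -
  have "S \<subseteq> box d n" using assms by (simp add: cubes_def)
  then have "supp (box d n) (spike n A S) = S"
    using assms by (auto simp: supp_def spike_def boost_def)
  then show ?thesis
    using assms by (auto simp: alternatives_def spike_def boost_def supp_def)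
qed

lemma mean_spike:
  "mean (box d n) J (spike n A S) f = mean (box d n) J (boost A S (\<lambda>_. 0)) f"
  unfolding mean_def by (intro arg_cong2[where f = "(/)"] wsum_cong) (simp_all add: spike_def)

text \<open>The worst case over signals is at least the average over all positions of the block with
  height exactly A. The factors \<open>3 ^ d\<close> and \<open>2 ^ d\<close> come from the size of
  a block and from the number of positions.\<close>

lemma risk_ge:
  assumes s: "0 < s" "s \<le> n" and A: "0 < A" and e: "0 < e"
    and B: "(tanh A)\<^sup>2 * (3 ^ d * real s * sus) \<le> B"
  shows "1 - e / 2 - exp B * B * (3 ^ d * real s) * 2 ^ d / (real n * (2 * e)) \<le> risk d L \<beta> n s A T"
proof -
  let ?r = "radius d n" and ?l = "side d s"
  define I where "I = corners d ?r ?l"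
  define N where "N = real (card I)"
  define \<sigma> where "\<sigma> = 3 ^ d * real s"
  have n: "0 < n" using s by simp
  have nN: "real n \<le> 2 ^ d * N" unfolding N_def I_def by (rule card_corners_ge[OF d s])
  then have N: "0 < N" using n by (metis of_nat_0_less_iff less_le_trans zero_less_mult_pos zero_less_numeral zero_less_power)
  have I: "finite I" "I \<noteq> {}" using N finite_corners by (auto simp: N_def I_def)
  have "0 \<le> (tanh A)\<^sup>2 * (3 ^ d * real s * sus)" using sus_pos by simp
  then have B0: "0 \<le> B" using B by linarith
  define alt where "alt \<mu> = measure_pmf.prob (lattice_ising d L \<beta> n \<mu>) {X. \<not> T X}" for \<mu>
  define err where "err k = mean (cube d ?r) (lat d L \<beta>) (boost A (block d ?l k) (\<lambda>_. 0)) (\<lambda>x. of_bool (\<not> T x))" for k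
  define Sup_alt where "Sup_alt = (SUP \<mu>\<in>alternatives (box d n) (cubes d n s) A. alt \<mu>)"
  have "err k \<le> Sup_alt"
    if k: "k \<in> I" for k
  proof -
    have "block d ?l k \<in> cubes d n s" using k by (simp add: cubes_eq[OF d] I_def)
    then have "alt (spike n A (block d ?l k)) \<le> Sup_alt"
      unfolding Sup_alt_def alt_def by (intro cSUP_upper bdd_above_prob spike_alternative A)
    moreover have "alt (spike n A (block d ?l k))
        = err k"
      by (simp only: alt_def prob_lattice_ising mean_spike) (simp only: box_eq err_def)
    ultimately show ?thesis by simp
  qed
  then have "(\<Sum>k\<in>I. err k)
      \<le> (\<Sum>k\<in>I. Sup_alt)" by (rule sum_mono)
  then have avg: "(\<Sum>k\<in>I. err k) / N
      \<le> Sup_alt" using N by (simp add: N_def pos_divide_le_eq mult.commute)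
  have "1 - e / 2 - exp B * B * \<sigma> / (N * (2 * e)) \<le>
      mean (cube d ?r) (lat d L \<beta>) (\<lambda>_. 0) (\<lambda>x. of_bool (T x)) +
      (\<Sum>k\<in>I. err k) / N"
    unfolding N_def err_def
  proof (rule model.second_moment[OF I])
    show "block d ?l k \<subseteq> cube d ?r" if "k \<in> I" for k
      using that by (auto simp: I_def dest: block_subset_cube)
    show "real (card (block d ?l k)) \<le> \<sigma>" for k
      using block_size(2)[OF d s(1)] by (simp add: card_block \<sigma>_def)
    show "real (card {k \<in> I. j \<in> block d ?l k}) \<le> \<sigma>" for j
      using block_size(2)[OF d s(1)] card_block_containing_le[of d ?r ?l j]
      unfolding \<sigma>_def I_def by (meson of_nat_mono order_trans)
  qed (use A e B sus_pos in \<open>auto simp: \<sigma>_def\<close>)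
  also have "\<dots> \<le> risk d L \<beta> n s A T"
    using avg unfolding risk_def prob_lattice_ising[of d L \<beta> n "\<lambda>_. 0"] box_eq[of n, symmetric]
    by (simp add: Sup_alt_def alt_def)
  finally have 1: "1 - e / 2 - exp B * B * \<sigma> / (N * (2 * e)) \<le> risk d L \<beta> n s A T" .
  have "exp B * B * \<sigma> / (N * (2 * e)) \<le> exp B * B * \<sigma> * 2 ^ d / (real n * (2 * e))"
  proof -
    have "exp B * B * \<sigma> / (N * (2 * e)) = exp B * B * \<sigma> * 2 ^ d / ((2 ^ d * N) * (2 * e))"
      using N e by (simp add: field_simps)
    also have "\<dots> \<le> exp B * B * \<sigma> * 2 ^ d / (real n * (2 * e))"
      using nN n e B0 by (intro divide_left_mono mult_right_mono mult_pos_pos) (auto simp: \<sigma>_def N)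
    finally show ?thesis .
  qed
  then show ?thesis using 1 by (simp add: \<sigma>_def)
qed

text \<open>Threshold: at l = sqrt (ln n / card S) the Chernoff exponent is (1 + sus) ln n - (3 +
  sus) ln n = - 2 ln n. One logarithm pays for the number of positions, the other remains as the
  error probability.\<close>

definition scan :: "nat \<Rightarrow> nat \<Rightarrow> ((nat \<Rightarrow> int) \<Rightarrow> real) \<Rightarrow> bool" where
  "scan n s X \<longleftrightarrow> (\<exists>S\<in>cubes d n s. (3 + sus) * sqrt (real (card S) * ln (real n)) \<le> (\<Sum>i\<in>S. X i))"

lemma risk_scan_le:
  assumes s: "0 < s" "s \<le> n" and n: "1 < n" and ln: "ln (real n) \<le> real s" and A: "0 < A"
    and tanh: "(4 + sus) * sqrt (ln (real n) / real s) \<le> tanh A"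
  shows "risk d L \<beta> n s A (scan n s) \<le> 3 ^ d / real n + sus / ln (real n)"
proof -
  let ?r = "radius d n" and ?l = "side d s"
  define V where "V = cube d ?r"
  define J where "J = lat d L \<beta>"
  define m where "m = real ((?l + 1) ^ d)"
  define \<nu> where "\<nu> = ln (real n)"
  have \<nu>: "0 < \<nu>" using n by (simp add: \<nu>_def)
  have ms: "real s \<le> m" unfolding m_def by (rule block_size(1)[OF d s(1)])
  have m: "0 < m" "\<nu> \<le> m" using s ln ms by (auto simp: \<nu>_def)
  define \<kappa> where "\<kappa> = 3 + sus"
  define a where "a = \<kappa> * sqrt (m * \<nu>)"
  have cub: "finite (cubes d n s)" "real (card (cubes d n s)) \<le> 3 ^ d * real n"
    and cubS: "\<And>S. S \<in> cubes d n s \<Longrightarrow> S \<subseteq> V \<and> real (card S) = m"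
  proof -
    show "finite (cubes d n s)" by (simp add: cubes_eq[OF d] finite_corners)
    have "card (cubes d n s) \<le> card (corners d ?r ?l)"
      unfolding cubes_eq[OF d] by (rule card_image_le[OF finite_corners])
    also have "\<dots> \<le> card (cube d ?r)" by (intro card_mono finite_cube corners_subset_cube)
    finally show "real (card (cubes d n s)) \<le> 3 ^ d * real n"
      using card_cube_radius_le[OF d, of n] n by (meson of_nat_mono order_trans less_trans zero_less_one)
    show "S \<subseteq> V \<and> real (card S) = m" if "S \<in> cubes d n s" for S
      using that subsetD[OF block_subset_cube] by (auto simp: cubes_eq[OF d] V_def m_def card_block)
  qed
  have scan: "scan n s X \<longleftrightarrow> (\<exists>S\<in>cubes d n s. a \<le> (\<Sum>i\<in>S. X i))" for X
    unfolding scan_def using cubS by (auto simp: a_def \<kappa>_def \<nu>_def)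
  have type1: "measure_pmf.prob (lattice_ising d L \<beta> n (\<lambda>_. 0)) {X. scan n s X} \<le> 3 ^ d / real n"
  proof -
    define l where "l = sqrt (\<nu> / m)"
    \<comment> \<open>Here the block must have at least ln n sites: the exponential moment bound is
      for l at most 1.\<close>
    have l: "0 \<le> l" "l \<le> 1" using \<nu> m by (auto simp: l_def)
    have l2: "m * l\<^sup>2 = \<nu>" using \<nu> m by (simp add: l_def)
    have la: "l * a = \<kappa> * \<nu>"
    proof -
      have "l * sqrt (m * \<nu>) = sqrt (\<nu> * \<nu>)" using m by (simp add: l_def real_sqrt_mult[symmetric])
      then show ?thesis using \<nu> by (simp add: a_def)
    qed
    have "mean V J (\<lambda>_. 0) (\<lambda>X. of_bool (scan n s X))
        \<le> mean V J (\<lambda>_. 0) (\<lambda>X. \<Sum>S\<in>cubes d n s. of_bool (a \<le> (\<Sum>i\<in>S. X i)))"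
    proof (rule mean_le)
      fix X :: "(nat \<Rightarrow> int) \<Rightarrow> real"
      show "of_bool (scan n s X) \<le> (\<Sum>S\<in>cubes d n s. of_bool (a \<le> (\<Sum>i\<in>S. X i)) :: real)"
      proof (cases "scan n s X")
        case True
        then obtain S where S: "S \<in> cubes d n s" "a \<le> (\<Sum>i\<in>S. X i)" using scan by blast
        have "of_bool (a \<le> (\<Sum>i\<in>S. X i)) \<le> (\<Sum>S\<in>cubes d n s. of_bool (a \<le> (\<Sum>i\<in>S. X i)) :: real)"
          using S cub by (intro member_le_sum) auto
        then show ?thesis using S True by simp
      qed (simp add: sum_nonneg)
    qed (simp add: V_def finite_cube)
    also have "\<dots> = (\<Sum>S\<in>cubes d n s. mean V J (\<lambda>_. 0) (\<lambda>X. of_bool (a \<le> (\<Sum>i\<in>S. X i))))"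
      by (rule mean_sum)
    also have "\<dots> \<le> (\<Sum>S\<in>cubes d n s. exp (- 2 * \<nu>))"
    proof (rule sum_mono)
      fix S assume S: "S \<in> cubes d n s"
      have "mean V J (\<lambda>_. 0) (\<lambda>X. of_bool (a \<le> (\<Sum>i\<in>S. X i)))
          \<le> exp (real (card S) * ((1 + sus) * l\<^sup>2) - l * a)"
        unfolding V_def J_def using cubS[OF S] l by (intro model.chernoff) (auto simp: V_def)
      also have "real (card S) * ((1 + sus) * l\<^sup>2) - l * a = (1 + sus) * (m * l\<^sup>2) - l * a"
        using cubS[OF S] by simp
      also have "\<dots> = - 2 * \<nu>" unfolding l2 la by (simp add: \<kappa>_def algebra_simps)
      finally show "mean V J (\<lambda>_. 0) (\<lambda>X. of_bool (a \<le> (\<Sum>i\<in>S. X i))) \<le> exp (- 2 * \<nu>)" .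
    qed
    also have "\<dots> \<le> (3 ^ d * real n) * exp (- 2 * \<nu>)" using cub(2) by simp
    also have "\<dots> = 3 ^ d / real n"
    proof -
      have "exp (- 2 * \<nu>) = inverse (exp \<nu> * exp \<nu>)" by (simp add: exp_minus exp_add[symmetric])
      also have "exp \<nu> = real n" using n by (simp add: \<nu>_def)
      finally show ?thesis using n by (simp add: field_simps)
    qed
    finally show ?thesis
      unfolding prob_lattice_ising box_eq V_def J_def .
  qed
  have type2: "measure_pmf.prob (lattice_ising d L \<beta> n \<mu>) {X. \<not> scan n s X} \<le> sus / \<nu>"
    if \<mu>: "\<mu> \<in> alternatives (box d n) (cubes d n s) A" for \<mu>
  proof -
    define S where "S = supp V \<mu>"
    have S: "S \<in> cubes d n s" and \<mu>A: "\<And>i. i \<in> S \<Longrightarrow> A \<le> \<mu> i" and \<mu>0: "\<And>i. i \<in> V \<Longrightarrow> 0 \<le> \<mu> i"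
      using \<mu> by (auto simp: alternatives_def S_def V_def box_eq[symmetric] PiE_iff)
    have SV: "S \<subseteq> V" and Sm: "real (card S) = m" using cubS[OF S] by auto
    \<comment> \<open>The unit between \<open>3 + sus\<close> and \<open>4 + sus\<close>: under the
      alternative the mean exceeds the threshold by at least g.\<close>
    define g where "g = sqrt (m * \<nu>)"
    have g: "0 < g" using m \<nu> by (simp add: g_def)
    have "mean V J \<mu> (\<lambda>X. of_bool (\<not> scan n s X)) \<le> mean V J \<mu> (\<lambda>X. of_bool ((\<Sum>i\<in>S. X i) < a))"
      using S scan by (intro mean_le) (auto simp: V_def finite_cube not_le[symmetric])
    also have "\<dots> \<le> real (card S) * sus / g\<^sup>2"
      unfolding V_def J_def
    proof (rule model.chebyshev)
      have "a + g = m * ((4 + sus) * sqrt (\<nu> / m))"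
      proof -
        have "m * sqrt (\<nu> / m) = sqrt (m * m) * sqrt (\<nu> / m)" using m by simp
        also have "\<dots> = sqrt (m * \<nu>)" using m by (simp only: real_sqrt_mult[symmetric]) simp
        finally have e: "m * sqrt (\<nu> / m) = sqrt (m * \<nu>)" .
        have "a + g = (4 + sus) * sqrt (m * \<nu>)" by (simp add: a_def g_def \<kappa>_def algebra_simps)
        then show ?thesis unfolding e[symmetric] by simp
      qed
      also have "\<dots> \<le> m * ((4 + sus) * sqrt (\<nu> / real s))"
        using m \<nu> s ms sus_pos by (intro mult_left_mono real_sqrt_le_mono divide_left_mono) auto
      also have "\<dots> \<le> m * tanh A" using tanh m by (intro mult_left_mono) (auto simp: \<nu>_def)
      also have "\<dots> = (\<Sum>i\<in>S. tanh A)" using Sm by simp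
      also have "\<dots> \<le> (\<Sum>i\<in>S. mean (cube d ?r) (lat d L \<beta>) \<mu> (\<lambda>x. x i))"
        using SV \<mu>A \<mu>0 A by (intro sum_mono model.tanh_le_mean) (auto simp: V_def)
      finally show "a + g \<le> (\<Sum>i\<in>S. mean (cube d ?r) (lat d L \<beta>) \<mu> (\<lambda>x. x i))" .
    qed (use SV \<mu>0 g in \<open>auto simp: V_def\<close>)
    also have "\<dots> = sus / \<nu>" using m \<nu> by (simp add: Sm g_def)
    finally show ?thesis
      unfolding prob_lattice_ising box_eq V_def J_def .
  qed
  have "cubes d n s \<noteq> {}"
  proof -
    have "0 < 2 ^ d * real (card (corners d ?r ?l))"
      using card_corners_ge[OF d s] n by (metis less_le_trans of_nat_0_less_iff less_trans zero_less_one)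
    then show ?thesis by (auto simp: cubes_eq[OF d])
  qed
  then have "alternatives (box d n) (cubes d n s) A \<noteq> {}"
    using spike_alternative A by blast
  then have "(SUP \<mu>\<in>alternatives (box d n) (cubes d n s) A.
      measure_pmf.prob (lattice_ising d L \<beta> n \<mu>) {X. \<not> scan n s X}) \<le> sus / \<nu>"
    using type2 by (intro cSUP_least)
  then show ?thesis using type1 by (simp add: risk_def \<nu>_def)
qed

text \<open>The supremum is one of real numbers, so a signal has to be exhibited before it can be
  bounded from below.\<close>

lemma risk_nonneg:
  assumes "0 < s" "s \<le> n" "0 < A"
  shows "0 \<le> risk d L \<beta> n s A T"
proof -
  have "0 < real n" using assms by simp
  then have "0 < 2 ^ d * real (card (corners d (radius d n) (side d s)))"
    using card_corners_ge[OF d assms(1,2)] by linarith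
  then obtain S where "S \<in> cubes d n s" by (force simp: cubes_eq[OF d])
  then have "measure_pmf.prob (lattice_ising d L \<beta> n (spike n A S)) {X. \<not> T X} \<le>
     (SUP \<mu>\<in>alternatives (box d n) (cubes d n s) A.
        measure_pmf.prob (lattice_ising d L \<beta> n \<mu>) {X. \<not> T X})"
    using assms by (intro cSUP_upper bdd_above_prob spike_alternative)
  moreover have "0 \<le> measure_pmf.prob (lattice_ising d L \<beta> n (spike n A S)) {X. \<not> T X}" by simp
  ultimately have "0 \<le> (SUP \<mu>\<in>alternatives (box d n) (cubes d n s) A.
        measure_pmf.prob (lattice_ising d L \<beta> n \<mu>) {X. \<not> T X})" by linarith
  then show ?thesis unfolding risk_def by (intro add_nonneg_nonneg) auto
qed

text \<open>For each fixed e the loss e is split between the term e / 2 and the second moment error.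
  The bound s' replaces s so that the limit concerns an explicit function of n in the
  applications.\<close>

lemma asymp_powerless_criterion:
  assumes "\<And>n. 0 < s n" "\<And>n. 0 < A n" "\<forall>\<^sub>F n in sequentially. s n \<le> n"
    and B: "\<forall>\<^sub>F n in sequentially. (tanh (A n))\<^sup>2 * (3 ^ d * real (s n) * sus) \<le> B n"
    and s': "\<forall>\<^sub>F n in sequentially. real (s n) \<le> s' n"
    and lim: "(\<lambda>n. exp (B n) * B n * s' n / real n) \<longlonglongrightarrow> 0"
  shows "asymp_powerless d L \<beta> s A T"
proof -
  have "\<forall>\<^sub>F n in sequentially. 1 - e < risk d L \<beta> n (s n) (A n) (T n)" if e: "0 < e" for e
  proof -
    define K where "K = 3 ^ d * 2 ^ d / (2 * e)"
    have K: "0 < K" using e by (simp add: K_def)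
    have "(\<lambda>n. K * (exp (B n) * B n * s' n / real n)) \<longlonglongrightarrow> K * 0"
      by (intro tendsto_mult tendsto_const lim)
    then have "\<forall>\<^sub>F n in sequentially. K * (exp (B n) * B n * s' n / real n) < e / 2"
      using e by (intro order_tendstoD(2)) auto
    then show ?thesis using assms(3) B s'
    proof eventually_elim
      case (elim n)
      have n: "0 < real n" using assms(1)[of n] elim by simp
      have "0 \<le> (tanh (A n))\<^sup>2 * (3 ^ d * real (s n) * sus)" using sus_pos by simp
      then have B0: "0 \<le> B n" using elim by linarith
      have "exp (B n) * B n * (3 ^ d * real (s n)) * 2 ^ d / (real n * (2 * e))
          \<le> exp (B n) * B n * (3 ^ d * s' n) * 2 ^ d / (real n * (2 * e))"
        using elim B0 n e by (intro divide_right_mono mult_right_mono mult_left_mono) auto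
      also have "\<dots> = K * (exp (B n) * B n * s' n / real n)"
        using n e by (simp add: K_def field_simps)
      also have "\<dots> < e / 2" by (rule elim(1))
      finally show ?case
        using risk_ge[OF assms(1) elim(2) assms(2) e elim(3), of "T n"] by linarith
    qed
  qed note ev = this
  show ?thesis
    unfolding asymp_powerless_def le_Liminf_iff
  proof (intro allI impI)
    fix y :: ereal assume y: "y < 1"
    then obtain z where z: "y < ereal z" "ereal z < 1" using ereal_dense2 by blast
    have "\<forall>\<^sub>F n in sequentially. 1 - (1 - z) < risk d L \<beta> n (s n) (A n) (T n)"
      using z by (intro ev) simp
    then show "\<forall>\<^sub>F n in sequentially. y < ereal (risk d L \<beta> n (s n) (A n) (T n))"
      by eventually_elim (use z in \<open>simp add: less_trans[of y "ereal z"]\<close>)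
  qed
qed

text \<open>The square of tanh is bounded by 1, whatever A is. The constant makes the exponent at
  most ln n / 2, so the error is of order (ln n)^2 / sqrt n.\<close>

lemma small_blocks_powerless:
  assumes reg: "testing_regime \<upsilon> s A"
    and small: "\<forall>\<^sub>F n in sequentially. real (s n) \<le> 1 / (2 * 3 ^ d * sus) * ln (real n)"
  shows "asymp_powerless d L \<beta> s A T"
proof (rule asymp_powerless_criterion)
  let ?c = "1 / (2 * 3 ^ d * sus)"
  have c: "0 < ?c" using sus_pos by simp
  show "0 < s n" "0 < A n" for n using reg by (auto simp: testing_regime_def)
  show "\<forall>\<^sub>F n in sequentially. real (s n) \<le> ?c * ln (real n)" by (rule small)
  have "(\<lambda>n. ?c * ln (real n) / real n) \<longlonglongrightarrow> 0" by real_asymp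
  then have "\<forall>\<^sub>F n in sequentially. ?c * ln (real n) / real n < 1" by (rule order_tendstoD) simp
  then show "\<forall>\<^sub>F n in sequentially. s n \<le> n"
    using small eventually_gt_at_top[of 0]
  proof eventually_elim
    case (elim n)
    then have "?c * ln (real n) < real n"
      by (simp only: pos_divide_less_eq of_nat_0_less_iff mult_1)
    then have "real (s n) \<le> real n" using elim(2) by linarith
    then show ?case by simp
  qed
  show "\<forall>\<^sub>F n in sequentially. (tanh (A n))\<^sup>2 * (3 ^ d * real (s n) * sus) \<le> ln (real n) / 2"
    using small
  proof eventually_elim
    case (elim n)
    have "(tanh (A n))\<^sup>2 \<le> 1"
      using tanh_real_bounds[of "A n"] by (simp add: abs_square_le_1 abs_le_iff)
    then have "(tanh (A n))\<^sup>2 * (3 ^ d * real (s n) * sus) \<le> 1 * (3 ^ d * real (s n) * sus)"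
      using sus_pos by (intro mult_right_mono) auto
    also have "\<dots> \<le> 3 ^ d * (?c * ln (real n)) * sus"
      unfolding mult_1 by (rule mult_right_mono[OF mult_left_mono[OF elim]]) (use sus_pos in auto)
    also have "\<dots> = ln (real n) / 2" using sus_pos by (simp add: field_simps)
    finally show ?case .
  qed
  show "(\<lambda>n. exp (ln (real n) / 2) * (ln (real n) / 2) * (?c * ln (real n)) / real n) \<longlonglongrightarrow> 0"
    by real_asymp
qed

lemma eventually_le_self:
  assumes "testing_regime \<upsilon> s A" "0 < \<upsilon>"
  shows "\<forall>\<^sub>F n in sequentially. s n \<le> n"
proof -
  have "\<forall>\<^sub>F n in sequentially. real (s n) \<le> real n powr (1 - \<upsilon>)"
    using assms by (simp add: testing_regime_def)
  then show ?thesis using eventually_gt_at_top[of 0]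
  proof eventually_elim
    case (elim n)
    have "real n powr (1 - \<upsilon>) \<le> real n powr 1" using elim assms(2) by (intro powr_mono) auto
    then have "real (s n) \<le> real n" using elim by simp
    then show ?case by simp
  qed
qed

text \<open>The constant makes the exponent at most (\<upsilon> / 2) ln n; with s at most n^(1 -
  \<upsilon>) the error is of order n^(-\<upsilon>/2) ln n.\<close>

lemma weak_signal_powerless:
  assumes reg: "testing_regime \<upsilon> s A" and \<upsilon>: "0 < \<upsilon>"
    and weak: "\<forall>\<^sub>F n in sequentially.
      tanh (A n) \<le> sqrt (\<upsilon> / (2 * 3 ^ d * sus)) * sqrt (ln (real n) / real (s n))"
  shows "asymp_powerless d L \<beta> s A T"
proof (rule asymp_powerless_criterion)
  show s: "0 < s n" and A: "0 < A n" for n using reg by (auto simp: testing_regime_def)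
  show "\<forall>\<^sub>F n in sequentially. real (s n) \<le> real n powr (1 - \<upsilon>)"
    using reg by (simp add: testing_regime_def)
  show "\<forall>\<^sub>F n in sequentially. s n \<le> n" by (rule eventually_le_self[OF reg \<upsilon>])
  show "\<forall>\<^sub>F n in sequentially. (tanh (A n))\<^sup>2 * (3 ^ d * real (s n) * sus) \<le> \<upsilon> / 2 * ln (real n)"
    using weak eventually_gt_at_top[of 0]
  proof eventually_elim
    case (elim n)
    have "0 \<le> tanh (A n)" using A[of n] by simp
    then have "(tanh (A n))\<^sup>2 \<le> (sqrt (\<upsilon> / (2 * 3 ^ d * sus)) * sqrt (ln (real n) / real (s n)))\<^sup>2"
      using elim by (intro power_mono) auto
    also have "\<dots> = \<upsilon> / (2 * 3 ^ d * sus) * (ln (real n) / real (s n))"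
      using \<upsilon> sus_pos elim(2) by (simp add: power_mult_distrib)
    finally have "(tanh (A n))\<^sup>2 * (3 ^ d * real (s n) * sus)
        \<le> \<upsilon> / (2 * 3 ^ d * sus) * (ln (real n) / real (s n)) * (3 ^ d * real (s n) * sus)"
      using sus_pos by (intro mult_right_mono) auto
    also have "\<dots> = \<upsilon> / 2 * ln (real n)" using sus_pos s[of n] by (simp add: field_simps)
    finally show ?case .
  qed
  show "(\<lambda>n. exp (\<upsilon> / 2 * ln (real n)) * (\<upsilon> / 2 * ln (real n)) * real n powr (1 - \<upsilon>) / real n) \<longlonglongrightarrow> 0"
    using \<upsilon> by real_asymp
qed

lemma strong_signal_powerful:
  assumes reg: "testing_regime \<upsilon> s A" and \<upsilon>: "0 < \<upsilon>"
    and large: "\<forall>\<^sub>F n in sequentially. ln (real n) \<le> real (s n)"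
    and strong: "\<forall>\<^sub>F n in sequentially. (4 + sus) * sqrt (ln (real n) / real (s n)) \<le> tanh (A n)"
  shows "asymp_powerful d L \<beta> s A (\<lambda>n. scan n (s n))"
proof -
  have s: "0 < s n" and A: "0 < A n" for n using reg by (auto simp: testing_regime_def)
  note sn = eventually_le_self[OF reg \<upsilon>]
  have "(\<lambda>n. risk d L \<beta> n (s n) (A n) (scan n (s n))) \<longlonglongrightarrow> 0"
  proof (rule tendsto_sandwich)
    \<comment> \<open>Powerfulness asks for a limit superior equal to 0, hence for a lower bound
      too.\<close>
    show "\<forall>\<^sub>F n in sequentially. 0 \<le> risk d L \<beta> n (s n) (A n) (scan n (s n))"
      using sn by eventually_elim (rule risk_nonneg[OF s _ A])
    show "\<forall>\<^sub>F n in sequentially. risk d L \<beta> n (s n) (A n) (scan n (s n)) \<le> 3 ^ d / real n + sus / ln (real n)"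
      using sn large strong eventually_gt_at_top[of 1]
      by eventually_elim (rule risk_scan_le[OF s _ _ _ A])
    show "(\<lambda>n. 3 ^ d / real n + sus / ln (real n)) \<longlonglongrightarrow> 0" by real_asymp
  qed simp
  then have "(\<lambda>n. ereal (risk d L \<beta> n (s n) (A n) (scan n (s n)))) \<longlonglongrightarrow> ereal 0" by simp
  then show ?thesis
    unfolding asymp_powerful_def using lim_imp_Limsup by (metis trivial_limit_sequentially zero_ereal_def)
qed

end

theorem theorem8:
  fixes d L :: nat and \<beta> :: real
  assumes "1 \<le> d" and "1 \<le> L"
    and "0 \<le> \<beta>" and "ereal \<beta> < beta_c d L"
  shows "\<exists>c>0. \<exists>C>0. \<forall>\<upsilon>>0.
    (\<forall>s A. testing_regime \<upsilon> s A \<longrightarrow>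
       (\<forall>\<^sub>F n in sequentially. real (s n) \<le> c * ln (real n)) \<longrightarrow>
       (\<forall>T. asymp_powerless d L \<beta> s A T)) \<and>
    (\<exists>c'>0. \<exists>C'>0. \<forall>s A. testing_regime \<upsilon> s A \<longrightarrow>
       (\<forall>\<^sub>F n in sequentially. C * ln (real n) \<le> real (s n)) \<longrightarrow>
       ((\<forall>\<^sub>F n in sequentially. C' * sqrt (ln (real n) / real (s n)) \<le> tanh (A n)) \<longrightarrow>
          (\<exists>T. asymp_powerful d L \<beta> s A T)) \<and>
       ((\<forall>\<^sub>F n in sequentially. tanh (A n) \<le> c' * sqrt (ln (real n) / real (s n))) \<longrightarrow>
          (\<forall>T. asymp_powerless d L \<beta> s A T)))"
proof -
  obtain S where S: "finite S" "S \<subseteq> points d" "origin d \<in> S" "phi d L \<beta> (origin d) S < 1"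
    using exists_phi_less_one[OF assms(1,3,4)] by blast
  define sus where "sus = real (card S) / (1 - phi d L \<beta> (origin d) S)"
  have "0 < card S" using S by (auto simp: card_gt_0_iff)
  then have pos: "0 < sus" using S by (simp add: sus_def)
  interpret high_temperature d L \<beta> sus
    by unfold_locales (use assms pos susceptibility_bound[OF assms(3) S] in \<open>auto simp: sus_def\<close>)
  have c: "0 < 1 / (2 * 3 ^ d * sus)" using pos by simp
  show ?thesis
  \<comment> \<open>The witness C = 1 is the requirement that blocks have at least ln n sites.
    Neither c nor C involves \<upsilon>.\<close>
  proof (rule exI[of _ "1 / (2 * 3 ^ d * sus)"], rule conjI[OF c], rule exI[of _ 1],
      rule conjI[OF zero_less_one], intro conjI allI impI)
    fix \<upsilon> :: real and s A T
    assume "testing_regime \<upsilon> s A" "\<forall>\<^sub>F n in sequentially. real (s n) \<le> 1 / (2 * 3 ^ d * sus) * ln (real n)"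
    then show "asymp_powerless d L \<beta> s A T" by (rule small_blocks_powerless)
  next
    fix \<upsilon> :: real assume \<upsilon>: "0 < \<upsilon>"
    \<comment> \<open>This constant depends on \<upsilon>, as the number of essentially disjoint
      positions is of order n / s and at least of order n^\<upsilon>.\<close>
    define c' where "c' = sqrt (\<upsilon> / (2 * 3 ^ d * sus))"
    have c': "0 < c'" and C': "0 < 4 + sus" using \<upsilon> pos by (simp_all add: c'_def)
    have main: "\<forall>s A. testing_regime \<upsilon> s A \<longrightarrow>
       (\<forall>\<^sub>F n in sequentially. 1 * ln (real n) \<le> real (s n)) \<longrightarrow>
       ((\<forall>\<^sub>F n in sequentially. (4 + sus) * sqrt (ln (real n) / real (s n)) \<le> tanh (A n)) \<longrightarrow>
          (\<exists>T. asymp_powerful d L \<beta> s A T)) \<and>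
       ((\<forall>\<^sub>F n in sequentially. tanh (A n) \<le> c' * sqrt (ln (real n) / real (s n))) \<longrightarrow>
          (\<forall>T. asymp_powerless d L \<beta> s A T))"
      using strong_signal_powerful[OF _ \<upsilon>] weak_signal_powerless[OF _ \<upsilon>]
      unfolding c'_def mult_1 by blast
    show "\<exists>c'>0. \<exists>C'>0. \<forall>s A. testing_regime \<upsilon> s A \<longrightarrow>
       (\<forall>\<^sub>F n in sequentially. 1 * ln (real n) \<le> real (s n)) \<longrightarrow>
       ((\<forall>\<^sub>F n in sequentially. C' * sqrt (ln (real n) / real (s n)) \<le> tanh (A n)) \<longrightarrow>
          (\<exists>T. asymp_powerful d L \<beta> s A T)) \<and>
       ((\<forall>\<^sub>F n in sequentially. tanh (A n) \<le> c' * sqrt (ln (real n) / real (s n))) \<longrightarrow>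
          (\<forall>T. asymp_powerless d L \<beta> s A T))"
      by (rule exI[of _ c'], rule conjI[OF c'], rule exI[of _ "4 + sus"], rule conjI[OF C'], rule main)
  qed
qed

end
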